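(* The braid group $B_3(P^2)$ on $3$ strings of the projective plane $P^2$ embeds in $\mathrm{SL}_{96}(\mathbb{Z})$, i.e. there is an injective homomorphism $B_3(P^2)\to\mathrm{SL}_{96}(\mathbb{Z})$.
   Context: $B_n(P^2)$ is the fundamental group of the orbit space $F_n(P^2)/S_n$, where $F_n(P^2)$ is the space of ordered $n$-tuples of distinct points of the real projective plane $P^2$ and $S_n$ permutes coordinates. For $n=3$ it has the presentation with generators $\delta_1,\delta_2,\rho_1,\rho_2,\rho_3$ and defining relations $\delta_1\delta_2\delta_1=\delta_2\delta_1\delta_2$; $\delta_1\rho_3=\rho_3\delta_1$; $\delta_2\rho_1=\rho_1\delta_2$; $\rho_i=\delta_i\rho_{i+1}\delta_i$ ($i=1,2$); $\rho_{i+1}^{-1}\rho_i^{-1}\rho_{i+1}\rho_i=\delta_i^2$ ($i=1,2$); $\delta_1\delta_2^2\delta_1=\rho_1^2$. *)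

theory Defs
  imports
    "HOL-Analysis.Analysis"
    "HOL-Algebra.Group"
    "HOL-Combinatorics.Permutations"
begin

section \<open>Quotient topology\<close>

definition quotient_topology :: "'a topology \<Rightarrow> ('a \<Rightarrow> 'b) \<Rightarrow> 'b topology" where
  "quotient_topology X f =
     topology (\<lambda>U. U \<subseteq> f ` topspace X \<and> openin X {x \<in> topspace X. f x \<in> U})"

lemma openin_quotient_topology:
  "openin (quotient_topology X f) U \<longleftrightarrow>
     U \<subseteq> f ` topspace X \<and> openin X {x \<in> topspace X. f x \<in> U}"
proof -
  have "istopology (\<lambda>U. U \<subseteq> f ` topspace X \<and> openin X {x \<in> topspace X. f x \<in> U})"
    unfolding istopology_def
  proof (intro conjI allI impI; (elim conjE)?)
    fix S T
    assume "S \<subseteq> f ` topspace X" "openin X {x \<in> topspace X. f x \<in> S}"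
      "openin X {x \<in> topspace X. f x \<in> T}"
    moreover have "{x \<in> topspace X. f x \<in> S \<inter> T} =
        {x \<in> topspace X. f x \<in> S} \<inter> {x \<in> topspace X. f x \<in> T}"
      by auto
    ultimately show "S \<inter> T \<subseteq> f ` topspace X" "openin X {x \<in> topspace X. f x \<in> S \<inter> T}"
      by (auto intro: openin_Int)
  next
    fix \<K>
    assume *: "\<forall>K\<in>\<K>. K \<subseteq> f ` topspace X \<and> openin X {x \<in> topspace X. f x \<in> K}"
    then show "\<Union>\<K> \<subseteq> f ` topspace X"
      by blast
    have "{x \<in> topspace X. f x \<in> \<Union>\<K>} = (\<Union>K\<in>\<K>. {x \<in> topspace X. f x \<in> K})"
      by auto
    moreover have "openin X (\<Union>K\<in>\<K>. {x \<in> topspace X. f x \<in> K})"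
      using * by (intro openin_Union) auto
    ultimately show "openin X {x \<in> topspace X. f x \<in> \<Union>\<K>}"
      by simp
  qed
  then show ?thesis
    by (simp add: quotient_topology_def)
qed

lemma topspace_quotient_topology [simp]:
  "topspace (quotient_topology X f) = f ` topspace X"
proof
  show "topspace (quotient_topology X f) \<subseteq> f ` topspace X"
    using openin_quotient_topology [of X f] openin_topspace by blast
  have "{x \<in> topspace X. f x \<in> f ` topspace X} = topspace X"
    by auto
  then have "openin (quotient_topology X f) (f ` topspace X)"
    by (simp add: openin_quotient_topology)
  then show "f ` topspace X \<subseteq> topspace (quotient_topology X f)"
    by (rule openin_subset)
qed

lemma quotient_map_quotient_topology: "quotient_map X (quotient_topology X f) f"
  by (simp add: quotient_map_def openin_quotient_topology)


section \<open>Fundamental group\<close>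

text \<open>
  The library operations on paths (\<open>(+++)\<close>, \<open>homotopic_paths\<close>) are restricted to
  topological type classes; here the space is an abstract topology.
  Paths are compared only on \<open>{0..1}\<close>: functions agreeing there are homotopic.
\<close>

definition loops :: "'a topology \<Rightarrow> 'a \<Rightarrow> (real \<Rightarrow> 'a) set" where
  "loops X b = {p. pathin X p \<and> p 0 = b \<and> p 1 = b}"

definition loop_homotopic :: "'a topology \<Rightarrow> 'a \<Rightarrow> (real \<Rightarrow> 'a) \<Rightarrow> (real \<Rightarrow> 'a) \<Rightarrow> bool" where
  "loop_homotopic X b = homotopic_with (\<lambda>r. r 0 = b \<and> r 1 = b) (top_of_set {0..1}) X"

definition loop_join :: "(real \<Rightarrow> 'a) \<Rightarrow> (real \<Rightarrow> 'a) \<Rightarrow> real \<Rightarrow> 'a" where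
  "loop_join p q = (\<lambda>s. if s \<le> 1/2 then p (2 * s) else q (2 * s - 1))"

definition loop_class :: "'a topology \<Rightarrow> 'a \<Rightarrow> (real \<Rightarrow> 'a) \<Rightarrow> (real \<Rightarrow> 'a) set" where
  "loop_class X b p = {q. loop_homotopic X b p q}"

definition fundamental_group :: "'a topology \<Rightarrow> 'a \<Rightarrow> (real \<Rightarrow> 'a) set monoid" where
  "fundamental_group X b =
     \<lparr>carrier = loop_class X b ` loops X b,
      mult = (\<lambda>A B. \<Union>p\<in>A. \<Union>q\<in>B. loop_class X b (loop_join p q)),
      one = loop_class X b (\<lambda>_. b)\<rparr>"

lemma loop_homotopic_imp_loops:
  assumes "loop_homotopic X b p q"
  shows "p \<in> loops X b" "q \<in> loops X b"
  using homotopic_with_imp_continuous_maps [OF assms [unfolded loop_homotopic_def]]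
    homotopic_with_imp_property [OF assms [unfolded loop_homotopic_def]]
  by (auto simp: loops_def pathin_def)

lemma loop_homotopic_refl: "p \<in> loops X b \<Longrightarrow> loop_homotopic X b p p"
  by (simp add: loop_homotopic_def loops_def pathin_def)

lemma loop_homotopic_sym: "loop_homotopic X b p q \<Longrightarrow> loop_homotopic X b q p"
  by (simp add: loop_homotopic_def homotopic_with_sym)

lemma loop_homotopic_trans:
  "loop_homotopic X b p q \<Longrightarrow> loop_homotopic X b q r \<Longrightarrow> loop_homotopic X b p r"
  unfolding loop_homotopic_def by (rule homotopic_with_trans)

lemma loop_class_eq_iff:
  "p \<in> loops X b \<Longrightarrow> loop_class X b p = loop_class X b q \<longleftrightarrow> loop_homotopic X b p q"
proof
  assume p: "p \<in> loops X b" and "loop_class X b p = loop_class X b q"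
  then have "p \<in> loop_class X b q"
    using loop_homotopic_refl [OF p] by (auto simp: loop_class_def)
  then show "loop_homotopic X b p q"
    by (simp add: loop_class_def loop_homotopic_sym)
next
  assume "loop_homotopic X b p q"
  then show "loop_class X b p = loop_class X b q"
    unfolding loop_class_def
    by (intro Collect_cong iffI) (blast intro: loop_homotopic_sym loop_homotopic_trans)+
qed

lemma loop_homotopic_join:
  assumes "loop_homotopic X b p p'" "loop_homotopic X b q q'"
  shows "loop_homotopic X b (loop_join p q) (loop_join p' q')"
proof -
  let ?I = "top_of_set {0..1::real}"
  let ?II = "prod_topology ?I ?I"
  obtain h where h: "continuous_map ?II X h" "\<And>s. h (0, s) = p s" "\<And>s. h (1, s) = p' s"
      "\<And>t. t \<in> {0..1} \<Longrightarrow> h (t, 0) = b \<and> h (t, 1) = b"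
    using assms(1) unfolding loop_homotopic_def homotopic_with_def by auto
  obtain k where k: "continuous_map ?II X k" "\<And>s. k (0, s) = q s" "\<And>s. k (1, s) = q' s"
      "\<And>t. t \<in> {0..1} \<Longrightarrow> k (t, 0) = b \<and> k (t, 1) = b"
    using assms(2) unfolding loop_homotopic_def homotopic_with_def by auto
  let ?m = "\<lambda>z::real \<times> real.
    if snd z \<le> 1/2 then h (fst z, 2 * snd z) else k (fst z, 2 * snd z - 1)"
  have II: "?II = top_of_set ({0..1} \<times> {0..1})"
    by (simp add: prod_topology_subtopology subtopology_subtopology Times_Int_Times
        flip: euclidean_product_topology)
  have "continuous_map ?II X ?m"
  proof (rule continuous_map_cases_le)
    show "continuous_map ?II euclideanreal snd"
      by (simp add: II continuous_on_snd continuous_on_id)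
    show "continuous_map ?II euclideanreal (\<lambda>_. 1/2)"
      by simp
    have "continuous_map (subtopology ?II {z \<in> topspace ?II. snd z \<le> 1/2}) ?II
            (\<lambda>z. (fst z, 2 * snd z))"
      unfolding II by (auto simp: subtopology_subtopology intro!: continuous_intros)
    from continuous_map_compose [OF this h(1)]
    show "continuous_map (subtopology ?II {z \<in> topspace ?II. snd z \<le> 1/2}) X
            (\<lambda>z. h (fst z, 2 * snd z))"
      by (simp only: o_def)
    have "continuous_map (subtopology ?II {z \<in> topspace ?II. 1/2 \<le> snd z}) ?II
            (\<lambda>z. (fst z, 2 * snd z - 1))"
      unfolding II by (auto simp: subtopology_subtopology intro!: continuous_intros)
    from continuous_map_compose [OF this k(1)]
    show "continuous_map (subtopology ?II {z \<in> topspace ?II. 1/2 \<le> snd z}) X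
            (\<lambda>z. k (fst z, 2 * snd z - 1))"
      by (simp only: o_def)
    show "h (fst z, 2 * snd z) = k (fst z, 2 * snd z - 1)"
      if "z \<in> topspace ?II" "snd z = 1/2" for z
    proof -
      from that have "2 * snd z = 1" "fst z \<in> {0..1}"
        by auto
      with h(4) k(4) show ?thesis
        by simp
    qed
  qed
  then show ?thesis
    unfolding loop_homotopic_def homotopic_with_def
    by (intro exI [of _ ?m]) (use h k in \<open>auto simp: loop_join_def\<close>)
qed

lemma loop_join_loops:
  "p \<in> loops X b \<Longrightarrow> q \<in> loops X b \<Longrightarrow> loop_join p q \<in> loops X b"
  by (rule loop_homotopic_imp_loops(1) [OF loop_homotopic_join])
    (rule loop_homotopic_refl, assumption)+

lemma loop_homotopic_reparam:
  assumes p: "p \<in> loops X b"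
    and f: "continuous_on {0..1} f" "f ` {0..1} \<subseteq> {0..1}"
    and g: "continuous_on {0..1} g" "g ` {0..1} \<subseteq> {0..1}"
    and fg: "f 0 = g 0" "f 1 = g 1" "p (f 0) = b" "p (f 1) = b"
  shows "loop_homotopic X b (p \<circ> f) (p \<circ> g)"
proof -
  let ?P = "\<lambda>r. r 0 = f 0 \<and> r 1 = f 1"
  let ?I = "top_of_set {0..1::real}"
  let ?h = "\<lambda>z::real \<times> real. (1 - fst z) * f (snd z) + fst z * g (snd z)"
  have "homotopic_with ?P ?I ?I f g"
    unfolding homotopic_with_def
  proof (intro exI [of _ ?h] conjI ballI allI)
    have II: "prod_topology ?I ?I = top_of_set ({0..1} \<times> {0..1})"
      by (simp add: prod_topology_subtopology subtopology_subtopology Times_Int_Times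
          flip: euclidean_product_topology)
    have "continuous_on ({0..1} \<times> {0..1}) ?h"
      by (intro continuous_intros continuous_on_compose2 [OF f(1)] continuous_on_compose2 [OF g(1)])
        auto
    moreover have "?h z \<in> {0..1}" if "z \<in> {0..1} \<times> {0..1}" for z
    proof -
      have "f (snd z) \<in> {0..1}" "g (snd z) \<in> {0..1}" "0 \<le> fst z" "fst z \<le> 1"
        using that f(2) g(2) by auto
      then show ?thesis
        using convexD_alt [of "{0..1::real}" "f (snd z)" "g (snd z)" "fst z"] by auto
    qed
    ultimately show "continuous_map (prod_topology ?I ?I) ?I ?h"
      unfolding II by (simp add: image_subset_iff_funcset [symmetric] image_subset_iff)
  qed (use fg in \<open>auto simp: algebra_simps\<close>)
  then have "homotopic_with (\<lambda>r. r 0 = b \<and> r 1 = b) ?I X (p \<circ> f) (p \<circ> g)"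
    by (rule homotopic_with_compose_continuous_map_left)
      (use p fg in \<open>auto simp: loops_def pathin_def\<close>)
  then show ?thesis
    by (simp add: loop_homotopic_def)
qed

lemma const_loops: "b \<in> topspace X \<Longrightarrow> (\<lambda>_. b) \<in> loops X b"
  by (simp add: loops_def pathin_def)

lemma fundamental_group_mult:
  assumes "p \<in> loops X b" "q \<in> loops X b"
  shows "loop_class X b p \<otimes>\<^bsub>fundamental_group X b\<^esub> loop_class X b q =
           loop_class X b (loop_join p q)"
proof -
  let ?j = "loop_class X b (loop_join p q)"
  have const: "loop_class X b (loop_join p' q') = ?j"
    if "p' \<in> loop_class X b p" "q' \<in> loop_class X b q" for p' q'
  proof -
    have "loop_homotopic X b (loop_join p q) (loop_join p' q')"
      using that by (intro loop_homotopic_join) (simp_all add: loop_class_def)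
    then show ?thesis
      using loop_class_eq_iff [OF loop_join_loops [OF assms], of "loop_join p' q'"] by simp
  qed
  have "p \<in> loop_class X b p" "q \<in> loop_class X b q"
    using assms by (simp_all add: loop_class_def loop_homotopic_refl)
  then have "(\<Union>p'\<in>loop_class X b p. \<Union>q'\<in>loop_class X b q. ?j) = ?j"
    by blast
  moreover have "(\<Union>p'\<in>loop_class X b p. \<Union>q'\<in>loop_class X b q.
      loop_class X b (loop_join p' q')) =
      (\<Union>p'\<in>loop_class X b p. \<Union>q'\<in>loop_class X b q. ?j)"
    by (intro SUP_cong refl const)
  ultimately show ?thesis
    by (simp add: fundamental_group_def)
qed

theorem group_fundamental_group:
  assumes b: "b \<in> topspace X"
  shows "group (fundamental_group X b)"
proof (rule groupI)
  let ?G = "fundamental_group X b" and ?c = "loop_class X b"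
  have carr: "carrier ?G = ?c ` loops X b" and one: "\<one>\<^bsub>?G\<^esub> = ?c (\<lambda>_. b)"
    by (auto simp: fundamental_group_def)
  show "\<one>\<^bsub>?G\<^esub> \<in> carrier ?G"
    using const_loops [OF b] by (simp add: carr one)
  show "x \<otimes>\<^bsub>?G\<^esub> y \<in> carrier ?G" if "x \<in> carrier ?G" "y \<in> carrier ?G" for x y
    using that by (auto simp: carr fundamental_group_mult loop_join_loops)
  show "(x \<otimes>\<^bsub>?G\<^esub> y) \<otimes>\<^bsub>?G\<^esub> z = x \<otimes>\<^bsub>?G\<^esub> (y \<otimes>\<^bsub>?G\<^esub> z)"
    if xyz: "x \<in> carrier ?G" "y \<in> carrier ?G" "z \<in> carrier ?G" for x y z
  proof -
    obtain p q r where pqr: "p \<in> loops X b" "q \<in> loops X b" "r \<in> loops X b"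
        "x = ?c p" "y = ?c q" "z = ?c r"
      using xyz by (auto simp: carr)
    let ?l = "loop_join (loop_join p q) r"
    let ?f = "\<lambda>s::real. max (s / 2) (max (s - 1/4) (2 * s - 1))"
    have l: "?l \<in> loops X b"
      by (simp add: pqr loop_join_loops)
    have pqr01: "p 1 = b" "q 0 = b" "q 1 = b" "r 0 = b"
      using pqr by (auto simp: loops_def)
    have eq: "loop_join p (loop_join q r) = ?l \<circ> ?f"
    proof
      fix s :: real
      consider "s \<le> 1/2" | "1/2 < s" "s \<le> 3/4" | "3/4 < s" by linarith
      then show "loop_join p (loop_join q r) s = (?l \<circ> ?f) s"
      proof cases
        case 1
        then have "?f s = s / 2" by auto
        with 1 show ?thesis by (simp add: loop_join_def)
      next
        case 2
        then have f: "?f s = s - 1/4" by auto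
        have "2 * (2 * (s - 1/4)) - 1 = 2 * (2 * s - 1)" by simp
        with 2 f show ?thesis by (simp add: loop_join_def)
      next
        case 3
        then have f: "?f s = 2 * s - 1" by auto
        with 3 show ?thesis by (simp add: loop_join_def)
      qed
    qed
    have f: "continuous_on {0..1} ?f" "?f ` {0..1} \<subseteq> {0..1}" "?f 0 = 0" "?f 1 = 1"
      by (auto intro!: continuous_intros simp: le_max_iff_disj)
    have "loop_homotopic X b (?l \<circ> id) (?l \<circ> ?f)"
      by (rule loop_homotopic_reparam [OF l _ _ f(1,2)])
        (use l f(3,4) in \<open>simp_all add: loops_def\<close>)
    then have "loop_homotopic X b ?l (loop_join p (loop_join q r))"
      by (simp only: eq comp_id)
    then show ?thesis
      using l by (simp add: pqr fundamental_group_mult loop_join_loops loop_class_eq_iff)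
  qed
  show "\<one>\<^bsub>?G\<^esub> \<otimes>\<^bsub>?G\<^esub> x = x" if x: "x \<in> carrier ?G" for x
  proof -
    obtain p where p: "p \<in> loops X b" "x = ?c p"
      using x by (auto simp: carr)
    have eq: "loop_join (\<lambda>_. b) p = p \<circ> (\<lambda>s. max 0 (2 * s - 1))"
    proof
      fix s :: real
      show "loop_join (\<lambda>_. b) p s = (p \<circ> (\<lambda>s. max 0 (2 * s - 1))) s"
        by (cases "s \<le> 1/2") (use p in \<open>simp_all add: loop_join_def loops_def max_absorb1 max_absorb2\<close>)
    qed
    have "loop_homotopic X b (p \<circ> (\<lambda>s. max 0 (2 * s - 1))) (p \<circ> id)"
      by (rule loop_homotopic_reparam [OF p(1)])
        (use p in \<open>auto simp: loops_def intro!: continuous_intros\<close>)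
    then have "loop_homotopic X b (loop_join (\<lambda>_. b) p) p"
      by (simp only: eq comp_id)
    then show ?thesis
      using p const_loops [OF b]
      by (simp add: one fundamental_group_mult loop_join_loops loop_class_eq_iff)
  qed
  show "\<exists>y\<in>carrier ?G. y \<otimes>\<^bsub>?G\<^esub> x = \<one>\<^bsub>?G\<^esub>" if x: "x \<in> carrier ?G" for x
  proof -
    obtain p where p: "p \<in> loops X b" "x = ?c p"
      using x by (auto simp: carr)
    let ?r = "p \<circ> (\<lambda>s. 1 - s)"
    have r: "?r \<in> loops X b"
    proof -
      have "continuous_map (top_of_set {0..1}) (top_of_set {0..1}) (\<lambda>s::real. 1 - s)"
        by (auto intro!: continuous_intros)
      then have "pathin X ?r"
        using p unfolding loops_def pathin_def by (blast intro: continuous_map_compose)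
      then show ?thesis
        using p by (simp add: loops_def)
    qed
    have eq: "loop_join ?r p = p \<circ> (\<lambda>s. \<bar>2 * s - 1\<bar>)"
    proof
      fix s :: real
      show "loop_join ?r p s = (p \<circ> (\<lambda>s. \<bar>2 * s - 1\<bar>)) s"
        by (cases "s \<le> 1/2") (simp_all add: loop_join_def)
    qed
    have const: "(\<lambda>_. b) = p \<circ> (\<lambda>_. 1)"
      using p by (auto simp: loops_def)
    have "loop_homotopic X b (p \<circ> (\<lambda>s. \<bar>2 * s - 1\<bar>)) (p \<circ> (\<lambda>_. 1))"
      by (rule loop_homotopic_reparam [OF p(1)])
        (use p in \<open>auto simp: loops_def intro!: continuous_intros\<close>)
    then have "loop_homotopic X b (loop_join ?r p) (\<lambda>_. b)"
      by (simp only: eq const)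
    then have "?c ?r \<otimes>\<^bsub>?G\<^esub> x = \<one>\<^bsub>?G\<^esub>"
      using p r by (simp add: one fundamental_group_mult loop_join_loops loop_class_eq_iff)
    with r show ?thesis
      by (auto simp: carr)
  qed
qed


section \<open>Configuration spaces and braid groups of the projective plane\<close>

text \<open>The unit sphere in \<open>\<real>\<^sup>3\<close> with antipodal points identified.\<close>

definition projective_plane :: "(real^3) set topology" where
  "projective_plane = quotient_topology (top_of_set (sphere 0 1)) (\<lambda>x. {x, - x})"

text \<open>An \<open>n\<close>-tuple is an extensional function on \<open>{..<n}\<close>.\<close>

definition ordered_config_space :: "nat \<Rightarrow> 'a topology \<Rightarrow> (nat \<Rightarrow> 'a) topology" where
  "ordered_config_space n X =
     subtopology (product_topology (\<lambda>_. X) {..<n}) {x. inj_on x {..<n}}"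

definition permutation_orbit :: "nat \<Rightarrow> (nat \<Rightarrow> 'a) \<Rightarrow> (nat \<Rightarrow> 'a) set" where
  "permutation_orbit n x = {x \<circ> \<sigma> |\<sigma>. \<sigma> permutes {..<n}}"

definition unordered_config_space :: "nat \<Rightarrow> 'a topology \<Rightarrow> (nat \<Rightarrow> 'a) set topology" where
  "unordered_config_space n X =
     quotient_topology (ordered_config_space n X) (permutation_orbit n)"

definition projective_braid_group ::
    "nat \<Rightarrow> (nat \<Rightarrow> (real^3) set) set \<Rightarrow> (real \<Rightarrow> (nat \<Rightarrow> (real^3) set) set) set monoid" where
  "projective_braid_group n b = fundamental_group (unordered_config_space n projective_plane) b"


section \<open>The special linear group\<close>

definition special_linear_group :: "('a::comm_ring_1^'n^'n) monoid" where
  "special_linear_group = \<lparr>carrier = {A. det A = 1}, mult = (**), one = mat 1\<rparr>"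

end

theory Submission
  imports Defs
begin

text \<open>
  Choose a unit vector on each of three distinct lines, and an order of the lines. The resulting space
  \<open>frames\<close> of triples of pairwise independent unit vectors carries a free isometric action of the 48
  signed permutations, and its quotient is the space of unordered triples of distinct lines. So it
  suffices to embed the fundamental group of \<open>frames\<close> into the special linear group of size two over the
  integers: inducing from a subgroup of index 48 gives a faithful representation of degree 96. Its
  matrices permute 48 blocks of size two, each of determinant one, so they have determinant one
  (\<open>det_block_monomial\<close>).

  By Gram-Schmidt a triple amounts to an orthonormal pair, a real number for the angle between the first
  two vectors, and the coordinates of the third vector. In a basis adapted to the first two vectors these
  coordinates range over the positive rays in space without two coordinate axes. Hence \<open>frames\<close> has the
  homotopy type of the product of the rotation group with the complement of two lines. The rotation group
  is doubly covered by the simply connected space of non-zero spinors, which accounts for a central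
  element of order two. The complement of the two lines is covered by two starlike sets, an upper and a
  lower one, meeting in four convex columns; it is homotopy equivalent to a graph with two vertices and
  four edges. Its group is free of rank three, and crossing the plane of the two lines downwards in the
  four quadrants is represented by the shears with off-diagonal entry \<open>2\<close> or \<open>- 2\<close>. A ping-pong argument
  shows that reduced words in these crossings differ from both the identity and its negative
  (\<open>word_not_central\<close>). The latter leaves room for the element of order two to act by \<open>- 1\<close>.

  Monodromy is encoded by locally defined matrix cocycles near the diagonal: such a cocycle becomes a
  coboundary on intervals and on squares, hence has a transport along paths that depends only on the
  homotopy class (\<open>transport_homotopic\<close>) and is multiplicative. A cocycle on \<open>frames\<close> induces one on the
  quotient (\<open>local_cocycle_induced\<close>). Faithfulness says that a loop with trivial transport is
  null-homotopic. Such a loop lifts to a closed loop of triples with trivial transport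
  (\<open>induced_transport_trivial\<close>); its orthonormal pair lifts to a closed loop of spinors; and the loop in
  the complement of the two lines is homotopic to a normal form that reads off a reduced word, which must
  be empty (\<open>crossing_transport_central\<close>). So it contracts in every factor (\<open>frame_loop_null\<close>).
\<close>

section \<open>Matrix transport along paths\<close>

text \<open>
  Near the diagonal, a matrix-valued function \<open>c\<close> satisfying the cocycle identity is the transition
  data of a flat bundle, so it has a monodromy along paths; the determinants put this monodromy into the
  special linear group. Working with \<open>c\<close> instead of a covering space keeps every construction inside
  functions on the given space: \<open>c\<close> may be discontinuous and take arbitrary values on distant pairs.
\<close>

definition cocycle_on :: "'a set \<Rightarrow> ('a \<Rightarrow> 'a \<Rightarrow> int^'n^'n) \<Rightarrow> bool" where
  "cocycle_on U c \<longleftrightarrow>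
     (\<forall>y\<in>U. c y y = mat 1) \<and> (\<forall>y\<in>U. \<forall>z\<in>U. det (c y z) = 1) \<and>
     (\<forall>y\<in>U. \<forall>z\<in>U. \<forall>w\<in>U. c y z ** c z w = c y w)"

definition local_cocycle :: "'a topology \<Rightarrow> ('a \<Rightarrow> 'a \<Rightarrow> int^'n^'n) \<Rightarrow> bool" where
  "local_cocycle X c \<longleftrightarrow> (\<forall>x\<in>topspace X. \<exists>U. openin X U \<and> x \<in> U \<and> cocycle_on U c)"

lemma local_cocycleE:
  assumes "local_cocycle X c" "x \<in> topspace X"
  obtains U where "openin X U" "x \<in> U" "cocycle_on U c"
  using assms unfolding local_cocycle_def by blast

text \<open>
  The function \<open>f\<close> is a flat section over the path, written in the trivialisation given by \<open>c\<close>.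
  Matrices act on the right of the starting value, so that transport along a concatenation is a
  product in the order of the paths.
\<close>

definition transport ::
    "('a \<Rightarrow> 'a \<Rightarrow> int^'n^'n) \<Rightarrow> (real \<Rightarrow> 'a) \<Rightarrow> int^'n^'n \<Rightarrow> int^'n^'n \<Rightarrow> bool" where
  "transport c \<gamma> M N \<longleftrightarrow>
     (\<exists>f d. 0 < d \<and> f 0 = M \<and> f 1 = N \<and>
        (\<forall>s\<in>{0..1}. \<forall>t\<in>{0..1}. \<bar>s - t\<bar> < d \<longrightarrow> f s ** c (\<gamma> s) (\<gamma> t) = f t))"

lemma fine_partition:
  fixes d :: real
  assumes "0 < d"
  obtains n :: nat where "0 < real n" "1 / real n < d"
proof -
  obtain m where "1 / real (Suc m) < d"
    using nat_approx_posE [OF assms] by blast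
  then show thesis
    using that [of "Suc m"] by simp
qed

lemma compact_uniform_nhds:
  fixes K :: "'a::metric_space set"
  assumes "compact K"
    and loc: "\<And>x. x \<in> K \<Longrightarrow> \<exists>U. openin (top_of_set K) U \<and> x \<in> U \<and> Q U"
  shows "\<exists>d>0. \<forall>x\<in>K. \<exists>U. Q U \<and> K \<inter> ball x d \<subseteq> U"
proof -
  let ?G = "{T. open T \<and> Q (K \<inter> T)}"
  have "K \<subseteq> \<Union>?G"
  proof
    fix x assume "x \<in> K"
    then obtain U where U: "openin (top_of_set K) U" "x \<in> U" "Q U"
      using loc by blast
    then obtain T where "open T" "U = K \<inter> T"
      by (auto simp: openin_open)
    with U show "x \<in> \<Union>?G"
      by auto
  qed
  then obtain d where "0 < d" "\<And>x. x \<in> K \<Longrightarrow> \<exists>T\<in>?G. ball x d \<subseteq> T"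
    using Heine_Borel_lemma [OF \<open>compact K\<close>, of ?G] by (metis (lifting) mem_Collect_eq)
  then show ?thesis
    by (intro exI [of _ d]) blast
qed

lemma local_cocycle_pullback:
  assumes c: "local_cocycle X c" and h: "continuous_map Y X h"
  shows "local_cocycle Y (\<lambda>s t. c (h s) (h t))"
  unfolding local_cocycle_def
proof
  fix y assume y: "y \<in> topspace Y"
  then have "h y \<in> topspace X"
    using h by (auto simp: continuous_map_def)
  then obtain U where U: "openin X U" "h y \<in> U" "cocycle_on U c"
    using c unfolding local_cocycle_def by blast
  let ?V = "{x \<in> topspace Y. h x \<in> U}"
  have "openin Y ?V"
    using h U(1) by (auto simp: continuous_map_def)
  moreover have "cocycle_on ?V (\<lambda>s t. c (h s) (h t))"
    using U(3) by (simp add: cocycle_on_def)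
  ultimately show "\<exists>V. openin Y V \<and> y \<in> V \<and> cocycle_on V (\<lambda>s t. c (h s) (h t))"
    using y U(2) by blast
qed

text \<open>
  With a Lebesgue number \<open>d\<close> for the domains where the identity holds, \<open>f x\<close> is the product of \<open>c\<close>
  along the segment from the centre to \<open>x\<close> cut into \<open>n\<close> short steps. For two nearby points the two
  segments bound a ladder of cells smaller than \<open>d\<close>, and the cocycle identity moves across one
  rung at a time. Intervals and squares are the two instances that are used.
\<close>

lemma local_cocycle_trivial_on_starlike:
  fixes K :: "'a::real_normed_vector set"
  assumes "compact K" and a: "a \<in> K" and star: "\<And>x. x \<in> K \<Longrightarrow> closed_segment a x \<subseteq> K"
    and c: "local_cocycle (top_of_set K) c"
  obtains f d where "0 < d" "f a = mat 1" "\<And>x. x \<in> K \<Longrightarrow> det (f x) = 1"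
    "\<And>x y. x \<in> K \<Longrightarrow> y \<in> K \<Longrightarrow> dist x y < d \<Longrightarrow> f x ** c x y = f y"
proof -
  have "\<exists>d>0. \<forall>x\<in>K. \<exists>U. cocycle_on U c \<and> K \<inter> ball x d \<subseteq> U"
    by (rule compact_uniform_nhds) (use assms in \<open>auto simp: local_cocycle_def\<close>)
  then obtain d where d: "0 < d" and dK: "\<forall>x\<in>K. \<exists>U. cocycle_on U c \<and> K \<inter> ball x d \<subseteq> U"
    by blast
  have coc: "cocycle_on (K \<inter> ball x d) c" if "x \<in> K" for x
    using dK that unfolding cocycle_on_def by (meson subsetD)
  have one: "c x x = mat 1" if "x \<in> K" for x
    using coc [OF that] that d by (simp add: cocycle_on_def)
  have det: "det (c x y) = 1" if "x \<in> K" "y \<in> K" "dist x y < d" for x y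
    using coc [of x] that d by (simp add: cocycle_on_def)
  have coc: "c y z ** c z w = c y w"
    if "x \<in> K" "y \<in> K" "z \<in> K" "w \<in> K" "dist x y < d" "dist x z < d" "dist x w < d" for x y z w
    using coc [of x] that by (simp add: cocycle_on_def)
  obtain R where R: "\<And>x. x \<in> K \<Longrightarrow> dist a x \<le> R"
    using \<open>compact K\<close> compact_imp_bounded bounded_any_center by metis
  obtain n :: nat where n: "2 * R / d < real n"
    using reals_Archimedean2 by blast
  have "0 \<le> R" using R [OF a] by simp
  then have n0: "0 < real n"
    using n d by (smt (verit) divide_nonneg_pos)
  have Rn: "R / real n < d / 2"
    using n d n0 by (simp add: field_simps)
  define P where "P k x = a + (real k / real n) *\<^sub>R (x - a)" for k x
  have PK: "P k x \<in> K" if "x \<in> K" "k \<le> n" for k x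
  proof -
    have "P k x = (1 - real k / real n) *\<^sub>R a + (real k / real n) *\<^sub>R x"
      by (simp add: P_def algebra_simps)
    moreover have "0 \<le> real k / real n" "real k / real n \<le> 1"
      using that n0 by auto
    ultimately have "P k x \<in> closed_segment a x"
      unfolding closed_segment_def by blast
    with star that show ?thesis by blast
  qed
  have dist1: "dist (P k x) (P (Suc k) x) < d / 2" if "x \<in> K" for k x
  proof -
    have "P (Suc k) x - P k x = (1 / real n) *\<^sub>R (x - a)"
      by (simp add: P_def add_divide_distrib scaleR_left_distrib)
    then have "norm (P (Suc k) x - P k x) = norm (x - a) / real n"
      using n0 by simp
    then have "dist (P k x) (P (Suc k) x) = norm (x - a) / real n"
      by (metis dist_commute dist_norm)
    also have "\<dots> \<le> R / real n"
      using R [OF that] n0 by (simp add: dist_norm norm_minus_commute divide_right_mono)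
    finally show ?thesis using Rn by linarith
  qed
  have dist2: "dist (P k x) (P k y) < d / 2" if "dist x y < d / 2" "k \<le> n" for k x y
  proof -
    have "P k x - P k y = (real k / real n) *\<^sub>R (x - y)"
      by (simp add: P_def algebra_simps)
    then have "dist (P k x) (P k y) = (real k / real n) * dist x y"
      using n0 by (simp add: dist_norm)
    also have "\<dots> \<le> 1 * dist x y"
      using that n0 by (intro mult_right_mono) auto
    finally show ?thesis using that by simp
  qed
  \<comment> \<open>The product of \<open>c\<close> over the first \<open>k\<close> steps of the segment from \<open>a\<close> to \<open>x\<close>.\<close>
  define F where "F = rec_nat (\<lambda>x. mat 1) (\<lambda>k G x. G x ** c (P k x) (P (Suc k) x))"
  have F0: "F 0 x = mat 1" and FS: "F (Suc k) x = F k x ** c (P k x) (P (Suc k) x)" for k x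
    by (simp_all add: F_def)
  have ladder: "F k x ** c (P k x) (P k y) = F k y"
    if x: "x \<in> K" and y: "y \<in> K" and xy: "dist x y < d / 2" and k: "k \<le> n" for k x y
    using k
  proof (induction k)
    case 0
    show ?case using one [OF a] by (simp add: F0 P_def)
  next
    case (Suc k)
    have K: "P k x \<in> K" "P (Suc k) x \<in> K" "P k y \<in> K" "P (Suc k) y \<in> K"
      using PK x y Suc.prems by simp_all
    have d1: "dist (P k x) (P (Suc k) x) < d / 2" "dist (P k x) (P k y) < d / 2"
        "dist (P k y) (P (Suc k) y) < d / 2"
      using dist1 x y dist2 [OF xy, of k] Suc.prems by simp_all
    then have d2: "dist (P k x) (P (Suc k) y) < d"
      using dist_triangle [of "P k x" "P (Suc k) y" "P k y"] by linarith
    have "F (Suc k) x ** c (P (Suc k) x) (P (Suc k) y)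
        = F k x ** (c (P k x) (P (Suc k) x) ** c (P (Suc k) x) (P (Suc k) y))"
      by (simp add: FS matrix_mul_assoc)
    also have "c (P k x) (P (Suc k) x) ** c (P (Suc k) x) (P (Suc k) y) = c (P k x) (P (Suc k) y)"
      by (rule coc [of "P k x"]) (use K d d1 d2 in simp_all)
    also have "\<dots> = c (P k x) (P k y) ** c (P k y) (P (Suc k) y)"
      by (rule coc [of "P k x", symmetric]) (use K d d1 d2 in simp_all)
    also have "F k x ** \<dots> = F (Suc k) y"
      using Suc by (simp add: FS matrix_mul_assoc)
    finally show ?case .
  qed
  have Pn: "P n x = x" for x
    using n0 by (simp add: P_def)
  show thesis
  proof (rule that [of "d / 2" "F n"])
    show "0 < d / 2" using d by simp
    have "F k a = mat 1" for k
      by (induction k) (simp_all add: F0 FS P_def one a)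
    then show "F n a = mat 1" .
    have "det (F k x) = 1" if "x \<in> K" "k \<le> n" for k x
      using that(2)
    proof (induction k)
      case (Suc k)
      have "dist (P k x) (P (Suc k) x) < d"
        using dist1 [OF \<open>x \<in> K\<close>, of k] d by linarith
      then have "det (c (P k x) (P (Suc k) x)) = 1"
        using PK \<open>x \<in> K\<close> Suc.prems by (intro det) simp_all
      with Suc show ?case by (simp add: FS det_mul)
    qed (simp add: F0)
    then show "det (F n x) = 1" if "x \<in> K" for x
      using that by simp
    show "F n x ** c x y = F n y" if "x \<in> K" "y \<in> K" "dist x y < d / 2" for x y
      using ladder [OF that, of n] by (simp add: Pn)
  qed
qed

lemma transport_exists:
  assumes c: "local_cocycle X c" and "pathin X \<gamma>"
  obtains N where "transport c \<gamma> M N" "det N = det M"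
proof -
  have "local_cocycle (top_of_set {0..1}) (\<lambda>s t. c (\<gamma> s) (\<gamma> t))"
    using local_cocycle_pullback [OF c] assms(2) by (simp add: pathin_def)
  then obtain f d where fd: "0 < d" "f (0::real) = mat 1" "\<And>s. s \<in> {0..1} \<Longrightarrow> det (f s) = 1"
    "\<And>s t. s \<in> {0..1} \<Longrightarrow> t \<in> {0..1} \<Longrightarrow> dist s t < d \<Longrightarrow> f s ** c (\<gamma> s) (\<gamma> t) = f t"
    by (rule local_cocycle_trivial_on_starlike [rotated 3])
      (auto simp: closed_segment_eq_real_ivl)
  have "transport c \<gamma> M (M ** f 1)"
    unfolding transport_def
    by (intro exI [of _ "\<lambda>t. M ** f t"] exI [of _ d])
      (use fd in \<open>auto simp: dist_real_def simp flip: matrix_mul_assoc\<close>)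
  moreover have "det (M ** f 1) = det M"
    using fd(3) [of 1] by (simp add: det_mul)
  ultimately show thesis by (rule that)
qed

lemma transport_unique:
  assumes "transport c \<gamma> M N" "transport c \<gamma> M N'"
  shows "N = N'"
proof -
  obtain f d where f: "0 < d" "f 0 = M" "f 1 = N"
    "\<And>s t. s \<in> {0..1} \<Longrightarrow> t \<in> {0..1} \<Longrightarrow> \<bar>s - t\<bar> < d \<Longrightarrow> f s ** c (\<gamma> s) (\<gamma> t) = f t"
    using assms(1) unfolding transport_def by blast
  obtain f' d' where f': "0 < d'" "f' 0 = M" "f' 1 = N'"
    "\<And>s t. s \<in> {0..1} \<Longrightarrow> t \<in> {0..1} \<Longrightarrow> \<bar>s - t\<bar> < d' \<Longrightarrow> f' s ** c (\<gamma> s) (\<gamma> t) = f' t"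
    using assms(2) unfolding transport_def by blast
  have "0 < min d d'" using f f' by simp
  then obtain n :: nat where n0: "0 < real n" and n1: "1 / real n < min d d'"
    using fine_partition by blast
  have "f (real k / real n) = f' (real k / real n)" if "k \<le> n" for k
    using that
  proof (induction k)
    case 0
    show ?case using f f' by simp
  next
    case (Suc k)
    have "\<bar>real k / real n - real (Suc k) / real n\<bar> = 1 / real n"
      using n0 by (simp add: field_simps)
    moreover have "real k / real n \<in> {0..1}" "real (Suc k) / real n \<in> {0..1}"
      using Suc.prems n0 by auto
    ultimately have "f (real (Suc k) / real n) = f (real k / real n) ** c (\<gamma> (real k / real n)) (\<gamma> (real (Suc k) / real n))"
        "f' (real (Suc k) / real n) = f' (real k / real n) ** c (\<gamma> (real k / real n)) (\<gamma> (real (Suc k) / real n))"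
      using f(4) [of "real k / real n" "real (Suc k) / real n"]
        f'(4) [of "real k / real n" "real (Suc k) / real n"] n1 by simp_all
    then show ?case using Suc by simp
  qed
  from this [of n] show ?thesis
    using f f' n0 by simp
qed

lemma transport_mult_left: "transport c \<gamma> M N \<Longrightarrow> transport c \<gamma> (L ** M) (L ** N)"
  unfolding transport_def
  by (elim exE, rule_tac x = "\<lambda>t. L ** f t" in exI, rule_tac x = d in exI)
    (auto simp flip: matrix_mul_assoc)

lemma transport_reverse:
  assumes "transport c \<gamma> M N"
  shows "transport c (\<lambda>t. \<gamma> (1 - t)) N M"
proof -
  obtain f d where f: "0 < d" "f 0 = M" "f 1 = N"
    "\<And>s t. s \<in> {0..1} \<Longrightarrow> t \<in> {0..1} \<Longrightarrow> \<bar>s - t\<bar> < d \<Longrightarrow> f s ** c (\<gamma> s) (\<gamma> t) = f t"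
    using assms unfolding transport_def by blast
  show ?thesis
    unfolding transport_def
    by (rule exI [of _ "\<lambda>t. f (1 - t)"], rule exI [of _ d]) (use f in \<open>auto intro!: f(4)\<close>)
qed

lemma transport_join:
  assumes c: "local_cocycle X c" and pq: "pathin X (loop_join p q)" "p 1 = q 0"
    and tp: "transport c p L M" and tq: "transport c q M N"
  shows "transport c (loop_join p q) L N"
proof -
  let ?j = "loop_join p q"
  obtain N' where "transport c ?j L N'"
    using transport_exists [OF c pq(1)] by blast
  then obtain f d where f: "0 < d" "f 0 = L" "f 1 = N'"
    "\<And>s t. s \<in> {0..1} \<Longrightarrow> t \<in> {0..1} \<Longrightarrow> \<bar>s - t\<bar> < d \<Longrightarrow> f s ** c (?j s) (?j t) = f t"
    unfolding transport_def by blast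
  have j: "?j (s / 2) = p s" "?j ((s + 1) / 2) = q s" if "s \<in> {0..1}" for s
    using that pq(2) by (auto simp: loop_join_def field_simps)
  have "transport c p L (f (1/2))"
    unfolding transport_def
  proof (intro exI [of _ "\<lambda>s. f (s / 2)"] exI [of _ d] conjI ballI impI)
    fix s t :: real
    assume "s \<in> {0..1}" "t \<in> {0..1}" "\<bar>s - t\<bar> < d"
    moreover from this have "\<bar>s / 2 - t / 2\<bar> < d"
      by linarith
    ultimately show "f (s / 2) ** c (p s) (p t) = f (t / 2)"
      using f(4) [of "s / 2" "t / 2"] j(1) [of s] j(1) [of t] by simp
  qed (use f in simp_all)
  then have M: "f (1/2) = M"
    using transport_unique tp by blast
  have "transport c q M N'"
    unfolding transport_def
  proof (intro exI [of _ "\<lambda>s. f ((s + 1) / 2)"] exI [of _ d] conjI ballI impI)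
    fix s t :: real
    assume st: "s \<in> {0..1}" "t \<in> {0..1}" "\<bar>s - t\<bar> < d"
    have half: "(s + 1) / 2 - (t + 1) / 2 = (s - t) / 2"
      by (simp add: field_simps)
    have "\<bar>(s + 1) / 2 - (t + 1) / 2\<bar> = \<bar>s - t\<bar> / 2"
      unfolding half by simp
    moreover have "\<bar>s - t\<bar> / 2 < d"
      using st(3) f(1) by (simp add: field_simps)
    ultimately have "\<bar>(s + 1) / 2 - (t + 1) / 2\<bar> < d"
      by (simp only:)
    with st show "f ((s + 1) / 2) ** c (q s) (q t) = f ((t + 1) / 2)"
      using f(4) [of "(s + 1) / 2" "(t + 1) / 2"] j(2) [of s] j(2) [of t] by simp
  qed (use f M in simp_all)
  then have "N' = N"
    using transport_unique tq by blast
  with \<open>transport c ?j L N'\<close> show ?thesis by simp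
qed

text \<open>
  The cocycle pulled back to the square of the homotopy is a coboundary, so transport along an edge is
  the quotient of two values of one function \<open>f\<close> on the corners. The two edges over the constant end
  points contribute the identity, because \<open>c\<close> is the identity on the diagonal.
\<close>

lemma transport_homotopic:
  assumes c: "local_cocycle X c"
    and hom: "homotopic_with (\<lambda>r. r 0 = a \<and> r 1 = b) (top_of_set {0..1}) X p q"
    and tp: "transport c p M N"
  shows "transport c q M N"
proof -
  let ?I = "{0..1::real}"
  obtain h where h: "continuous_map (prod_topology (top_of_set ?I) (top_of_set ?I)) X h"
      "\<And>s. h (0, s) = p s" "\<And>s. h (1, s) = q s"
      "\<And>t. t \<in> ?I \<Longrightarrow> h (t, 0) = a \<and> h (t, 1) = b"
    using hom unfolding homotopic_with_def by auto
  have II: "prod_topology (top_of_set ?I) (top_of_set ?I) = top_of_set (?I \<times> ?I)"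
    by (simp add: prod_topology_subtopology subtopology_subtopology Times_Int_Times
        flip: euclidean_product_topology)
  have hK: "h z \<in> topspace X" if "z \<in> ?I \<times> ?I" for z
    using h(1) that by (auto simp: continuous_map_def II)
  have lc: "local_cocycle (top_of_set (?I \<times> ?I)) (\<lambda>y z. c (h y) (h z))"
    using local_cocycle_pullback [OF c h(1)] by (simp add: II)
  have "convex (?I \<times> ?I)"
    by (simp add: convex_Times)
  then have star: "closed_segment (0, 0) x \<subseteq> ?I \<times> ?I" if "x \<in> ?I \<times> ?I" for x
    using that by (intro closed_segment_subset) auto
  have K0: "compact (?I \<times> ?I)" "(0, 0) \<in> ?I \<times> ?I"
    by (simp_all add: compact_Times)
  obtain f d where f: "0 < d" "f (0, 0) = mat 1" "\<And>x. x \<in> ?I \<times> ?I \<Longrightarrow> det (f x) = 1"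
    "\<And>x y. x \<in> ?I \<times> ?I \<Longrightarrow> y \<in> ?I \<times> ?I \<Longrightarrow> dist x y < d \<Longrightarrow> f x ** c (h x) (h y) = f y"
    by (rule local_cocycle_trivial_on_starlike [OF K0 star lc], assumption, rule that)
  have one: "c (h z) (h z) = mat 1" if "z \<in> ?I \<times> ?I" for z
    using c hK [OF that] unfolding local_cocycle_def cocycle_on_def by metis
  have horizontal: "transport c (\<lambda>s. h (t, s)) (f (t, 0)) (f (t, 1))" if "t \<in> ?I" for t
    unfolding transport_def
    by (intro exI [of _ "\<lambda>s. f (t, s)"] exI [of _ d])
      (use f that in \<open>auto simp: dist_Pair_Pair dist_real_def\<close>)
  have vertical: "transport c (\<lambda>t. h (t, s)) (f (0, s)) (f (1, s))" if "s \<in> ?I" for s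
    unfolding transport_def
    by (intro exI [of _ "\<lambda>t. f (t, s)"] exI [of _ d])
      (use f that in \<open>auto simp: dist_Pair_Pair dist_real_def\<close>)
  have const: "transport c (\<lambda>t. h (t, s)) (f (0, s)) (f (0, s))" if "s \<in> {0, 1}" for s
  proof -
    have "c (h (t, s)) (h (t', s)) = mat 1" if "t \<in> ?I" "t' \<in> ?I" for t t'
    proof -
      have "h (t, s) = h (t', s)"
        using h(4) [OF that(1)] h(4) [OF that(2)] \<open>s \<in> {0, 1}\<close> by auto
      then show ?thesis
        using one [of "(t', s)"] that \<open>s \<in> {0, 1}\<close> by auto
    qed
    then show ?thesis
      unfolding transport_def
      by (intro exI [of _ "\<lambda>t. f (0, s)"] exI [of _ 1]) simp
  qed
  have eq: "f (1, 0) = mat 1" "f (1, 1) = f (0, 1)"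
    using transport_unique [OF vertical const, of 0] transport_unique [OF vertical const, of 1] f(2)
    by auto
  have "transport c p (mat 1) (f (0, 1))" "transport c q (mat 1) (f (0, 1))"
    using horizontal [of 0] horizontal [of 1] h(2,3) f(2) eq by simp_all
  then have "transport c p M (M ** f (0, 1))" "transport c q M (M ** f (0, 1))"
    using transport_mult_left [of c _ "mat 1" _ M] by fastforce+
  then show ?thesis
    using transport_unique tp by blast
qed

section \<open>Lifting paths\<close>

text \<open>
  The part of being evenly covered that existence of path lifts needs: through each point above \<open>V\<close>
  there is a continuous section over all of \<open>V\<close>.
\<close>

definition sectioned_nhd :: "'a topology \<Rightarrow> 'z::topological_space set \<Rightarrow> ('z \<Rightarrow> 'a) \<Rightarrow> 'a set \<Rightarrow> bool" where
  "sectioned_nhd X Z p V \<longleftrightarrow>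
     (\<forall>e\<in>Z. p e \<in> V \<longrightarrow>
        (\<exists>s. continuous_map (subtopology X V) (top_of_set Z) s \<and> (\<forall>y\<in>V. p (s y) = y) \<and> s (p e) = e))"

lemma path_lift:
  fixes Z :: "'z::topological_space set"
  assumes \<gamma>: "pathin X \<gamma>"
    and sec: "\<And>y. y \<in> topspace X \<Longrightarrow> \<exists>V. openin X V \<and> y \<in> V \<and> sectioned_nhd X Z p V"
    and z0: "z0 \<in> Z" "p z0 = \<gamma> 0"
  obtains g where "path g" "path_image g \<subseteq> Z" "g 0 = z0" "\<And>t. t \<in> {0..1} \<Longrightarrow> p (g t) = \<gamma> t"
proof -
  let ?Q = "\<lambda>U. \<exists>V. sectioned_nhd X Z p V \<and> \<gamma> ` U \<subseteq> V"
  have "\<exists>d>0. \<forall>t\<in>{0..1::real}. \<exists>U. ?Q U \<and> {0..1} \<inter> ball t d \<subseteq> U"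
  proof (rule compact_uniform_nhds)
    fix t :: real assume t: "t \<in> {0..1}"
    then have "\<gamma> t \<in> topspace X"
      using \<gamma> by (auto simp: pathin_def continuous_map_def)
    then obtain V where V: "openin X V" "\<gamma> t \<in> V" "sectioned_nhd X Z p V"
      using sec by blast
    let ?U = "{s \<in> {0..1}. \<gamma> s \<in> V}"
    have "openin (top_of_set {0..1}) ?U"
      using \<gamma> V(1) by (auto simp: pathin_def continuous_map_def)
    moreover have "t \<in> ?U" "?Q ?U"
      using t V by blast+
    ultimately show "\<exists>U. openin (top_of_set {0..1}) U \<and> t \<in> U \<and> ?Q U"
      by blast
  qed simp
  then obtain d where d: "0 < d" and dQ: "\<And>t::real. t \<in> {0..1} \<Longrightarrow> \<exists>U. ?Q U \<and> {0..1} \<inter> ball t d \<subseteq> U"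
    by blast
  obtain n :: nat where n0: "0 < real n" and nd: "1 / real n < d"
    using fine_partition d by blast
  have "\<exists>g. continuous_on {0..real k / real n} g \<and> g ` {0..real k / real n} \<subseteq> Z \<and> g 0 = z0 \<and>
      (\<forall>t\<in>{0..real k / real n}. p (g t) = \<gamma> t)" if "k \<le> n" for k
    using that
  proof (induction k)
    case 0
    show ?case
      by (rule exI [of _ "\<lambda>_. z0"]) (use z0 in simp)
  next
    case (Suc k)
    define a b where "a = real k / real n" and "b = real (Suc k) / real n"
    obtain g where g: "continuous_on {0..a} g" "g ` {0..a} \<subseteq> Z" "g 0 = z0" "\<And>t. t \<in> {0..a} \<Longrightarrow> p (g t) = \<gamma> t"
      using Suc unfolding a_def by auto
    have ab: "0 \<le> a" "a \<le> b" "b \<le> 1" "b = a + 1 / real n"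
      using Suc.prems n0 by (auto simp: a_def b_def field_simps)
    then have "{a..b} \<subseteq> {0..1} \<inter> ball a d"
      using nd by (auto simp: dist_real_def)
    moreover have "a \<in> {0..1}"
      using ab(1-3) by auto
    ultimately obtain V where V: "sectioned_nhd X Z p V" "\<gamma> ` {a..b} \<subseteq> V"
      using dQ [of a] by blast
    have ga: "g a \<in> Z" "p (g a) = \<gamma> a" "\<gamma> a \<in> V"
      using g ab V by auto
    then obtain s where s: "continuous_map (subtopology X V) (top_of_set Z) s"
        "\<And>y. y \<in> V \<Longrightarrow> p (s y) = y" "s (\<gamma> a) = g a"
      using V(1) unfolding sectioned_nhd_def by metis
    have "continuous_map (top_of_set {a..b}) X \<gamma>"
      using \<gamma> ab unfolding pathin_def by (rule_tac continuous_map_from_subtopology_mono) auto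
    then have "continuous_map (top_of_set {a..b}) (subtopology X V) \<gamma>"
      using V(2) by (simp add: continuous_map_in_subtopology image_subset_iff_funcset)
    from continuous_map_compose [OF this s(1)]
    have s\<gamma>: "continuous_on {a..b} (\<lambda>t. s (\<gamma> t))" "(\<lambda>t. s (\<gamma> t)) ` {a..b} \<subseteq> Z"
      by (auto simp: o_def image_subset_iff_funcset continuous_map_in_subtopology)
    let ?g = "\<lambda>t. if t \<le> a then g t else s (\<gamma> t)"
    have "continuous_on ({0..a} \<union> {a..b}) ?g"
      by (rule continuous_on_cases) (use g s\<gamma> s in auto)
    moreover have "{0..a} \<union> {a..b} = {0..b}"
      using ab(1,2) by auto
    moreover have "?g ` {0..b} \<subseteq> Z" "?g 0 = z0"
      using g s\<gamma>(2) ab by (auto simp: image_subset_iff)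
    moreover have "p (?g t) = \<gamma> t" if "t \<in> {0..b}" for t
      using g(4) s(2) V(2) that by (auto simp: image_subset_iff)
    ultimately show ?case
      unfolding b_def by (intro exI [of _ ?g]) simp
  qed
  from this [of n] n0 obtain g where "continuous_on {0..1} g" "g ` {0..1} \<subseteq> Z" "g 0 = z0"
      "\<forall>t\<in>{0..1}. p (g t) = \<gamma> t"
    by auto
  then show thesis
    by (intro that [of g]) (auto simp: path_def path_image_def)
qed

section \<open>Determinants of block monomial matrices\<close>

lemma sum_over_block:
  fixes \<beta> :: "'n::finite \<Rightarrow> 'k::finite \<times> 2" and F :: "2 \<Rightarrow> int"
  assumes "bij \<beta>"
  shows "(\<Sum>h\<in>UNIV. if fst (\<beta> h) = k \<and> P then F (snd (\<beta> h)) else 0) = (if P then \<Sum>b\<in>UNIV. F b else 0)"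
proof -
  have "(\<Sum>h\<in>UNIV. if fst (\<beta> h) = k \<and> P then F (snd (\<beta> h)) else 0)
      = (\<Sum>(q, b)\<in>UNIV. if q = k \<and> P then F b else 0)"
    using sum.reindex_bij_betw [OF assms, of "\<lambda>(q, b). if q = k \<and> P then F b else 0"]
    by (simp add: case_prod_beta)
  also have "\<dots> = (\<Sum>q\<in>UNIV. \<Sum>b\<in>UNIV. if q = k \<and> P then F b else 0)"
    by (simp only: sum.cartesian_product UNIV_Times_UNIV)
  also have "\<dots> = (\<Sum>q\<in>UNIV. if q = k then (if P then \<Sum>b\<in>UNIV. F b else 0) else 0)"
    by (intro sum.cong) auto
  finally show ?thesis by simp
qed

text \<open>
  The bijection \<open>\<beta>\<close> groups the indices into pairs. A matrix with a single non-trivial block has only two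
  permutations in its Leibniz expansion, the identity and one transposition; the general matrix is a
  product of such factors.
\<close>

lemma det_block_diagonal:
  fixes C :: "'k::finite \<Rightarrow> int^2^2" and \<beta> :: "'n::finite \<Rightarrow> 'k \<times> 2"
  assumes \<beta>: "bij \<beta>" and C: "\<And>k. det (C k) = 1"
  shows "det (\<chi> i j. if fst (\<beta> i) = fst (\<beta> j) then C (fst (\<beta> i)) $ snd (\<beta> i) $ snd (\<beta> j) else 0) = 1"
proof -
  define E :: "'k \<Rightarrow> int^'n^'n" where
    "E k = (\<chi> i j. if fst (\<beta> i) = k \<and> fst (\<beta> j) = k then C k $ snd (\<beta> i) $ snd (\<beta> j)
              else if i = j then 1 else 0)" for k
  define D :: "'k set \<Rightarrow> int^'n^'n" where
    "D F = (\<chi> i j. if fst (\<beta> i) = fst (\<beta> j) \<and> fst (\<beta> i) \<in> F then C (fst (\<beta> i)) $ snd (\<beta> i) $ snd (\<beta> j)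
              else if i = j then 1 else 0)" for F
  have detE: "det (E k) = 1" for k
  proof -
    define a b where "a = inv_into UNIV \<beta> (k, 1)" and "b = inv_into UNIV \<beta> (k, 2)"
    have ab: "\<beta> a = (k, 1)" "\<beta> b = (k, 2)"
      using \<beta> by (simp_all add: a_def b_def bij_is_surj surj_f_inv_f)
    then have "a \<noteq> b" by auto
    have fst_iff: "fst (\<beta> i) = k \<longleftrightarrow> i = a \<or> i = b" for i
    proof
      assume "fst (\<beta> i) = k"
      then have "\<beta> i = (k, 1) \<or> \<beta> i = (k, 2)"
        using exhaust_2 [of "snd (\<beta> i)"] by (metis prod.collapse)
      then show "i = a \<or> i = b"
        using ab \<beta> by (metis bij_pointE)
    qed (use ab in auto)
    have E: "E k $ a $ a = C k $ 1 $ 1" "E k $ a $ b = C k $ 1 $ 2" "E k $ b $ a = C k $ 2 $ 1" "E k $ b $ b = C k $ 2 $ 2"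
      by (simp_all add: E_def ab)
    have E': "E k $ i $ j = (if i = j then 1 else 0)" if "i \<noteq> a" "i \<noteq> b" for i j
      using that by (simp add: E_def fst_iff)
    let ?f = "\<lambda>q. of_int (sign q) * (\<Prod>i\<in>UNIV. E k $ i $ q i)"
    have zero: "?f q = 0" if q: "q permutes UNIV" "q \<noteq> id" "q \<noteq> Transposition.transpose a b" for q
    proof (rule ccontr)
      assume "?f q \<noteq> 0"
      then have nz: "E k $ i $ q i \<noteq> 0" for i
        by (simp add: prod_zero_iff)
      have fixq: "q i = i" if "i \<noteq> a" "i \<noteq> b" for i
        using E' [OF that, of "q i"] nz [of i] by (auto split: if_splits)
      have "inj q" using q(1) by (simp add: permutes_inj)
      then have "q a \<in> {a, b}" "q b \<in> {a, b}" "q a \<noteq> q b"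
        using fixq \<open>a \<noteq> b\<close> by (metis insert_iff injD)+
      then consider "q a = a" "q b = b" | "q a = b" "q b = a"
        by auto
      then show False
      proof cases
        case 1
        then have "q = id" using fixq by (metis eq_id_iff)
        then show False using q(2) by simp
      next
        case 2
        then have "q i = Transposition.transpose a b i" for i
          using fixq [of i] by (cases "i = a"; cases "i = b") (simp_all add: transpose_apply_other)
        then show False using q(3) by auto
      qed
    qed
    have "det (E k) = (\<Sum>q\<in>{id, Transposition.transpose a b}. ?f q)"
      unfolding det_def
      by (rule sum.mono_neutral_right) (use zero in \<open>auto simp: permutes_id permutes_swap_id\<close>)
    moreover have "id \<noteq> Transposition.transpose a b"
      using \<open>a \<noteq> b\<close> by (metis id_apply transpose_apply_first)
    moreover have "(\<Prod>i\<in>UNIV. E k $ i $ q i) = (\<Prod>i\<in>{a, b}. E k $ i $ q i)"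
      if "\<And>i. i \<noteq> a \<Longrightarrow> i \<noteq> b \<Longrightarrow> q i = i" for q
      by (rule prod.mono_neutral_right) (use that E' in auto)
    ultimately show ?thesis
      using C [of k] \<open>a \<noteq> b\<close>
      by (simp add: E det_2 sign_id sign_swap_id transpose_apply_other)
  qed
  have DE: "D (insert k F) = D F ** E k" if "k \<notin> F" for k F
  proof -
    have "(D F ** E k) $ i $ j = D (insert k F) $ i $ j" for i j
    proof (cases "fst (\<beta> i) = k")
      case True
      then have "D F $ i $ l = (if i = l then 1 else 0)" for l
        using that by (simp add: D_def)
      then have "(D F ** E k) $ i $ j = E k $ i $ j"
        by (simp add: matrix_matrix_mult_def if_distrib [of "\<lambda>x. x * _"] cong: if_cong)
      then show ?thesis
        using True by (auto simp: E_def D_def)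
    next
      case False
      then have "E k $ l $ j = (if l = j then 1 else 0)" if "D F $ i $ l \<noteq> 0" for l
        using that by (auto simp: D_def E_def split: if_splits)
      then have "D F $ i $ l * E k $ l $ j = (if l = j then D F $ i $ l else 0)" for l
        by (cases "D F $ i $ l = 0") auto
      then have "(D F ** E k) $ i $ j = D F $ i $ j"
        by (simp add: matrix_matrix_mult_def)
      then show ?thesis
        using False by (simp add: D_def)
    qed
    then show ?thesis by (simp add: vec_eq_iff)
  qed
  have "det (D F) = 1" if "finite F" for F
    using that
  proof induction
    case empty
    have "D {} = mat 1" by (simp add: D_def mat_def)
    then show ?case by simp
  next
    case (insert k F)
    then show ?case by (simp add: DE det_mul detE)
  qed
  from this [of UNIV] have "det (D UNIV) = 1" by simp
  moreover have "D UNIV = (\<chi> i j. if fst (\<beta> i) = fst (\<beta> j) then C (fst (\<beta> i)) $ snd (\<beta> i) $ snd (\<beta> j) else 0)"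
    using \<beta> by (auto simp: D_def vec_eq_iff)
  ultimately show ?thesis by simp
qed

text \<open>
  Permuting the blocks by \<open>\<pi>\<close> permutes the indices by \<open>q 1 \<circ> q 2\<close>, where \<open>q e\<close> moves only the indices in
  position \<open>e\<close> of their blocks. The involution \<open>t\<close> exchanging the two positions conjugates \<open>q 1\<close> to \<open>q 2\<close>,
  so the signs cancel. This is why induction with blocks of even size lands in the special linear
  group.
\<close>

lemma det_block_monomial:
  fixes C :: "'k::finite \<Rightarrow> int^2^2" and \<beta> :: "'n::finite \<Rightarrow> 'k \<times> 2"
  assumes \<beta>: "bij \<beta>" and C: "\<And>k. det (C k) = 1" and \<pi>: "bij \<pi>"
  shows "det (\<chi> i j. if \<pi> (fst (\<beta> i)) = fst (\<beta> j) then C (fst (\<beta> i)) $ snd (\<beta> i) $ snd (\<beta> j) else 0) = 1"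
proof -
  define \<sigma> where "\<sigma> e x = (if snd x = e then (inv_into UNIV \<pi> (fst x), snd x) else x)" for e :: 2 and x :: "'k \<times> 2"
  define q where "q e = inv_into UNIV \<beta> \<circ> \<sigma> e \<circ> \<beta>" for e :: 2
  define t where "t = inv_into UNIV \<beta> \<circ> (\<lambda>x. (fst x, if snd x = 1 then 2 else 1::2)) \<circ> \<beta>"
  have two: "e = 1 \<or> e = 2" for e :: 2
    by (rule exhaust_2)
  have b\<beta>: "bij (inv_into UNIV \<beta>)" by (simp add: \<beta> bij_imp_bij_inv)
  have "\<sigma> e (if snd x = e then (\<pi> (fst x), snd x) else x) = x"
    "(if snd (\<sigma> e x) = e then (\<pi> (fst (\<sigma> e x)), snd (\<sigma> e x)) else \<sigma> e x) = x" for e x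
    using \<pi> by (auto simp: \<sigma>_def bij_is_inj bij_is_surj surj_f_inv_f)
  then have "bij (\<sigma> e)" for e
    by (intro o_bij [of "\<lambda>x. if snd x = e then (\<pi> (fst x), snd x) else x"]) (simp_all add: fun_eq_iff)
  then have bq: "bij (q e)" for e
    unfolding q_def by (intro bij_comp \<beta> b\<beta>)
  have "bij (\<lambda>x::'k\<times>2. (fst x, if snd x = 1 then 2 else 1::2))" (is "bij ?s")
    by (rule o_bij [of ?s]) (use two in \<open>auto simp: fun_eq_iff\<close>)
  then have bt: "bij t"
    unfolding t_def by (intro bij_comp \<beta> b\<beta>)
  have \<beta>inv: "\<beta> (inv_into UNIV \<beta> x) = x" "inv_into UNIV \<beta> (\<beta> i) = i" for x i
    using \<beta> by (simp_all add: bij_is_inj bij_is_surj surj_f_inv_f)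
  have tt: "t \<circ> t = id"
  proof
    fix i
    have "\<beta> ((t \<circ> t) i) = \<beta> i"
      using two [of "snd (\<beta> i)"] by (auto simp: t_def \<beta>inv prod_eq_iff)
    then show "(t \<circ> t) i = id i"
      by (metis \<beta>inv(2) id_apply)
  qed
  have q2: "q 2 = t \<circ> q 1 \<circ> t"
  proof
    fix i
    have "\<beta> (q 2 i) = \<beta> ((t \<circ> q 1 \<circ> t) i)"
      using two [of "snd (\<beta> i)"] by (auto simp: t_def q_def \<sigma>_def \<beta>inv prod_eq_iff)
    then show "q 2 i = (t \<circ> q 1 \<circ> t) i"
      by (metis \<beta>inv(2))
  qed
  have perm: "permutation f" if "bij f" for f :: "'n \<Rightarrow> 'n"
    using that by (simp add: permutation)
  have "sign (q 2) = sign t * sign (q 1) * sign t"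
    unfolding q2 by (simp add: sign_compose perm permutation_compose bq bt)
  also have "\<dots> = sign (t \<circ> t) * sign (q 1)"
    by (simp add: sign_compose perm bt)
  finally have sq: "sign (q 1 \<circ> q 2) = 1"
    by (simp add: sign_compose perm bq tt sign_id)
  have q12: "q 1 \<circ> q 2 permutes UNIV"
    using bq by (intro bij_imp_permutes) (auto intro: bij_comp)
  define D :: "int^'n^'n" where
    "D = (\<chi> i j. if fst (\<beta> i) = fst (\<beta> j) then C (fst (\<beta> i)) $ snd (\<beta> i) $ snd (\<beta> j) else 0)"
  have "\<beta> ((q 1 \<circ> q 2) j) = (inv_into UNIV \<pi> (fst (\<beta> j)), snd (\<beta> j))" for j
    using two [of "snd (\<beta> j)"] by (auto simp: q_def \<sigma>_def \<beta>inv)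
  then have "(\<chi> i j. if \<pi> (fst (\<beta> i)) = fst (\<beta> j) then C (fst (\<beta> i)) $ snd (\<beta> i) $ snd (\<beta> j) else 0)
      = (\<chi> i j. D $ i $ (q 1 \<circ> q 2) j)"
    using bij_inv_eq_iff [OF \<pi>] by (auto simp: D_def vec_eq_iff)
  then show ?thesis
    using det_permute_columns [OF q12, of D] sq det_block_diagonal [OF \<beta> C] by (simp add: D_def)
qed

section \<open>Induced cocycles on quotients by finite groups of isometries\<close>

text \<open>
  The isometry assumption makes the sheets over a small neighbourhood recognisable by distance: this
  yields a globally defined relation that tells when two points lie on the same sheet.
\<close>

locale finite_isometric_quotient =
  fixes Z :: "'z::metric_space set" and K :: "('z \<Rightarrow> 'z) set"
    and X :: "'a topology" and p :: "'z \<Rightarrow> 'a"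
  assumes finite_K: "finite K" and id_K: "id \<in> K"
    and comp_K: "f \<in> K \<Longrightarrow> g \<in> K \<Longrightarrow> f \<circ> g \<in> K"
    and inverse_K: "f \<in> K \<Longrightarrow> \<exists>g\<in>K. f \<circ> g = id \<and> g \<circ> f = id"
    and isometry: "f \<in> K \<Longrightarrow> dist (f x) (f y) = dist x y"
    and K_Z: "f \<in> K \<Longrightarrow> z \<in> Z \<Longrightarrow> f z \<in> Z"
    and free: "f \<in> K \<Longrightarrow> z \<in> Z \<Longrightarrow> f z = z \<Longrightarrow> f = id"
    and fibre: "z \<in> Z \<Longrightarrow> w \<in> Z \<Longrightarrow> p z = p w \<longleftrightarrow> (\<exists>f\<in>K. w = f z)"
    and p_continuous: "continuous_map (top_of_set Z) X p"
    and p_open: "openin (top_of_set Z) U \<Longrightarrow> openin X (p ` U)"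
    and p_surj: "p ` Z = topspace X"
begin

text \<open>
  \<open>w\<close> is the strictly closest point to \<open>z\<close> in its own fibre. Only for points in fibres that are close to
  each other does this mean lying on a common sheet.
\<close>

definition near :: "'z \<Rightarrow> 'z \<Rightarrow> bool" where
  "near z w \<longleftrightarrow> (\<forall>w'\<in>Z. p w' = p w \<longrightarrow> w' \<noteq> w \<longrightarrow> dist z w < dist z w')"

text \<open>
  The label \<open>j z\<close> is the group element naming the sheet through \<open>z\<close>.
\<close>

definition trivialisation ::
    "('z \<Rightarrow> 'z \<Rightarrow> int^2^2) \<Rightarrow> 'a set \<Rightarrow> ('z \<Rightarrow> 'z \<Rightarrow> 'z) \<Rightarrow> bool" where
  "trivialisation c V j \<longleftrightarrow>
     (\<forall>z\<in>Z. \<forall>w\<in>Z. p z \<in> V \<longrightarrow> p w \<in> V \<longrightarrow> (near z w \<longleftrightarrow> j z = j w)) \<and>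
     (\<forall>y\<in>V. bij_betw j {z \<in> Z. p z = y} K) \<and>
     (\<forall>k\<in>K. openin (top_of_set Z) {z \<in> Z. p z \<in> V \<and> j z = k}) \<and>
     (\<forall>k\<in>K. cocycle_on {z \<in> Z. p z \<in> V \<and> j z = k} c)"

text \<open>
  Take \<open>V\<close> to be the image of a ball around \<open>z0\<close> whose radius is at most a quarter of the distance from
  \<open>z0\<close> to the rest of its orbit, and so small that \<open>c\<close> is a cocycle on every translate of the ball. Points
  in one translate are less than \<open>2 * r\<close> apart, points in different translates more than \<open>2 * r\<close>.
\<close>

lemma trivialisation_exists:
  assumes c: "local_cocycle (top_of_set Z) c" and y: "y \<in> topspace X"
  obtains V j where "openin X V" "y \<in> V" "trivialisation c V j" "sectioned_nhd X Z p V"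
proof -
  obtain z0 where z0: "z0 \<in> Z" "p z0 = y"
    using y unfolding p_surj [symmetric] by auto
  have "\<exists>r>0. cocycle_on (ball (k z0) r \<inter> Z) c \<and> (k \<noteq> id \<longrightarrow> 4 * r \<le> dist z0 (k z0))"
    if k: "k \<in> K" for k
  proof -
    have "k z0 \<in> topspace (top_of_set Z)"
      using K_Z [OF k z0(1)] by simp
    from local_cocycleE [OF c this]
    obtain U where U: "openin (top_of_set Z) U" "k z0 \<in> U" "cocycle_on U c" .
    from U(1,2) obtain e where e: "0 < e" "ball (k z0) e \<inter> Z \<subseteq> U"
      by (meson openin_contains_ball)
    define r where "r = (if k = id then e else min e (dist z0 (k z0) / 4))"
    have "0 < r"
      using e(1) free [OF k z0(1)] by (auto simp: r_def)
    moreover have "ball (k z0) r \<inter> Z \<subseteq> U"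
      using e(2) by (auto simp: r_def split: if_splits)
    then have "cocycle_on (ball (k z0) r \<inter> Z) c"
      using U(3) unfolding cocycle_on_def by (meson subsetD)
    moreover have "k \<noteq> id \<longrightarrow> 4 * r \<le> dist z0 (k z0)"
      by (auto simp: r_def min_def)
    ultimately show ?thesis by blast
  qed
  then obtain \<rho> where \<rho>: "\<And>k. k \<in> K \<Longrightarrow> 0 < \<rho> k"
      "\<And>k. k \<in> K \<Longrightarrow> cocycle_on (ball (k z0) (\<rho> k) \<inter> Z) c"
      "\<And>k. k \<in> K \<Longrightarrow> k \<noteq> id \<Longrightarrow> 4 * \<rho> k \<le> dist z0 (k z0)"
    by metis
  define r where "r = Min (\<rho> ` K)"
  have r0: "0 < r"
    unfolding r_def using \<rho>(1) finite_K id_K by (subst Min_gr_iff) auto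
  have r\<rho>: "r \<le> \<rho> k" if "k \<in> K" for k
    using that finite_K by (simp add: r_def)
  have coc: "cocycle_on (ball (k z0) r \<inter> Z) c" if "k \<in> K" for k
  proof -
    have "ball (k z0) r \<inter> Z \<subseteq> ball (k z0) (\<rho> k) \<inter> Z"
      using r\<rho> [OF that] by auto
    then show ?thesis
      using \<rho>(2) [OF that] unfolding cocycle_on_def by (meson subsetD)
  qed
  have sep: "4 * r \<le> dist (k z0) (l z0)" if k: "k \<in> K" and l: "l \<in> K" and "k \<noteq> l" for k l
  proof -
    obtain k' where k': "k' \<in> K" "k \<circ> k' = id" "k' \<circ> k = id"
      using inverse_K [OF k] by blast
    then have "k' \<circ> l \<noteq> id"
      using \<open>k \<noteq> l\<close> by (metis comp_assoc comp_id id_comp)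
    moreover have "k' \<circ> l \<in> K"
      using k' l comp_K by blast
    ultimately have "4 * r \<le> dist z0 ((k' \<circ> l) z0)"
      using \<rho>(3) [of "k' \<circ> l"] r\<rho> [of "k' \<circ> l"] by linarith
    also have "\<dots> = dist (k z0) (k ((k' \<circ> l) z0))"
      using isometry [OF k] by simp
    also have "k ((k' \<circ> l) z0) = l z0"
      using k'(2) by (metis comp_apply id_apply)
    finally show ?thesis .
  qed
  have far: "2 * r < dist z w"
    if "z \<in> ball (k z0) r" "w \<in> ball (l z0) r" "k \<in> K" "l \<in> K" "k \<noteq> l" for z w k l
  proof -
    have "dist (k z0) z < r" "dist (l z0) w < r" using that by auto
    moreover have "dist (k z0) (l z0) \<le> dist (k z0) z + dist z w + dist (l z0) w"
      using dist_triangle [of "k z0" "l z0" z] dist_triangle [of z "l z0" w]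
      by (simp add: dist_commute)
    ultimately show ?thesis
      using sep [of k l] that by linarith
  qed
  have close: "dist z w < 2 * r" if "z \<in> ball (k z0) r" "w \<in> ball (k z0) r" for z w k
    using that dist_triangle [of z w "k z0"] by (simp add: dist_commute)
  define B where "B = ball z0 r \<inter> Z"
  define V where "V = p ` B"
  define j where "j z = (THE k. k \<in> K \<and> z \<in> ball (k z0) r)" for z
  have j_eq: "j z = k" if "k \<in> K" "z \<in> ball (k z0) r" for k z
    unfolding j_def
  proof (rule the_equality)
    show "l = k" if "l \<in> K \<and> z \<in> ball (l z0) r" for l
      using far [of z l z k] that \<open>k \<in> K\<close> \<open>z \<in> ball (k z0) r\<close> r0 by auto
  qed (use that in blast)
  have sheet: "j z \<in> K \<and> z \<in> ball (j z z0) r" if z: "z \<in> Z" "p z \<in> V" for z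
  proof -
    obtain w where w: "w \<in> B" "p w = p z"
      using z(2) unfolding V_def by auto
    then obtain k where k: "k \<in> K" "z = k w"
      using fibre [of w z] z(1) by (auto simp: B_def)
    then have "z \<in> ball (k z0) r"
      using w(1) isometry [OF k(1)] by (simp add: B_def)
    then show ?thesis
      using j_eq k(1) by simp
  qed
  have inV: "p z \<in> V" if z: "z \<in> Z" "z \<in> ball (k z0) r" and k: "k \<in> K" for z k
  proof -
    obtain k' where k': "k' \<in> K" "k \<circ> k' = id" "k' \<circ> k = id"
      using inverse_K [OF k] by blast
    have "dist z0 (k' z) = dist (k z0) (k (k' z))"
      using isometry [OF k] by simp
    also have "k (k' z) = z"
      using k'(2) by (metis comp_apply id_apply)
    finally have "k' z \<in> B"
      using z K_Z [OF k'(1) z(1)] by (simp add: B_def)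
    moreover have "p z = p (k' z)"
      using fibre [OF z(1) K_Z [OF k'(1) z(1)]] k'(1) by blast
    ultimately show ?thesis
      by (simp add: V_def)
  qed
  have sheet_eq: "{z \<in> Z. p z \<in> V \<and> j z = k} = ball (k z0) r \<inter> Z" if "k \<in> K" for k
    using sheet inV j_eq that by auto
  have j_fibre: "bij_betw j {z \<in> Z. p z = y} K" if "y \<in> V" for y
  proof -
    obtain w where w: "w \<in> B" "p w = y"
      using \<open>y \<in> V\<close> unfolding V_def by auto
    have wZ: "w \<in> Z" using w by (simp add: B_def)
    have jk: "j (k w) = k" if "k \<in> K" for k
      using j_eq [OF that, of "k w"] w(1) isometry [OF that] by (simp add: B_def)
    have "{z \<in> Z. p z = y} = (\<lambda>k. k w) ` K"
    proof (intro equalityI subsetI)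
      fix x assume "x \<in> {z \<in> Z. p z = y}"
      then have "\<exists>k\<in>K. x = k w"
        using fibre [OF wZ, of x] w(2) by simp
      then show "x \<in> (\<lambda>k. k w) ` K" by blast
    next
      fix x assume "x \<in> (\<lambda>k. k w) ` K"
      then have "\<exists>k\<in>K. x = k w" "x \<in> Z"
        using K_Z [OF _ wZ] by auto
      then show "x \<in> {z \<in> Z. p z = y}"
        using fibre [OF wZ, of x] w(2) by simp
    qed
    then show ?thesis
      using jk by (auto simp: bij_betw_def inj_on_def image_image)
  qed
  have near_iff: "near z w \<longleftrightarrow> j z = j w"
    if z: "z \<in> Z" "p z \<in> V" and w: "w \<in> Z" "p w \<in> V" for z w
  proof
    assume eq: "j z = j w"
    show "near z w"
      unfolding near_def
    proof (intro ballI impI)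
      fix w' assume w': "w' \<in> Z" "p w' = p w" "w' \<noteq> w"
      then have "j w' \<noteq> j w"
        using j_fibre [of "p w"] w by (auto simp: bij_betw_def inj_on_def)
      then have "2 * r < dist z w'"
        using far [of z "j z" w' "j w'"] sheet [OF z] sheet [of w'] w' w(2) eq by auto
      moreover have "dist z w < 2 * r"
        using close [of z "j z" w] sheet [OF z] sheet [OF w] eq by simp
      ultimately show "dist z w < dist z w'" by simp
    qed
  next
    assume near: "near z w"
    show "j z = j w"
    proof (rule ccontr)
      assume neq: "j z \<noteq> j w"
      have "j z \<in> j ` {x \<in> Z. p x = p w}"
        using j_fibre [OF w(2)] sheet [OF z] by (simp add: bij_betw_def)
      then obtain w' where w': "w' \<in> Z" "p w' = p w" "j w' = j z"
        by auto
      then have "w' \<noteq> w" using neq by auto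
      then have "dist z w < dist z w'"
        using near w' by (simp add: near_def)
      moreover have "dist z w' < 2 * r"
        using close [of z "j z" w'] sheet [OF z] sheet [of w'] w' w(2) by simp
      moreover have "2 * r < dist z w"
        using far [of z "j z" w "j w"] sheet [OF z] sheet [OF w] neq by simp
      ultimately show False by simp
    qed
  qed
  have triv: "trivialisation c V j"
    unfolding trivialisation_def using near_iff j_fibre sheet_eq coc
    by (auto simp: openin_open_Int Int_commute)
  have open_ball: "openin (top_of_set Z) (ball x r \<inter> Z)" for x
    by (simp add: openin_open_Int Int_commute)
  then have "openin X V"
    unfolding V_def B_def by (intro p_open)
  moreover have "y \<in> V"
    using z0 r0 by (auto simp: V_def B_def)
  moreover have "sectioned_nhd X Z p V"
    unfolding sectioned_nhd_def
  proof (intro ballI impI)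
    fix e assume e: "e \<in> Z" "p e \<in> V"
    define S where "S = ball (j e z0) r \<inter> Z"
    define s where "s = inv_into S p"
    have pS: "p ` S = V"
    proof
      show "p ` S \<subseteq> V"
        using inV sheet [OF e] by (auto simp: S_def)
      show "V \<subseteq> p ` S"
      proof
        fix y assume "y \<in> V"
        then have "j e \<in> j ` {z \<in> Z. p z = y}"
          using j_fibre sheet [OF e] by (simp add: bij_betw_def)
        then obtain z where "z \<in> Z" "p z = y" "j z = j e" by auto
        with sheet [of z] \<open>y \<in> V\<close> show "y \<in> p ` S"
          by (auto simp: S_def)
      qed
    qed
    have inj: "inj_on p S"
    proof (rule inj_onI)
      fix z w assume zw: "z \<in> S" "w \<in> S" "p z = p w"
      then have "j z = j e" "j w = j e"
        using j_eq [of "j e"] sheet [OF e] unfolding S_def by blast+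
      then have "j z = j w" by simp
      moreover have "p w \<in> V" using zw pS by blast
      ultimately show "z = w"
        using j_fibre zw unfolding bij_betw_def inj_on_def S_def by blast
    qed
    have ps: "p (s y) = y" "s y \<in> S" if "y \<in> V" for y
      using that pS by (simp_all add: s_def f_inv_into_f inv_into_into)
    have "continuous_map (subtopology X V) (top_of_set Z) s"
      unfolding continuous_map_def
    proof (intro conjI allI impI)
      show "s \<in> topspace (subtopology X V) \<rightarrow> topspace (top_of_set Z)"
        using ps(2) by (auto simp: S_def)
      fix U assume U: "openin (top_of_set Z) U"
      have "openin X (p ` (S \<inter> U))"
        using p_open openin_Int [OF open_ball U] by (simp add: S_def)
      moreover have "{x \<in> topspace (subtopology X V). s x \<in> U} = p ` (S \<inter> U)"
      proof -
        have "V \<subseteq> topspace X"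
          using \<open>openin X V\<close> by (rule openin_subset)
        moreover have "s (p z) = z" if "z \<in> S" for z
          using inj that by (simp add: s_def)
        moreover have "p z \<in> V" if "z \<in> S" for z
          using that pS by blast
        ultimately show ?thesis
          using ps by (force simp: image_iff)
      qed
      ultimately show "openin (subtopology X V) {x \<in> topspace (subtopology X V). s x \<in> U}"
        using openin_open_subtopology [OF \<open>openin X V\<close>] pS by (metis Int_lower1 image_mono)
    qed
    moreover have "s (p e) = e"
      using inj sheet [OF e] e(1) by (simp add: s_def S_def)
    ultimately show "\<exists>s. continuous_map (subtopology X V) (top_of_set Z) s \<and> (\<forall>y\<in>V. p (s y) = y) \<and> s (p e) = e"
      using ps(1) by blast
  qed
  ultimately show thesis
    using that triv by blast
qed


definition point_of :: "'a \<Rightarrow> 'k::finite \<Rightarrow> 'z" where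
  "point_of x = (SOME e. bij_betw e UNIV {z \<in> Z. p z = x})"

text \<open>
  The cocycle of the induced representation: its \<open>2 \<times> 2\<close> blocks are indexed by pairs of points in the
  two fibres, and the block is \<open>c\<close> on pairs that lie on a common sheet and zero elsewhere.
\<close>

definition induced ::
    "('n::finite \<Rightarrow> 'k::finite \<times> 2) \<Rightarrow> ('z \<Rightarrow> 'z \<Rightarrow> int^2^2) \<Rightarrow> 'a \<Rightarrow> 'a \<Rightarrow> int^'n^'n" where
  "induced \<beta> c x y = (\<chi> i j.
     if near (point_of x (fst (\<beta> i))) (point_of y (fst (\<beta> j)))
     then c (point_of x (fst (\<beta> i))) (point_of y (fst (\<beta> j))) $ snd (\<beta> i) $ snd (\<beta> j) else 0)"

lemma bij_point_of:
  assumes card: "CARD('k::finite) = card K" and y: "y \<in> V" and triv: "trivialisation c V j"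
  shows "bij_betw (point_of y :: 'k \<Rightarrow> 'z) UNIV {z \<in> Z. p z = y}"
proof -
  have "bij_betw j {z \<in> Z. p z = y} K"
    using triv y by (simp add: trivialisation_def)
  then have "finite {z \<in> Z. p z = y}" "card {z \<in> Z. p z = y} = CARD('k)"
    using finite_K card bij_betw_finite bij_betw_same_card by fastforce+
  then have "\<exists>e. bij_betw e (UNIV :: 'k set) {z \<in> Z. p z = y}"
    by (intro finite_same_card_bij) simp_all
  then show ?thesis
    unfolding point_of_def by (rule someI_ex)
qed

text \<open>
  On a trivialised neighbourhood each point of one fibre has exactly one partner on its sheet in the
  other fibre, so the induced matrices are block monomial and the sum over the middle index in a
  product has a single non-zero block.
\<close>

lemma cocycle_on_induced:
  fixes \<beta> :: "'n::finite \<Rightarrow> 'k::finite \<times> 2"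
  assumes card: "CARD('k) = card K" and \<beta>: "bij \<beta>" and triv: "trivialisation c V j"
  shows "cocycle_on V (induced \<beta> c)"
proof -
  let ?e = "point_of :: 'a \<Rightarrow> 'k \<Rightarrow> 'z"
  define l where "l x k = j (?e x k)" for x and k :: 'k
  have e: "?e x k \<in> Z" "p (?e x k) = x" if "x \<in> V" for x k
    using bij_point_of [OF card that triv] by (auto simp: bij_betw_def)
  have l_bij: "bij_betw (l x) UNIV K" if "x \<in> V" for x
    using bij_betw_trans [OF bij_point_of [OF card that triv], of j K] triv that
    by (simp add: trivialisation_def l_def o_def cong: bij_betw_cong)
  have near: "near (?e x k) (?e y m) \<longleftrightarrow> l x k = l y m" if "x \<in> V" "y \<in> V" for x y k m
    using triv e that by (simp add: trivialisation_def l_def)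
  have coc: "cocycle_on {z \<in> Z. p z \<in> V \<and> j z = k} c" if "k \<in> K" for k
    using triv that by (simp add: trivialisation_def)
  have lK: "l x k \<in> K" if "x \<in> V" for x k
    using l_bij [OF that] by (auto simp: bij_betw_def)
  have ind: "induced \<beta> c x y $ i $ m =
      (if l x (fst (\<beta> i)) = l y (fst (\<beta> m))
       then c (?e x (fst (\<beta> i))) (?e y (fst (\<beta> m))) $ snd (\<beta> i) $ snd (\<beta> m) else 0)"
    if "x \<in> V" "y \<in> V" for x y i m
    using that by (simp add: induced_def near)
  have l_inj: "l x k = l x m \<longleftrightarrow> k = m" if "x \<in> V" for x k m
    using l_bij [OF that] by (auto simp: bij_betw_def inj_def)
  have mem: "?e x k \<in> {z \<in> Z. p z \<in> V \<and> j z = l x k}" if "x \<in> V" for x k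
    using e that by (simp add: l_def)
  have \<beta>_eq: "i = m" if "fst (\<beta> i) = fst (\<beta> m)" "snd (\<beta> i) = snd (\<beta> m)" for i m
    using bij_is_inj [OF \<beta>] that by (simp add: inj_def prod_eq_iff)
  have one: "induced \<beta> c x x = mat 1" if x: "x \<in> V" for x
  proof -
    have "c (?e x k) (?e x k) = mat 1" for k
      using coc [OF lK [OF x], of k] mem [OF x, of k] unfolding cocycle_on_def by blast
    then have "induced \<beta> c x x $ i $ m = mat 1 $ i $ m" for i m
      using x by (auto simp: ind l_inj mat_def dest: \<beta>_eq)
    then show ?thesis by (simp add: vec_eq_iff)
  qed
  have det: "det (induced \<beta> c x y) = 1" if x: "x \<in> V" and y: "y \<in> V" for x y
  proof -
    define \<pi> where "\<pi> = inv_into UNIV (l y) \<circ> l x"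
    have ly: "bij_betw (inv_into UNIV (l y)) K UNIV"
      using bij_betw_inv_into [OF l_bij [OF y]] .
    then have "bij \<pi>"
      unfolding \<pi>_def using bij_betw_trans [OF l_bij [OF x]] by blast
    have l\<pi>: "l y (\<pi> k) = l x k" for k
      using bij_betw_inv_into_right [OF l_bij [OF y] lK [OF x]] by (simp add: \<pi>_def)
    have eq: "l x k = l y m \<longleftrightarrow> \<pi> k = m" for k m
      using l\<pi> [of k] l_inj [OF y, of "\<pi> k" m] by auto
    define C where "C k = c (?e x k) (?e y (\<pi> k))" for k
    have "det (C k) = 1" for k
    proof -
      have "?e y (\<pi> k) \<in> {z \<in> Z. p z \<in> V \<and> j z = l x k}"
        using mem [OF y, of "\<pi> k"] by (simp add: l\<pi>)
      then show ?thesis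
        using coc [OF lK [OF x], of k] mem [OF x, of k] unfolding cocycle_on_def C_def by blast
    qed
    moreover have "induced \<beta> c x y = (\<chi> i m. if \<pi> (fst (\<beta> i)) = fst (\<beta> m)
        then C (fst (\<beta> i)) $ snd (\<beta> i) $ snd (\<beta> m) else 0)"
      using x y by (auto simp: vec_eq_iff ind eq C_def)
    ultimately show ?thesis
      using det_block_monomial [OF \<beta> _ \<open>bij \<pi>\<close>, of C] by simp
  qed
  have mult: "induced \<beta> c x y ** induced \<beta> c y w = induced \<beta> c x w"
    if x: "x \<in> V" and y: "y \<in> V" and w: "w \<in> V" for x y w
  proof -
    have "(induced \<beta> c x y ** induced \<beta> c y w) $ i $ m = induced \<beta> c x w $ i $ m" for i m
    proof -
      let ?z = "?e x (fst (\<beta> i))" and ?a = "snd (\<beta> i)" and ?v = "?e w (fst (\<beta> m))" and ?d = "snd (\<beta> m)"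
      have "l x (fst (\<beta> i)) \<in> l y ` UNIV"
        using bij_betw_imp_surj_on [OF l_bij [OF y]] lK [OF x] by simp
      then obtain k where k: "l x (fst (\<beta> i)) = l y k" by (elim imageE)
      have "(induced \<beta> c x y ** induced \<beta> c y w) $ i $ m
          = (\<Sum>h\<in>UNIV. induced \<beta> c x y $ i $ h * induced \<beta> c y w $ h $ m)"
        by (simp add: matrix_matrix_mult_def)
      also have "\<dots> = (\<Sum>h\<in>UNIV. if fst (\<beta> h) = k \<and> l y k = l w (fst (\<beta> m))
            then c ?z (?e y k) $ ?a $ snd (\<beta> h) * c (?e y k) ?v $ snd (\<beta> h) $ ?d else 0)"
        using x y w by (intro sum.cong) (auto simp: ind k l_inj)
      also have "\<dots> = (if l y k = l w (fst (\<beta> m)) then (c ?z (?e y k) ** c (?e y k) ?v) $ ?a $ ?d else 0)"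
        using sum_over_block [OF \<beta>, of k "l y k = l w (fst (\<beta> m))"
            "\<lambda>b. c ?z (?e y k) $ ?a $ b * c (?e y k) ?v $ b $ ?d"]
        by (simp add: matrix_matrix_mult_def)
      also have "\<dots> = induced \<beta> c x w $ i $ m"
      proof (cases "l y k = l w (fst (\<beta> m))")
        case True
        have "?z \<in> {z \<in> Z. p z \<in> V \<and> j z = l y k}" "?e y k \<in> {z \<in> Z. p z \<in> V \<and> j z = l y k}"
            "?v \<in> {z \<in> Z. p z \<in> V \<and> j z = l y k}"
          using mem [OF x, of "fst (\<beta> i)"] mem [OF y, of k] mem [OF w, of "fst (\<beta> m)"] k True
          by simp_all
        then have "c ?z (?e y k) ** c (?e y k) ?v = c ?z ?v"
          using coc [OF lK [OF y], of k] unfolding cocycle_on_def by blast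
        then show ?thesis
          using True x w k by (simp add: ind)
      next
        case False
        then show ?thesis
          using x w k by (simp add: ind)
      qed
      finally show ?thesis .
    qed
    then show ?thesis by (simp add: vec_eq_iff)
  qed
  show ?thesis
    unfolding cocycle_on_def using one det mult by blast
qed

lemma local_cocycle_induced:
  fixes \<beta> :: "'n::finite \<Rightarrow> 'k::finite \<times> 2"
  assumes "CARD('k) = card K" "bij \<beta>" and c: "local_cocycle (top_of_set Z) c"
  shows "local_cocycle X (induced \<beta> c)"
  unfolding local_cocycle_def
proof
  fix x assume "x \<in> topspace X"
  from trivialisation_exists [OF c this]
  obtain V j where "openin X V" "x \<in> V" "trivialisation c V j" .
  with cocycle_on_induced [OF assms(1,2)]
  show "\<exists>U. openin X U \<and> x \<in> U \<and> cocycle_on U (induced \<beta> c)" by blast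
qed

lemma lift_path:
  assumes "pathin X \<gamma>" "z0 \<in> Z" "p z0 = \<gamma> 0"
  obtains g where "path g" "path_image g \<subseteq> Z" "g 0 = z0" "\<And>t. t \<in> {0..1} \<Longrightarrow> p (g t) = \<gamma> t"
proof -
  have one: "local_cocycle (top_of_set Z) (\<lambda>_ _. mat 1 :: int^2^2)"
    unfolding local_cocycle_def cocycle_on_def by (intro ballI exI [of _ Z]) simp
  have sec: "\<exists>V. openin X V \<and> y \<in> V \<and> sectioned_nhd X Z p V" if "y \<in> topspace X" for y
    by (rule trivialisation_exists [OF one that]) blast
  show thesis
    by (rule path_lift [OF assms(1) sec assms(2,3)], assumption, rule that)
qed

text \<open>
  In the block row of the starting point of the lift, the flat section of the induced cocycle has only
  one non-zero block: it sits at the current point of the lift and is the flat section of \<open>c\<close>. If the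
  transport is the identity, that block has returned to the diagonal, hence the lift is closed.
\<close>

lemma induced_transport_trivial:
  fixes \<beta> :: "'n::finite \<Rightarrow> 'k::finite \<times> 2"
  assumes card: "CARD('k) = card K" and \<beta>: "bij \<beta>" and c: "local_cocycle (top_of_set Z) c"
    and g: "path g" "path_image g \<subseteq> Z" "\<And>t. t \<in> {0..1} \<Longrightarrow> p (g t) = \<gamma> t"
    and loop: "\<gamma> 0 = \<gamma> 1" and tr: "transport (induced \<beta> c) \<gamma> (mat 1) (mat 1)"
  shows "g 0 = g 1" "transport c g (mat 1) (mat 1)"
proof -
  let ?e = "point_of :: 'a \<Rightarrow> 'k \<Rightarrow> 'z"
  have gZ: "g t \<in> Z" if "t \<in> {0..1}" for t
    using g(2) that by (auto simp: path_image_def)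
  have cg: "continuous_map (top_of_set {0..1}) (top_of_set Z) g"
    using g(1) gZ by (auto simp: path_def continuous_map_in_subtopology)
  have "pathin (top_of_set Z) g"
    using cg by (simp add: pathin_def)
  obtain N where N: "transport c g (mat 1) N"
    using transport_exists [OF c \<open>pathin (top_of_set Z) g\<close>] by blast
  obtain f' d' where f': "0 < d'" "f' 0 = mat 1" "f' 1 = N"
    "\<And>s t. s \<in> {0..1} \<Longrightarrow> t \<in> {0..1} \<Longrightarrow> \<bar>s - t\<bar> < d' \<Longrightarrow> f' s ** c (g s) (g t) = f' t"
    using N unfolding transport_def by blast
  obtain f d where f: "0 < d" "f 0 = mat 1" "f 1 = mat 1"
    "\<And>s t. s \<in> {0..1} \<Longrightarrow> t \<in> {0..1} \<Longrightarrow> \<bar>s - t\<bar> < d \<Longrightarrow> f s ** induced \<beta> c (\<gamma> s) (\<gamma> t) = f t"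
    using tr unfolding transport_def by blast
  have X: "\<gamma> t \<in> topspace X" if "t \<in> {0..1}" for t
    using g(3) [OF that] gZ [OF that] p_surj by (metis imageI)
  have e_bij: "bij_betw (?e (\<gamma> t)) UNIV {z \<in> Z. p z = \<gamma> t}" if "t \<in> {0..1}" for t
    by (rule trivialisation_exists [OF c X [OF that]]) (rule bij_point_of [OF card])
  have "\<exists>\<kappa>. t \<in> {0..1} \<longrightarrow> ?e (\<gamma> t) \<kappa> = g t" for t
  proof (cases "t \<in> {0..1}")
    case True
    then have "g t \<in> ?e (\<gamma> t) ` UNIV"
      using e_bij gZ g(3) by (simp add: bij_betw_def)
    then show ?thesis by force
  qed auto
  then obtain \<kappa> where \<kappa>: "\<And>t. t \<in> {0..1} \<Longrightarrow> ?e (\<gamma> t) (\<kappa> t) = g t"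
    by metis
  define Q where
    "Q U \<longleftrightarrow> (\<forall>s\<in>U. \<forall>t\<in>U. \<forall>m. near (g s) (?e (\<gamma> t) m) \<longleftrightarrow> m = \<kappa> t)" for U
  have "\<exists>d>0. \<forall>x\<in>{0..1::real}. \<exists>U. Q U \<and> {0..1} \<inter> ball x d \<subseteq> U"
  proof (rule compact_uniform_nhds)
    fix t0 :: real assume t0: "t0 \<in> {0..1}"
    obtain V j where V: "openin X V" "\<gamma> t0 \<in> V" and triv: "trivialisation c V j"
      using trivialisation_exists [OF c X [OF t0]] by metis
    define S where "S = {z \<in> Z. p z \<in> V \<and> j z = j (g t0)}"
    have "j ` {z \<in> Z. p z = \<gamma> t0} = K"
      using triv V(2) by (simp add: trivialisation_def bij_betw_def)
    then have jK: "j (g t0) \<in> K"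
      using gZ [OF t0] g(3) [OF t0] by blast
    then have S: "openin (top_of_set Z) S"
      using triv by (simp add: trivialisation_def S_def)
    let ?U = "{t \<in> {0..1}. g t \<in> S}"
    have "openin (top_of_set {0..1}) ?U"
      using cg S by (auto simp: continuous_map_def)
    moreover have "t0 \<in> ?U"
      using t0 gZ g(3) V(2) by (simp add: S_def)
    moreover have "Q ?U"
      unfolding Q_def
    proof (intro ballI allI)
      fix s t m assume st: "s \<in> ?U" "t \<in> ?U"
      then have t: "t \<in> {0..1}" "\<gamma> t \<in> V" and js: "j (g s) = j (g t)"
        using g(3) by (auto simp: S_def)
      have em: "?e (\<gamma> t) m \<in> {z \<in> Z. p z = \<gamma> t}"
        using e_bij [OF t(1)] by (auto simp: bij_betw_def)
      then have "near (g s) (?e (\<gamma> t) m) \<longleftrightarrow> j (g s) = j (?e (\<gamma> t) m)"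
        using triv st t(2) by (simp add: trivialisation_def S_def)
      also have "\<dots> \<longleftrightarrow> j (?e (\<gamma> t) (\<kappa> t)) = j (?e (\<gamma> t) m)"
        using \<kappa> [OF t(1)] js by simp
      also have "\<dots> \<longleftrightarrow> ?e (\<gamma> t) (\<kappa> t) = ?e (\<gamma> t) m"
      proof -
        have "inj_on j {z \<in> Z. p z = \<gamma> t}"
          using triv t(2) by (simp add: trivialisation_def bij_betw_def)
        moreover have "?e (\<gamma> t) (\<kappa> t) \<in> {z \<in> Z. p z = \<gamma> t}"
          using e_bij [OF t(1)] by (auto simp: bij_betw_def)
        ultimately show ?thesis
          using em inj_onD by fastforce
      qed
      also have "\<dots> \<longleftrightarrow> m = \<kappa> t"
        using e_bij [OF t(1)] by (auto simp: bij_betw_def inj_def)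
      finally show "near (g s) (?e (\<gamma> t) m) \<longleftrightarrow> m = \<kappa> t" .
    qed
    ultimately show "\<exists>U. openin (top_of_set {0..1}) U \<and> t0 \<in> U \<and> Q U"
      by blast
  qed simp
  then obtain d2 where d2: "0 < d2" "\<And>x::real. x \<in> {0..1} \<Longrightarrow> \<exists>U. Q U \<and> {0..1} \<inter> ball x d2 \<subseteq> U"
    by blast
  have nr: "near (g s) (?e (\<gamma> t) m) \<longleftrightarrow> m = \<kappa> t"
    if "s \<in> {0..1}" "t \<in> {0..1}" "\<bar>s - t\<bar> < d2" for s t m
  proof -
    from d2(2) [OF \<open>s \<in> {0..1}\<close>] obtain U where "Q U" "{0..1} \<inter> ball s d2 \<subseteq> U"
      by blast
    moreover have "s \<in> {0..1} \<inter> ball s d2" "t \<in> {0..1} \<inter> ball s d2"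
      using that d2(1) by (auto simp: dist_real_def)
    ultimately show ?thesis unfolding Q_def by blast
  qed
  define \<delta> where "\<delta> = min d (min d' d2)"
  have \<delta>: "0 < \<delta>" "\<delta> \<le> d" "\<delta> \<le> d'" "\<delta> \<le> d2"
    using f f' d2 by (auto simp: \<delta>_def)
  obtain n :: nat where n0: "0 < real n" and n1: "1 / real n < \<delta>"
    using fine_partition \<delta>(1) by blast
  have \<beta>_eq: "i = m" if "fst (\<beta> i) = fst (\<beta> m)" "snd (\<beta> i) = snd (\<beta> m)" for i m
    using bij_is_inj [OF \<beta>] that by (simp add: inj_def prod_eq_iff)
  have step: "f (real k / real n) $ i $ m =
      (if fst (\<beta> m) = \<kappa> (real k / real n) then f' (real k / real n) $ snd (\<beta> i) $ snd (\<beta> m) else 0)"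
    if "k \<le> n" "fst (\<beta> i) = \<kappa> 0" for k i m
    using that(1)
  proof (induction k arbitrary: m)
    case 0
    show ?case
      using f(2) f'(2) that(2) \<beta>_eq [of i m] by (auto simp: mat_def)
  next
    case (Suc k)
    define s t where "s = real k / real n" and "t = real (Suc k) / real n"
    have ts: "t - s = 1 / real n"
      by (simp add: s_def t_def add_divide_distrib)
    have "\<bar>t - s\<bar> = 1 / real n"
      unfolding ts using n0 by simp
    then have close: "\<bar>s - t\<bar> < \<delta>"
      using n1 by (metis abs_minus_commute)
    have st: "s \<in> {0..1}" "t \<in> {0..1}"
      using Suc.prems n0 by (auto simp: s_def t_def)
    have IH: "f s $ i $ h = (if fst (\<beta> h) = \<kappa> s then f' s $ snd (\<beta> i) $ snd (\<beta> h) else 0)" for h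
      using Suc by (simp add: s_def)
    have near: "near (g s) (?e (\<gamma> t) l) \<longleftrightarrow> l = \<kappa> t" for l
      using nr [OF st] close \<delta> by simp
    have "f t $ i $ m = (f s ** induced \<beta> c (\<gamma> s) (\<gamma> t)) $ i $ m"
      using f(4) [OF st] close \<delta> by simp
    also have "\<dots> = (\<Sum>h\<in>UNIV. f s $ i $ h * induced \<beta> c (\<gamma> s) (\<gamma> t) $ h $ m)"
      by (simp add: matrix_matrix_mult_def)
    also have "\<dots> = (\<Sum>h\<in>UNIV. if fst (\<beta> h) = \<kappa> s \<and> fst (\<beta> m) = \<kappa> t
          then f' s $ snd (\<beta> i) $ snd (\<beta> h) * c (g s) (g t) $ snd (\<beta> h) $ snd (\<beta> m) else 0)"
      using near near [of "\<kappa> t"] \<kappa> [OF st(1)] \<kappa> [OF st(2)] by (intro sum.cong) (auto simp: IH induced_def)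
    also have "\<dots> = (if fst (\<beta> m) = \<kappa> t then (f' s ** c (g s) (g t)) $ snd (\<beta> i) $ snd (\<beta> m) else 0)"
      using sum_over_block [OF \<beta>, of "\<kappa> s" "fst (\<beta> m) = \<kappa> t"
          "\<lambda>b. f' s $ snd (\<beta> i) $ b * c (g s) (g t) $ b $ snd (\<beta> m)"]
      by (simp add: matrix_matrix_mult_def)
    also have "f' s ** c (g s) (g t) = f' t"
      using f'(4) [OF st] close \<delta> by simp
    finally show ?case by (simp add: t_def)
  qed
  have one: "(mat 1 :: int^'n^'n) $ i $ m = (if fst (\<beta> m) = \<kappa> 1 then N $ snd (\<beta> i) $ snd (\<beta> m) else 0)"
    if "fst (\<beta> i) = \<kappa> 0" for i m
    using step [of n i m] that f(3) f'(3) n0 by simp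
  have \<beta>_surj: "\<exists>i. \<beta> i = x" for x
    using \<beta> by (metis bij_pointE)
  obtain i0 where "\<beta> i0 = (\<kappa> 0, 1)" using \<beta>_surj by blast
  then have \<kappa>01: "\<kappa> 1 = \<kappa> 0"
    using one [of i0 i0] by (auto simp: mat_def split: if_splits)
  then show "g 0 = g 1"
    using \<kappa> [of 0] \<kappa> [of 1] loop by simp
  have "N $ a $ b = mat 1 $ a $ b" for a b
  proof -
    obtain i m where "\<beta> i = (\<kappa> 0, a)" "\<beta> m = (\<kappa> 0, b)"
      using \<beta>_surj by metis
    then show ?thesis
      using one [of i m] \<kappa>01 \<beta>_eq [of i m] by (auto simp: mat_def split: if_splits)
  qed
  then have "N = mat 1" by (simp add: vec_eq_iff)
  with N show "transport c g (mat 1) (mat 1)" by simp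
qed

end

section \<open>Ping-pong for shear matrices\<close>

definition mat2 :: "int \<Rightarrow> int \<Rightarrow> int \<Rightarrow> int \<Rightarrow> int^2^2" where
  "mat2 a b c d = vector [vector [a, b], vector [c, d]]"

lemma mat2_nth [simp]:
  "mat2 a b c d $ 1 $ 1 = a" "mat2 a b c d $ 1 $ 2 = b"
  "mat2 a b c d $ 2 $ 1 = c" "mat2 a b c d $ 2 $ 2 = d"
  by (simp_all add: mat2_def)

lemma mat2_mult:
  "mat2 a b c d ** mat2 a' b' c' d' =
     mat2 (a * a' + b * c') (a * b' + b * d') (c * a' + d * c') (c * b' + d * d')"
  by (simp add: vec_eq_iff forall_2 matrix_matrix_mult_def sum_2)

lemma mat2_one: "mat 1 = mat2 1 0 0 1"
  by (simp add: vec_eq_iff forall_2 mat_def)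

lemma det_mat2: "det (mat2 a b c d) = a * d - b * c"
  by (simp add: det_2)

lemma mat2_apply: "mat2 a b c d *v v = vector [a * v $ 1 + b * v $ 2, c * v $ 1 + d * v $ 2]"
  by (simp add: vec_eq_iff forall_2 matrix_vector_mult_def sum_2)

type_synonym quadrant = "bool \<times> bool"

text \<open>
  The sign of the off-diagonal entry is the second component of the index, so flipping it inverts the
  matrix. As a Moebius transformation, a shear composed with the reflection that changes the
  sign of one coordinate is a reflection in a side of the ideal quadrilateral with vertices \<open>- 1\<close>, \<open>0\<close>,
  \<open>1\<close> and infinity.
\<close>

definition shear :: "quadrant \<Rightarrow> int^2^2" where
  "shear q = (case q of
     (True, True) \<Rightarrow> mat2 1 2 0 1 | (True, False) \<Rightarrow> mat2 1 (- 2) 0 1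
   | (False, True) \<Rightarrow> mat2 1 0 2 1 | (False, False) \<Rightarrow> mat2 1 0 (- 2) 1)"

definition shear_inv :: "quadrant \<Rightarrow> int^2^2" where
  "shear_inv q = shear (fst q, \<not> snd q)"

lemma shear_inv: "shear q ** shear_inv q = mat 1" "shear_inv q ** shear q = mat 1"
  by (cases q; auto simp: shear_def shear_inv_def mat2_mult mat2_one split: bool.split)+

lemma det_shear: "det (shear q) = 1" "det (shear_inv q) = 1"
  by (cases q; auto simp: shear_def shear_inv_def det_mat2 split: bool.split)+

text \<open>
  In terms of the slope \<open>t = v $ 1 / v $ 2\<close> the four sectors are \<open>1 < t\<close>, \<open>t < - 1\<close>, \<open>0 < t < 1\<close> and
  \<open>- 1 < t < 0\<close>. They are symmetric under \<open>v \<mapsto> - v\<close>, so they cannot distinguish a matrix from its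
  negative; this gives the statement about \<open>- mat 1\<close> for free.
\<close>

definition sector :: "quadrant \<Rightarrow> (int^2) set" where
  "sector q = {v. let s = (if snd q then 1 else - 1) * (v $ 1 * v $ 2) in
     if fst q then (v $ 2)\<^sup>2 < s else (v $ 1)\<^sup>2 < s}"

definition conj_quadrant :: "quadrant \<Rightarrow> quadrant" where
  "conj_quadrant q = (fst q, \<not> snd q)"

lemma shear_sector:
  assumes "v \<in> sector r" "r \<noteq> conj_quadrant q"
  shows "shear q *v v \<in> sector q"
proof -
  obtain x y where v: "v $ 1 = x" "v $ 2 = y" by blast
  have sq: "0 \<le> (x + y)\<^sup>2" "0 \<le> (x - y)\<^sup>2" "0 \<le> x * x" "0 \<le> y * y" by simp_all
  show ?thesis
    using assms sq
    by (cases q; cases r)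
      (auto simp: sector_def shear_def conj_quadrant_def mat2_apply v Let_def power2_eq_square
        algebra_simps split: bool.splits if_splits; use sq(3,4) in linarith)+
qed

lemma sector_disjoint: "v \<in> sector q \<Longrightarrow> v \<in> sector r \<Longrightarrow> q = r"
proof -
  assume *: "v \<in> sector q" "v \<in> sector r"
  obtain x y where v: "v $ 1 = x" "v $ 2 = y" by blast
  have sq: "0 \<le> (x + y)\<^sup>2" "0 \<le> (x - y)\<^sup>2" "0 \<le> x * x" "0 \<le> y * y" by simp_all
  show "q = r"
    using * sq
    by (cases q; cases r)
      (auto simp: sector_def v Let_def power2_eq_square algebra_simps split: bool.splits if_splits;
        use sq(3,4) in linarith)+
qed

lemma sector_nonempty: "\<exists>v. v \<in> sector q"
proof -
  have "(vector [if fst q then 2 else 1, (if snd q then 1 else -1) * (if fst q then 1 else 2)] :: int^2)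
      \<in> sector q"
    by (auto simp: sector_def Let_def)
  then show ?thesis ..
qed

lemma sector_uminus: "- v \<in> sector q \<longleftrightarrow> v \<in> sector q"
  by (simp add: sector_def)

text \<open>
  The head of the list is the latest letter. The letters stand for crossings between two half-spaces,
  so they are inverted alternately and the first one (an even position) is not inverted.
\<close>

fun word :: "quadrant list \<Rightarrow> int^2^2" where
  "word [] = mat 1"
| "word (q # qs) = word qs ** (if even (length qs) then shear q else shear_inv q)"

text \<open>
  A shear moves every sector other than that of its inverse into its own sector. Two consecutive letters
  have opposite exponents, hence two different neighbours never cancel, and the image is pushed to the
  sector of the earliest letter.
\<close>

lemma word_ping_pong:
  "distinct_adj (q # qs) \<Longrightarrow> r \<noteq> q \<Longrightarrow>
     v \<in> sector (if even (length qs) then conj_quadrant r else r) \<Longrightarrow>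
     word (q # qs) *v v \<in> sector (last (q # qs))"
proof (induction qs arbitrary: q r v)
  case Nil
  then show ?case
    by (auto intro!: shear_sector simp: conj_quadrant_def prod_eq_iff)
next
  case (Cons a qs)
  have "a \<noteq> q" "distinct_adj (a # qs)"
    using Cons.prems(1) by auto
  have "(if even (length (a # qs)) then shear q else shear_inv q) *v v
      \<in> sector (if even (length qs) then conj_quadrant q else q)"
  proof (cases "even (length qs)")
    case True
    then show ?thesis
      using Cons.prems(2,3) shear_sector [of v r "conj_quadrant q"]
      by (auto simp: shear_inv_def conj_quadrant_def prod_eq_iff)
  next
    case False
    then show ?thesis
      using Cons.prems(2,3) shear_sector [of v "conj_quadrant r" q]
      by (auto simp: conj_quadrant_def prod_eq_iff)
  qed
  from Cons.IH [OF \<open>distinct_adj (a # qs)\<close> \<open>a \<noteq> q\<close> [symmetric] this]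
  show ?case
    by (simp flip: matrix_vector_mul_assoc)
qed

text \<open>
  A starting vector in a sector different from those of the first and last letter exists since there are
  four sectors; the word moves it, up to sign, to a disjoint sector.
\<close>

lemma word_not_central:
  assumes "distinct_adj qs" "even (length qs)" "qs \<noteq> []"
  shows "word qs \<noteq> mat 1" "word qs \<noteq> - mat 1"
proof -
  obtain q qs' where qs: "qs = q # qs'" using assms(3) by (cases qs) auto
  have "\<exists>r. r \<noteq> q \<and> r \<noteq> last qs"
  proof -
    have "card {q, last qs} < card (UNIV :: quadrant set)"
      by (simp add: card_insert_if card_UNIV_bool flip: UNIV_Times_UNIV)
    then have "{q, last qs} \<noteq> UNIV" by (metis less_irrefl)
    then show ?thesis by auto
  qed
  then obtain r where r: "r \<noteq> q" "r \<noteq> last qs" by blast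
  obtain v where v: "v \<in> sector r" using sector_nonempty by blast
  have "word qs *v v \<in> sector (last qs)"
    using word_ping_pong [of q qs' r v] assms r(1) v by (simp add: qs)
  moreover have "v \<notin> sector (last qs)"
    using sector_disjoint r(2) v by blast
  moreover have "- mat 1 *v v = - v"
    by (simp add: vec_eq_iff forall_2 matrix_vector_mult_def mat_def sum_2)
  ultimately show "word qs \<noteq> mat 1" "word qs \<noteq> - mat 1"
    using sector_uminus [of v "last qs"] by (auto simp: matrix_vector_mul_lid)
qed

section \<open>Space without two lines\<close>

type_synonym point3 = "real \<times> real \<times> real"

text \<open>
  The complement of the first two coordinate axes. It deforms to a graph with two vertices, the
  half-spaces above and below the plane of the axes, and four edges, the open quadrants of that plane.
\<close>

definition punctured :: "point3 set" where
  "punctured = {(x, y, z). z \<noteq> 0 \<or> (x \<noteq> 0 \<and> y \<noteq> 0)}"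

text \<open>
  The half-space above (even \<open>k\<close>) or below the plane of the two axes, enlarged by the columns over the four
  quadrants. The two sets are starlike and meet in the four convex columns. Indexing by a number and not by
  a truth value suits a path that changes the set at every step: after \<open>k\<close> changes it is in \<open>side k\<close>.
\<close>

definition side :: "nat \<Rightarrow> point3 set" where
  "side k = {(x, y, z). 0 < (- 1) ^ k * z \<or> (x \<noteq> 0 \<and> y \<noteq> 0)}"

definition quadrant_of :: "point3 \<Rightarrow> quadrant" where
  "quadrant_of n = (0 < fst n, 0 < fst (snd n))"

definition nonneg :: "point3 \<Rightarrow> bool" where
  "nonneg n \<longleftrightarrow> 0 \<le> snd (snd n)"

text \<open>
  Descending through the plane in a quadrant contributes the shear of that quadrant, ascending its
  inverse. Points of the plane count as being above it; close to such a point the quadrant is constant,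
  so it does not matter at which of the two points it is read off.
\<close>

definition crossing :: "point3 \<Rightarrow> point3 \<Rightarrow> int^2^2" where
  "crossing m n =
     (if nonneg m = nonneg n then mat 1 else if nonneg m then shear (quadrant_of m)
      else shear_inv (quadrant_of m))"

text \<open>
  A primitive of the cocycle \<open>crossing\<close> on \<open>side k\<close>, normalised to be the identity in the half-space.
\<close>

definition frame :: "nat \<Rightarrow> point3 \<Rightarrow> int^2^2" where
  "frame k n = (if nonneg n = even k then mat 1
     else if even k then shear (quadrant_of n) else shear_inv (quadrant_of n))"

lemma punctured_eq: "punctured = side 0 \<union> side 1"
  by (auto simp: punctured_def side_def)

lemma side_subset: "side k \<subseteq> punctured"
  by (auto simp: punctured_def side_def)

lemma side_Suc_Suc [simp]: "side (Suc (Suc k)) = side k"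
  by (simp add: side_def)

lemma open_side: "open (side k)"
proof -
  have "open ({n::point3. 0 < (- 1) ^ k * snd (snd n)} \<union> ({n. fst n \<noteq> 0} \<inter> {n. fst (snd n) \<noteq> 0}))"
    by (intro open_Un open_Int open_Collect_less open_Collect_neq continuous_intros)
  also have "{n. 0 < (- 1) ^ k * snd (snd n)} \<union> ({n. fst n \<noteq> 0} \<inter> {n. fst (snd n) \<noteq> 0}) = side k"
    by (auto simp: side_def)
  finally show ?thesis .
qed

definition quadrant_cylinder :: "point3 \<Rightarrow> point3 set" where
  "quadrant_cylinder n =
     {m. 0 < fst m * fst n \<and> 0 < fst (snd m) * fst (snd n)}"

lemma open_quadrant_cylinder: "open (quadrant_cylinder n)"
proof -
  have "quadrant_cylinder n = {m. 0 < fst m * fst n} \<inter> {m. 0 < fst (snd m) * fst (snd n)}"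
    by (auto simp: quadrant_cylinder_def)
  then show ?thesis
    by (auto intro!: open_Int open_Collect_less continuous_intros)
qed

lemma in_own_cylinder: "fst n \<noteq> 0 \<Longrightarrow> fst (snd n) \<noteq> 0 \<Longrightarrow> n \<in> quadrant_cylinder n"
  by (auto simp: quadrant_cylinder_def zero_less_mult_iff linorder_neq_iff)

lemma quadrant_of_cylinder: "\<exists>q. \<forall>m\<in>quadrant_cylinder n. quadrant_of m = q"
  by (rule exI [of _ "quadrant_of n"])
    (auto simp: quadrant_cylinder_def quadrant_of_def zero_less_mult_iff)

lemma same_side_nhd:
  assumes "snd (snd n) \<noteq> (0::real)"
  shows "\<exists>U b. open U \<and> n \<in> U \<and> (\<forall>m\<in>U. nonneg m = b)"
proof (cases "0 < snd (snd n)")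
  case True
  then show ?thesis
    by (intro exI [of _ "{m. 0 < snd (snd m)}"] exI [of _ True])
      (auto simp: nonneg_def intro!: open_Collect_less continuous_intros)
next
  case False
  with assms show ?thesis
    by (intro exI [of _ "{m. snd (snd m) < 0}"] exI [of _ False])
      (auto simp: nonneg_def intro!: open_Collect_less continuous_intros)
qed

lemma local_cocycle_crossing: "local_cocycle (top_of_set punctured) crossing"
  unfolding local_cocycle_def
proof
  fix n assume "n \<in> topspace (top_of_set punctured)"
  then have n: "n \<in> punctured" by simp
  have "\<exists>U. open U \<and> n \<in> U \<and> cocycle_on U crossing"
  proof (cases "snd (snd n) = 0")
    case True
    with n have "n \<in> quadrant_cylinder n"
      by (intro in_own_cylinder) (auto simp: punctured_def)
    moreover obtain q where "\<forall>m\<in>quadrant_cylinder n. quadrant_of m = q"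
      using quadrant_of_cylinder [of n] by blast
    then have "crossing x x = mat 1" "det (crossing x y) = 1"
        "crossing x y ** crossing y z = crossing x z"
      if "x \<in> quadrant_cylinder n" "y \<in> quadrant_cylinder n" "z \<in> quadrant_cylinder n" for x y z
      using that by (cases "nonneg x"; cases "nonneg y"; cases "nonneg z";
          simp add: crossing_def shear_inv det_shear)+
    then have "cocycle_on (quadrant_cylinder n) crossing"
      unfolding cocycle_on_def by blast
    ultimately show ?thesis using open_quadrant_cylinder by blast
  next
    case False
    from same_side_nhd [OF this]
    obtain U b where "open U \<and> n \<in> U \<and> (\<forall>m\<in>U. nonneg m = b)"
      by (elim exE)
    then show ?thesis
      by (intro exI [of _ U]) (simp add: cocycle_on_def crossing_def)
  qed
  then obtain U where U: "open U" "n \<in> U" "cocycle_on U crossing" by blast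
  then have "cocycle_on (punctured \<inter> U) crossing"
    by (auto simp: cocycle_on_def)
  then show "\<exists>U. openin (top_of_set punctured) U \<and> n \<in> U \<and> cocycle_on U crossing"
    using U n by (intro exI [of _ "punctured \<inter> U"]) (auto simp: openin_open_Int)
qed

lemma transport_local_frame:
  fixes S :: "'a::topological_space set" and c :: "'a \<Rightarrow> 'a \<Rightarrow> int^'n^'n"
  assumes \<gamma>: "path \<gamma>" "path_image \<gamma> \<subseteq> S"
    and F: "\<And>n. n \<in> S \<Longrightarrow> \<exists>U. open U \<and> n \<in> U \<and>
        (\<forall>x\<in>S \<inter> U. \<forall>y\<in>S \<inter> U. F x ** c x y = F y)"
  shows "transport c \<gamma> (F (\<gamma> 0)) (F (\<gamma> 1))"
proof -
  define Q where "Q T \<longleftrightarrow> (\<forall>s\<in>T. \<forall>t\<in>T. F (\<gamma> s) ** c (\<gamma> s) (\<gamma> t) = F (\<gamma> t))" for T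
  have "\<exists>d>0. \<forall>t\<in>{0..1::real}. \<exists>T. Q T \<and> {0..1} \<inter> ball t d \<subseteq> T"
  proof (rule compact_uniform_nhds)
    fix t :: real assume t: "t \<in> {0..1}"
    then have "\<gamma> t \<in> S" using \<gamma>(2) by (auto simp: path_image_def)
    then obtain U where U: "open U" "\<gamma> t \<in> U" "\<forall>x\<in>S \<inter> U. \<forall>y\<in>S \<inter> U. F x ** c x y = F y"
      using F by blast
    let ?T = "{s \<in> {0..1}. \<gamma> s \<in> U}"
    have "?T = {0..1} \<inter> \<gamma> -` U" by auto
    then have "openin (top_of_set {0..1}) ?T"
      using \<gamma>(1) U(1) by (simp add: path_def continuous_openin_preimage_gen)
    moreover have "Q ?T"
      using U(3) \<gamma>(2) by (auto simp: Q_def path_image_def image_subset_iff)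
    moreover have "t \<in> ?T" using t U by simp
    ultimately show "\<exists>T. openin (top_of_set {0..1}) T \<and> t \<in> T \<and> Q T"
      by blast
  qed simp
  then obtain d where d: "0 < d" "\<And>t::real. t \<in> {0..1} \<Longrightarrow> \<exists>T. Q T \<and> {0..1} \<inter> ball t d \<subseteq> T"
    by blast
  show ?thesis
    unfolding transport_def
  proof (intro exI [of _ "\<lambda>t. F (\<gamma> t)"] exI [of _ d] conjI ballI impI)
    fix s t :: real assume st: "s \<in> {0..1}" "t \<in> {0..1}" "\<bar>s - t\<bar> < d"
    from d(2) [OF st(1)] obtain T where T: "Q T" "{0..1} \<inter> ball s d \<subseteq> T" by blast
    have "s \<in> {0..1} \<inter> ball s d" "t \<in> {0..1} \<inter> ball s d"
      using st d(1) by (auto simp: dist_real_def)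
    with T show "F (\<gamma> s) ** c (\<gamma> s) (\<gamma> t) = F (\<gamma> t)"
      unfolding Q_def by blast
  qed (use d in simp_all)
qed

lemma transport_side:
  assumes "path \<gamma>" "path_image \<gamma> \<subseteq> side k"
  shows "transport crossing \<gamma> (frame k (\<gamma> 0)) (frame k (\<gamma> 1))"
proof (rule transport_local_frame [OF assms])
  fix n assume n: "n \<in> side k"
  show "\<exists>U. open U \<and> n \<in> U \<and>
      (\<forall>x\<in>side k \<inter> U. \<forall>y\<in>side k \<inter> U. frame k x ** crossing x y = frame k y)"
  proof (cases "0 < (- 1) ^ k * snd (snd n)")
    case True
    have "nonneg m = even k" if "0 < (- 1) ^ k * snd (snd m)" for m
      using that by (cases "even k") (auto simp: nonneg_def)
    moreover have "open {m :: point3. 0 < (- 1) ^ k * snd (snd m)}"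
      by (intro open_Collect_less continuous_intros)
    ultimately show ?thesis
      using True by (intro exI [of _ "{m. 0 < (- 1) ^ k * snd (snd m)}"]) (simp add: frame_def crossing_def)
  next
    case False
    with n have "n \<in> quadrant_cylinder n"
      by (intro in_own_cylinder) (auto simp: side_def)
    moreover obtain q where "\<forall>m\<in>quadrant_cylinder n. quadrant_of m = q"
      using quadrant_of_cylinder [of n] by blast
    ultimately show ?thesis
      by (intro exI [of _ "quadrant_cylinder n"])
        (simp add: frame_def crossing_def shear_inv open_quadrant_cylinder)
  qed
qed

lemma simply_connected_side: "simply_connected (side k)"
proof (rule starlike_imp_simply_connected)
  define s :: real where "s = (- 1) ^ k"
  have ss: "s * s = 1"
    by (simp add: s_def flip: power_mult_distrib)
  have "closed_segment (0, 0, s) n \<subseteq> side k" if "n \<in> side k" for n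
  proof
    fix m assume "m \<in> closed_segment (0, 0, s) n"
    then obtain u where u: "0 \<le> u" "u \<le> 1" "m = (1 - u) *\<^sub>R (0, 0, s) + u *\<^sub>R n"
      by (auto simp: closed_segment_def)
    obtain x y z where n: "n = (x, y, z)" by (cases n)
    have m: "m = (u * x, u * y, (1 - u) * s + u * z)"
      using u(3) by (simp add: n)
    show "m \<in> side k"
    proof (cases "u = 0")
      case False
      then have "0 < u" using u by simp
      have "s * ((1 - u) * s + u * z) = (1 - u) * (s * s) + u * (s * z)"
        by (simp add: algebra_simps)
      also have "\<dots> = (1 - u) + u * (s * z)"
        by (simp add: ss)
      finally have "0 < s * ((1 - u) * s + u * z)" if "0 < s * z"
        using mult_pos_pos [OF \<open>0 < u\<close> that] u(2) by linarith
      then show ?thesis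
        using \<open>n \<in> side k\<close> \<open>0 < u\<close> by (auto simp: m n side_def s_def)
    qed (simp add: m side_def ss flip: s_def)
  qed
  moreover have "(0, 0, s) \<in> side k"
    by (simp add: side_def ss flip: s_def)
  ultimately show "starlike (side k)"
    unfolding starlike_def by blast
qed

section \<open>Normal forms of paths\<close>

lemma loop_join_eq_joinpaths: "loop_join p q = p +++ q"
  by (simp add: loop_join_def joinpaths_def)

lemma transport_joinpaths:
  assumes "local_cocycle (top_of_set S) c" "path p" "path q" "path_image p \<subseteq> S" "path_image q \<subseteq> S"
    and "pathfinish p = pathstart q" "transport c p L M" "transport c q M N"
  shows "transport c (p +++ q) L N"
proof -
  have "path (p +++ q)" "path_image (p +++ q) \<subseteq> S"
    using assms by (simp_all add: path_image_join)
  then have "pathin (top_of_set S) (loop_join p q)"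
    by (auto simp: pathin_def loop_join_eq_joinpaths path_def path_image_def continuous_map_in_subtopology)
  from transport_join [OF assms(1) this _ assms(7,8)] show ?thesis
    using assms(6) by (simp add: loop_join_eq_joinpaths pathfinish_def pathstart_def)
qed

lemma transport_homotopic_paths:
  assumes "local_cocycle (top_of_set S) c" "homotopic_paths S p q" "transport c p M N"
  shows "transport c q M N"
proof (rule transport_homotopic [OF assms(1) _ assms(3)])
  show "homotopic_with (\<lambda>r. r 0 = p 0 \<and> r 1 = p 1) (top_of_set {0..1}) (top_of_set S) p q"
    using assms(2) by (simp add: homotopic_paths_def pathstart_def pathfinish_def)
qed

text \<open>
  A base point in each quadrant. It belongs to both pieces of the cover.
\<close>

definition corner :: "quadrant \<Rightarrow> point3" where
  "corner q = (if fst q then 1 else - 1, if snd q then 1 else - 1, 0)"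

lemma corner_frames [simp]:
  "quadrant_of (corner q) = q" "frame k (corner q) = (if even k then mat 1 else shear_inv q)"
  by (cases q; auto simp: corner_def quadrant_of_def frame_def nonneg_def)+

lemma corner_in_side [simp]: "corner q \<in> side k"
  by (auto simp: corner_def side_def)

text \<open>
  A normal path starts above the plane and visits corners, changing between the two pieces at each of
  them. The list records the corners, the latest one first.
\<close>

fun normal_path :: "quadrant list \<Rightarrow> (real \<Rightarrow> point3) \<Rightarrow> bool" where
  "normal_path [] \<gamma> \<longleftrightarrow> path \<gamma> \<and> pathstart \<gamma> = (0, 0, 1) \<and> path_image \<gamma> \<subseteq> side 0"
| "normal_path (q # qs) \<gamma> \<longleftrightarrow>
     (\<exists>\<alpha> \<delta>. \<gamma> = \<alpha> +++ \<delta> \<and> normal_path qs \<alpha> \<and> pathfinish \<alpha> = corner q \<and>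
        path \<delta> \<and> pathstart \<delta> = corner q \<and> path_image \<delta> \<subseteq> side (Suc (length qs)))"

lemma normal_pathD:
  "normal_path qs \<gamma> \<Longrightarrow>
     path \<gamma> \<and> path_image \<gamma> \<subseteq> punctured \<and> pathstart \<gamma> = (0, 0, 1) \<and> pathfinish \<gamma> \<in> side (length qs)"
proof (induction qs arbitrary: \<gamma>)
  case Nil
  then show ?case
    using side_subset pathfinish_in_path_image by fastforce
next
  case (Cons q qs)
  then obtain \<alpha> \<delta> where *: "\<gamma> = \<alpha> +++ \<delta>" "normal_path qs \<alpha>" "pathfinish \<alpha> = corner q"
      "path \<delta>" "pathstart \<delta> = corner q" "path_image \<delta> \<subseteq> side (Suc (length qs))"
    by auto
  moreover have "pathfinish \<delta> \<in> side (Suc (length qs))"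
    using * pathfinish_in_path_image by blast
  moreover have "path_image \<delta> \<subseteq> punctured"
    using * side_subset by blast
  ultimately show ?case
    using Cons.IH [of \<alpha>] by (simp add: path_image_join)
qed

lemma transport_normal_path:
  "normal_path qs \<gamma> \<Longrightarrow>
     transport crossing \<gamma> (mat 1) (word qs ** frame (length qs) (pathfinish \<gamma>))"
proof (induction qs arbitrary: \<gamma>)
  case Nil
  then have "path \<gamma>" "path_image \<gamma> \<subseteq> side 0" "\<gamma> 0 = (0, 0, 1)"
    by (simp_all add: pathstart_def)
  with transport_side [of \<gamma> 0] show ?case
    by (simp add: pathfinish_def frame_def nonneg_def)
next
  case (Cons q qs)
  then obtain \<alpha> \<delta> where \<gamma>: "\<gamma> = \<alpha> +++ \<delta>" and \<alpha>: "normal_path qs \<alpha>" "pathfinish \<alpha> = corner q"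
    and \<delta>: "path \<delta>" "pathstart \<delta> = corner q" "path_image \<delta> \<subseteq> side (Suc (length qs))"
    by auto
  let ?k = "length qs"
  have t\<alpha>: "transport crossing \<alpha> (mat 1) (word qs ** frame ?k (corner q))"
    using Cons.IH [OF \<alpha>(1)] \<alpha>(2) by simp
  have "transport crossing \<delta> (frame (Suc ?k) (corner q)) (frame (Suc ?k) (pathfinish \<delta>))"
    using transport_side [OF \<delta>(1,3)] \<delta>(2) by (simp add: pathfinish_def pathstart_def)
  then have t\<delta>: "transport crossing \<delta> (word (q # qs) ** frame (Suc ?k) (corner q))
      (word (q # qs) ** frame (Suc ?k) (pathfinish \<delta>))"
    by (rule transport_mult_left)
  have eq: "word (q # qs) ** frame (Suc ?k) (corner q) = word qs ** frame ?k (corner q)"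
    by (simp add: shear_inv flip: matrix_mul_assoc)
  have \<delta>p: "path_image \<delta> \<subseteq> punctured"
    using \<delta>(3) side_subset by blast
  have "transport crossing \<gamma> (mat 1) (word (q # qs) ** frame (Suc ?k) (pathfinish \<delta>))"
    unfolding \<gamma>
    by (rule transport_joinpaths [OF local_cocycle_crossing _ _ _ _ _ t\<alpha> t\<delta> [unfolded eq]])
      (use \<alpha> \<delta> \<delta>p normal_pathD [OF \<alpha>(1)] in auto)
  then show ?case
    by (simp add: \<gamma>)
qed

lemma normal_path_extend_same_side:
  assumes "normal_path qs \<gamma>" "path \<delta>" "pathfinish \<gamma> = pathstart \<delta>" "path_image \<delta> \<subseteq> side (length qs)"
  obtains \<gamma>' where "normal_path qs \<gamma>'" "homotopic_paths punctured (\<gamma> +++ \<delta>) \<gamma>'"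
proof (cases qs)
  case Nil
  have "normal_path qs (\<gamma> +++ \<delta>)"
    using assms by (simp add: Nil path_image_join)
  then show thesis
    using that normal_pathD by (metis homotopic_paths_refl)
next
  case (Cons q qs')
  then obtain \<alpha> \<epsilon> where \<gamma>: "\<gamma> = \<alpha> +++ \<epsilon>" and \<alpha>: "normal_path qs' \<alpha>" "pathfinish \<alpha> = corner q"
    and \<epsilon>: "path \<epsilon>" "pathstart \<epsilon> = corner q" "path_image \<epsilon> \<subseteq> side (Suc (length qs'))"
    using assms(1) by auto
  have fin: "pathfinish \<epsilon> = pathstart \<delta>"
    using assms(3) by (simp add: \<gamma>)
  have "path (\<epsilon> +++ \<delta>)" "pathstart (\<epsilon> +++ \<delta>) = corner q" "path_image (\<epsilon> +++ \<delta>) \<subseteq> side (Suc (length qs'))"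
    using \<epsilon> fin assms(2,4) Cons by (simp_all add: path_image_join)
  then have "normal_path qs (\<alpha> +++ (\<epsilon> +++ \<delta>))"
    unfolding Cons normal_path.simps
    using \<alpha> by (intro exI [of _ \<alpha>] exI [of _ "\<epsilon> +++ \<delta>"]) simp
  moreover have "path_image \<epsilon> \<subseteq> punctured" "path_image \<delta> \<subseteq> punctured"
    using \<epsilon>(3) assms(4) side_subset by blast+
  then have "homotopic_paths punctured (\<alpha> +++ (\<epsilon> +++ \<delta>)) ((\<alpha> +++ \<epsilon>) +++ \<delta>)"
    by (intro homotopic_paths_assoc)
      (use \<alpha> \<epsilon> fin assms(2) normal_pathD [OF \<alpha>(1)] in auto)
  ultimately show thesis
    using that unfolding \<gamma> by (metis homotopic_paths_sym)
qed

lemma segment_to_corner: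
  assumes "n \<in> side k" "n \<in> side (Suc k)"
  shows "path_image (linepath n (corner (quadrant_of n))) \<subseteq> side j"
proof -
  obtain x y z where n: "n = (x, y, z)" by (cases n)
  have xy: "x \<noteq> 0" "y \<noteq> 0"
    using assms by (cases "even k"; auto simp: side_def n)+
  have nz: "(1 - u) * t + u * (if 0 < t then 1 else - 1) \<noteq> 0"
    if "0 \<le> u" "u \<le> 1" "t \<noteq> 0" for u t :: real
  proof (cases "u = 1")
    case False
    then have "0 < 1 - u" using that by simp
    then have "0 < (1 - u) * t" if "0 < t"
      using that by simp
    moreover have "(1 - u) * t < 0" if "\<not> 0 < t"
      using that \<open>t \<noteq> 0\<close> \<open>0 < 1 - u\<close> by (intro mult_pos_neg) auto
    ultimately show ?thesis
      using \<open>0 \<le> u\<close> by (cases "0 < t") auto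
  qed simp
  show ?thesis
  proof
    fix m assume "m \<in> path_image (linepath n (corner (quadrant_of n)))"
    then obtain u where u: "0 \<le> u" "u \<le> 1" "m = (1 - u) *\<^sub>R n + u *\<^sub>R corner (quadrant_of n)"
      by (auto simp: path_image_linepath closed_segment_def)
    have "fst m = (1 - u) * x + u * (if 0 < x then 1 else - 1)"
        "fst (snd m) = (1 - u) * y + u * (if 0 < y then 1 else - 1)"
      by (auto simp: u(3) n corner_def quadrant_of_def)
    then have "fst m \<noteq> 0" "fst (snd m) \<noteq> 0"
      using nz [OF u(1,2)] xy by simp_all
    then show "m \<in> side j"
      by (cases m) (auto simp: side_def)
  qed
qed

text \<open>
  If the new piece of path lies on the other side, its starting point lies in some quadrant and can be
  moved to the corner there. When this corner repeats the previous one, the path between the two visits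
  is a loop in a simply connected piece; it can be dropped, which shortens the list by one.
\<close>

lemma normal_path_extend:
  assumes \<gamma>: "normal_path qs \<gamma>" "distinct_adj qs"
    and \<delta>: "path \<delta>" "pathfinish \<gamma> = pathstart \<delta>" "path_image \<delta> \<subseteq> side k"
  obtains qs' \<gamma>' where "normal_path qs' \<gamma>'" "distinct_adj qs'" "homotopic_paths punctured (\<gamma> +++ \<delta>) \<gamma>'"
proof (cases "side k = side (length qs)")
  case True
  with \<delta> have "path_image \<delta> \<subseteq> side (length qs)" by simp
  from normal_path_extend_same_side [OF \<gamma>(1) \<delta>(1,2) this] show thesis
    using that \<gamma>(2) by blast
next
  case False
  then have side: "side k = side (Suc (length qs))"
    by (cases "even k"; cases "even (length qs)") (simp_all add: side_def)
  define n where "n = pathfinish \<gamma>"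
  define q where "q = quadrant_of n"
  define \<sigma> where "\<sigma> = linepath n (corner q)"
  have n_side: "n \<in> side (length qs)" "n \<in> side (Suc (length qs))"
    using normal_pathD [OF \<gamma>(1)] \<delta> side pathstart_in_path_image [of \<delta>] by (auto simp: n_def)
  have \<sigma>: "path \<sigma>" "pathstart \<sigma> = n" "pathfinish \<sigma> = corner q" "path_image \<sigma> \<subseteq> side j" for j
    using segment_to_corner [OF n_side] by (simp_all add: \<sigma>_def q_def)
  have \<gamma>p: "path \<gamma>" "path_image \<gamma> \<subseteq> punctured" "pathfinish \<gamma> = n"
    using normal_pathD [OF \<gamma>(1)] by (simp_all add: n_def)
  have \<delta>p: "path_image \<delta> \<subseteq> punctured" "pathstart \<delta> = n"
    using \<delta> side_subset by (auto simp: n_def)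
  have \<sigma>p: "path_image \<sigma> \<subseteq> punctured"
    using \<sigma>(4) side_subset by blast
  obtain \<gamma>1 where \<gamma>1: "normal_path qs \<gamma>1" "homotopic_paths punctured (\<gamma> +++ \<sigma>) \<gamma>1"
    by (rule normal_path_extend_same_side [OF \<gamma>(1) \<sigma>(1) _ \<sigma>(4)]) (use \<gamma>p \<sigma> in auto)
  have \<gamma>1p: "path \<gamma>1" "path_image \<gamma>1 \<subseteq> punctured" "pathfinish \<gamma>1 = corner q"
    using normal_pathD [OF \<gamma>1(1)] homotopic_paths_imp_pathfinish [OF \<gamma>1(2)] \<sigma>(3) by simp_all
  define \<delta>' where "\<delta>' = reversepath \<sigma> +++ \<delta>"
  have \<delta>': "path \<delta>'" "pathstart \<delta>' = corner q" "path_image \<delta>' \<subseteq> side (Suc (length qs))"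
    using \<sigma> \<delta> \<delta>p side by (simp_all add: \<delta>'_def path_image_join)
  have \<delta>'p: "path_image \<delta>' \<subseteq> punctured"
    using \<delta>'(3) side_subset by blast
  \<comment> \<open>Insert the detour to the corner and back.\<close>
  have main: "homotopic_paths punctured (\<gamma> +++ \<delta>) (\<gamma>1 +++ \<delta>')"
  proof -
    have "homotopic_paths punctured (\<gamma>1 +++ \<delta>') ((\<gamma> +++ \<sigma>) +++ \<delta>')"
      by (rule homotopic_paths_join) (use \<gamma>1 \<gamma>1p \<delta>' \<delta>'p homotopic_paths_sym in auto)
    also have "homotopic_paths punctured ((\<gamma> +++ \<sigma>) +++ \<delta>') (\<gamma> +++ (\<sigma> +++ \<delta>'))"
      by (rule homotopic_paths_sym, rule homotopic_paths_assoc) (use \<gamma>p \<sigma> \<sigma>p \<delta>' \<delta>'p in auto)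
    also have "homotopic_paths punctured (\<gamma> +++ (\<sigma> +++ \<delta>')) (\<gamma> +++ \<delta>)"
    proof (rule homotopic_paths_join)
      have "homotopic_paths punctured (\<sigma> +++ \<delta>') ((\<sigma> +++ reversepath \<sigma>) +++ \<delta>)"
        unfolding \<delta>'_def by (rule homotopic_paths_assoc) (use \<sigma> \<sigma>p \<delta> \<delta>p in auto)
      also have "homotopic_paths punctured ((\<sigma> +++ reversepath \<sigma>) +++ \<delta>) (linepath n n +++ \<delta>)"
        by (rule homotopic_paths_join) (use homotopic_paths_rinv [OF \<sigma>(1) \<sigma>p] \<sigma> \<delta> \<delta>p in auto)
      also have "homotopic_paths punctured (linepath n n +++ \<delta>) \<delta>"
        using homotopic_paths_lid' \<delta> \<delta>p by blast
      finally show "homotopic_paths punctured (\<sigma> +++ \<delta>') \<delta>" .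
    qed (use \<gamma>p \<sigma> in auto)
    finally show ?thesis
      by (rule homotopic_paths_sym)
  qed
  show thesis
  proof (cases "qs = [] \<or> hd qs \<noteq> q")
    case True
    then have "distinct_adj (q # qs)"
      using \<gamma>(2) by (cases qs) auto
    moreover have "normal_path (q # qs) (\<gamma>1 +++ \<delta>')"
      using \<gamma>1(1) \<gamma>1p \<delta>' by auto
    ultimately show thesis
      using that main by blast
  next
    case False
    then obtain qs0 where qs: "qs = q # qs0"
      by (cases qs) auto
    obtain \<alpha> \<epsilon> where \<gamma>1_eq: "\<gamma>1 = \<alpha> +++ \<epsilon>" and \<alpha>: "normal_path qs0 \<alpha>" "pathfinish \<alpha> = corner q"
      and \<epsilon>: "path \<epsilon>" "pathstart \<epsilon> = corner q" "path_image \<epsilon> \<subseteq> side (Suc (length qs0))"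
      using \<gamma>1(1) qs by auto
    have \<alpha>p: "path \<alpha>" "path_image \<alpha> \<subseteq> punctured"
      using normal_pathD [OF \<alpha>(1)] by simp_all
    have \<epsilon>_fin: "pathfinish \<epsilon> = corner q"
      using \<gamma>1p(3) by (simp add: \<gamma>1_eq)
    have "homotopic_paths (side (Suc (length qs0))) \<epsilon> (linepath (corner q) (corner q))"
      using simply_connected_side [of "Suc (length qs0)"] \<epsilon> \<epsilon>_fin
      unfolding simply_connected_eq_contractible_path by metis
    then have \<epsilon>_null: "homotopic_paths punctured \<epsilon> (linepath (corner q) (corner q))"
      using side_subset homotopic_paths_subset by blast
    have "homotopic_paths punctured (\<alpha> +++ \<epsilon>) (\<alpha> +++ linepath (corner q) (corner q))"
      by (rule homotopic_paths_join) (use \<alpha> \<alpha>p \<epsilon> \<epsilon>_null in auto)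
    also have "homotopic_paths punctured (\<alpha> +++ linepath (corner q) (corner q)) \<alpha>"
      using homotopic_paths_rid' \<alpha> \<alpha>p by metis
    finally have "homotopic_paths punctured \<gamma>1 \<alpha>"
      unfolding \<gamma>1_eq .
    then have \<alpha>\<delta>: "homotopic_paths punctured (\<gamma>1 +++ \<delta>') (\<alpha> +++ \<delta>')"
      by (rule homotopic_paths_join) (use \<gamma>1p \<delta>' \<delta>'p in auto)
    have "path_image \<delta>' \<subseteq> side (length qs0)"
      using \<delta>'(3) by (simp add: qs)
    then obtain \<gamma>' where "normal_path qs0 \<gamma>'" "homotopic_paths punctured (\<alpha> +++ \<delta>') \<gamma>'"
      using normal_path_extend_same_side [OF \<alpha>(1) \<delta>'(1)] \<alpha>(2) \<delta>'(2) by metis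
    moreover have "distinct_adj qs0"
      using \<gamma>(2) by (cases qs0) (auto simp: qs)
    ultimately show thesis
      using that main \<alpha>\<delta> homotopic_paths_trans by metis
  qed
qed

text \<open>
  Cut the path into pieces each of which stays in the upper or in the lower part, and add them one at a
  time.
\<close>

lemma normal_path_exists:
  assumes \<gamma>: "path \<gamma>" "path_image \<gamma> \<subseteq> punctured" "pathstart \<gamma> = (0, 0, 1)"
  obtains qs \<gamma>' where "normal_path qs \<gamma>'" "distinct_adj qs" "homotopic_paths punctured \<gamma> \<gamma>'"
proof -
  define Q where "Q T \<longleftrightarrow> (\<exists>k. \<gamma> ` T \<subseteq> side k)" for T
  have "\<exists>d>0. \<forall>t\<in>{0..1::real}. \<exists>T. Q T \<and> {0..1} \<inter> ball t d \<subseteq> T"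
  proof (rule compact_uniform_nhds)
    fix t :: real assume t: "t \<in> {0..1}"
    then have "\<gamma> t \<in> punctured" using \<gamma>(2) by (auto simp: path_image_def)
    then have "\<gamma> t \<in> side 0 \<or> \<gamma> t \<in> side 1"
      by (simp add: punctured_eq)
    then obtain k where k: "\<gamma> t \<in> side k" by blast
    have "openin (top_of_set {0..1}) ({0..1} \<inter> \<gamma> -` side k)"
      using \<gamma>(1) open_side by (simp add: path_def continuous_openin_preimage_gen)
    moreover have "Q ({0..1} \<inter> \<gamma> -` side k)"
      unfolding Q_def by blast
    ultimately show "\<exists>T. openin (top_of_set {0..1}) T \<and> t \<in> T \<and> Q T"
      using t k by blast
  qed simp
  then obtain d where d: "0 < d" "\<And>t::real. t \<in> {0..1} \<Longrightarrow> \<exists>T. Q T \<and> {0..1} \<inter> ball t d \<subseteq> T"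
    by blast
  obtain n :: nat where n0: "0 < real n" and nd: "1 / real n < d"
    using fine_partition d(1) by blast
  have "\<exists>qs \<gamma>'. normal_path qs \<gamma>' \<and> distinct_adj qs \<and>
      homotopic_paths punctured (subpath 0 (real k / real n) \<gamma>) \<gamma>'" if "k \<le> n" for k
    using that
  proof (induction k)
    case 0
    have "subpath 0 0 \<gamma> = linepath (0, 0, 1) (0, 0, 1)"
      using \<gamma>(3) by (simp add: subpath_refl pathstart_def)
    moreover have "normal_path [] (linepath (0, 0, 1) (0, 0, 1))"
      by (simp add: side_def)
    ultimately have "normal_path [] (subpath 0 0 \<gamma>)" by simp
    then show ?case
      using normal_pathD by (intro exI [of _ "[]"] exI [of _ "subpath 0 0 \<gamma>"]) fastforce
  next
    case (Suc k)
    define a b where "a = real k / real n" and "b = real (Suc k) / real n"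
    have ab: "0 \<le> a" "a \<le> b" "b \<le> 1" "b = a + 1 / real n"
      using Suc.prems n0 by (auto simp: a_def b_def field_simps)
    obtain qs \<gamma>' where IH: "normal_path qs \<gamma>'" "distinct_adj qs" "homotopic_paths punctured (subpath 0 a \<gamma>) \<gamma>'"
      using Suc unfolding a_def by auto
    have "{a..b} \<subseteq> {0..1} \<inter> ball a d"
      using nd ab by (auto simp: dist_real_def)
    moreover have a01: "a \<in> {0..1}" "b \<in> {0..1}"
      using ab(1-3) by auto
    ultimately obtain T where "Q T" "{a..b} \<subseteq> T"
      using d(2) [of a] by blast
    then obtain j where j: "\<gamma> ` {a..b} \<subseteq> side j"
      unfolding Q_def by blast
    define \<delta> where "\<delta> = subpath a b \<gamma>"
    have \<delta>: "path \<delta>" "path_image \<delta> \<subseteq> side j" "pathstart \<delta> = \<gamma> a"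
      using j \<gamma>(1) a01 ab(2) by (auto simp: \<delta>_def path_image_subpath closed_segment_eq_real_ivl)
    have "pathfinish \<gamma>' = pathstart \<delta>"
      using homotopic_paths_imp_pathfinish [OF IH(3)] \<delta>(3) by simp
    from normal_path_extend [OF IH(1,2) \<delta>(1) this \<delta>(2)]
    obtain qs' \<gamma>'' where new: "normal_path qs' \<gamma>''" "distinct_adj qs'"
        "homotopic_paths punctured (\<gamma>' +++ \<delta>) \<gamma>''" .
    have "homotopic_paths punctured (subpath 0 b \<gamma>) (subpath 0 a \<gamma> +++ \<delta>)"
      unfolding \<delta>_def
      by (rule homotopic_paths_sym, rule homotopic_join_subpaths) (use \<gamma> a01 in auto)
    also have "homotopic_paths punctured (subpath 0 a \<gamma> +++ \<delta>) (\<gamma>' +++ \<delta>)"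
      by (rule homotopic_paths_join) (use IH \<delta> side_subset in auto)
    also note new(3)
    finally show ?case
      using new(1,2) unfolding b_def by blast
  qed
  from this [of n] n0 show thesis
    using that by auto
qed

lemma path_connected_punctured: "path_connected punctured"
proof -
  have "corner (True, True) \<in> side 0 \<inter> side 1" by simp
  then have "side 0 \<inter> side 1 \<noteq> {}" by blast
  then show ?thesis
    unfolding punctured_eq
    by (intro path_connected_Un simply_connected_imp_path_connected simply_connected_side)
qed

text \<open>
  After conjugation the loop starts at \<open>(0, 0, 1)\<close>. This point is not in the lower piece, so the normal
  form of the loop has even length and its transport is the word of its list. By ping-pong a central word
  is empty, and a normal path with empty list stays in the upper piece.
\<close>

lemma crossing_transport_central:
  assumes g: "path g" "path_image g \<subseteq> punctured" "pathfinish g = pathstart g"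
    and M: "transport crossing g (mat 1) M" "M = mat 1 \<or> M = - mat 1"
  shows "M = mat 1" "homotopic_paths punctured g (linepath (pathstart g) (pathstart g))"
proof -
  let ?o = "(0, 0, 1) :: point3"
  have "?o \<in> punctured" "pathstart g \<in> punctured"
    using g(2) pathstart_in_path_image by (auto simp: punctured_def)
  then obtain r where r: "path r" "path_image r \<subseteq> punctured" "pathstart r = ?o" "pathfinish r = pathstart g"
    using path_connected_punctured unfolding path_connected_def by metis
  define \<gamma> where "\<gamma> = r +++ g +++ reversepath r"
  have \<gamma>: "path \<gamma>" "path_image \<gamma> \<subseteq> punctured" "pathstart \<gamma> = ?o" "pathfinish \<gamma> = ?o"
    using r g by (simp_all add: \<gamma>_def path_image_join)
  have "pathin (top_of_set punctured) r"
    using r by (auto simp: pathin_def path_def path_image_def continuous_map_in_subtopology)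
  then obtain R where R: "transport crossing r (mat 1) R"
    using transport_exists [OF local_cocycle_crossing] by metis
  have MR: "R ** M = M ** R"
    using M(2) by (auto simp: vec_eq_iff forall_2 sum_2 matrix_matrix_mult_def mat_def)
  have "transport crossing (reversepath r) R (mat 1)"
    using transport_reverse [OF R] by (simp add: reversepath_def)
  from transport_mult_left [OF this, of M] have r': "transport crossing (reversepath r) (M ** R) M"
    by simp
  have g': "transport crossing g R (M ** R)"
    using transport_mult_left [OF M(1), of R] MR by simp
  have "transport crossing (g +++ reversepath r) R M"
    by (rule transport_joinpaths [OF local_cocycle_crossing _ _ _ _ _ g' r']) (use g r in auto)
  then have t\<gamma>: "transport crossing \<gamma> (mat 1) M"
    unfolding \<gamma>_def
    by (intro transport_joinpaths [OF local_cocycle_crossing _ _ _ _ _ R])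
      (use g r in \<open>auto simp: path_image_join\<close>)
  obtain qs \<gamma>' where n: "normal_path qs \<gamma>'" "distinct_adj qs" "homotopic_paths punctured \<gamma> \<gamma>'"
    using normal_path_exists [OF \<gamma>(1-3)] .
  have fin: "pathfinish \<gamma>' = ?o" "pathstart \<gamma>' = ?o"
    using homotopic_paths_imp_pathfinish [OF n(3)] homotopic_paths_imp_pathstart [OF n(3)] \<gamma> by simp_all
  then have "?o \<in> side (length qs)"
    using normal_pathD [OF n(1)] by simp
  then have ev: "even (length qs)"
    by (cases "even (length qs)") (auto simp: side_def)
  have "transport crossing \<gamma>' (mat 1) (word qs)"
    using transport_normal_path [OF n(1)] fin ev by (simp add: frame_def nonneg_def)
  moreover have "transport crossing \<gamma>' (mat 1) M"
    using transport_homotopic_paths [OF local_cocycle_crossing n(3) t\<gamma>] .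
  ultimately have "word qs = M"
    by (rule transport_unique)
  then have "qs = []"
    using word_not_central [OF n(2) ev] M(2) by auto
  then show "M = mat 1"
    using \<open>word qs = M\<close> by simp
  have "path \<gamma>'" "path_image \<gamma>' \<subseteq> side 0"
    using n(1) \<open>qs = []\<close> by simp_all
  then have "homotopic_paths (side 0) \<gamma>' (linepath ?o ?o)"
    using simply_connected_side [of 0] fin
    unfolding simply_connected_eq_contractible_path by metis
  then have "homotopic_paths punctured \<gamma>' (linepath ?o ?o)"
    using side_subset homotopic_paths_subset by blast
  with n(3) have "homotopic_paths punctured \<gamma> (linepath ?o ?o)"
    by (rule homotopic_paths_trans)
  then have "homotopic_loops punctured \<gamma> (linepath ?o ?o)"
    by (rule homotopic_paths_imp_homotopic_loops) (use \<gamma> in auto)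
  moreover have "homotopic_loops punctured \<gamma> g"
    unfolding \<gamma>_def by (rule homotopic_loops_conjugate) (use r g in auto)
  ultimately have "homotopic_loops punctured g (linepath ?o ?o)"
    by (meson homotopic_loops_sym homotopic_loops_trans)
  then show "homotopic_paths punctured g (linepath (pathstart g) (pathstart g))"
    by (rule homotopic_loops_imp_homotopic_paths_null)
qed

section \<open>Spinors of orthonormal pairs\<close>

text \<open>
  The real and imaginary parts of the isotropic vector
  \<open>(z\<^sup>2 - w\<^sup>2, \<i> * (z\<^sup>2 + w\<^sup>2), - 2 * z * w)\<close> of complex three-space. They are orthogonal and have equal length.
  This is the double cover of the rotation group by the three-sphere, written with quadratic forms.
\<close>

definition spin :: "complex \<times> complex \<Rightarrow> (real^3) \<times> (real^3)" where
  "spin q = (let z = fst q; w = snd q in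
     (vector [Re (z\<^sup>2 - w\<^sup>2), Re (\<i> * (z\<^sup>2 + w\<^sup>2)), Re (- 2 * (z * w))],
      vector [Im (z\<^sup>2 - w\<^sup>2), Im (\<i> * (z\<^sup>2 + w\<^sup>2)), Im (- 2 * (z * w))]))"

text \<open>
  An orthonormal pair is packed into the complex vector \<open>fst x + \<i> * snd x\<close>, which is isotropic. The next
  three functions recover from it the squares and the product of the two components of a spinor.
\<close>

definition null_coord :: "(real^3) \<times> (real^3) \<Rightarrow> 3 \<Rightarrow> complex" where
  "null_coord x k = Complex (fst x $ k) (snd x $ k)"

definition first_square :: "(real^3) \<times> (real^3) \<Rightarrow> complex" where
  "first_square x = (null_coord x 1 - \<i> * null_coord x 2) / 2"

definition second_square :: "(real^3) \<times> (real^3) \<Rightarrow> complex" where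
  "second_square x = (- null_coord x 1 - \<i> * null_coord x 2) / 2"

definition mixed_product :: "(real^3) \<times> (real^3) \<Rightarrow> complex" where
  "mixed_product x = - null_coord x 3 / 2"

definition orthonormal_pairs :: "((real^3) \<times> (real^3)) set" where
  "orthonormal_pairs = {x. norm (fst x) = 1 \<and> norm (snd x) = 1 \<and> fst x \<bullet> snd x = 0}"

lemma spin_eq_iff:
  "spin q = x \<longleftrightarrow> (fst q)\<^sup>2 = first_square x \<and> (snd q)\<^sup>2 = second_square x \<and> fst q * snd q = mixed_product x"
proof -
  have "spin q = x \<longleftrightarrow> (fst q)\<^sup>2 - (snd q)\<^sup>2 = null_coord x 1 \<and>
      \<i> * ((fst q)\<^sup>2 + (snd q)\<^sup>2) = null_coord x 2 \<and> - 2 * (fst q * snd q) = null_coord x 3"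
    unfolding spin_def Let_def null_coord_def
    by (cases x) (auto simp: vec_eq_iff forall_3 complex_eq_iff)
  moreover have "A - B = X \<and> \<i> * (A + B) = Y \<longleftrightarrow> A = (X - \<i> * Y) / 2 \<and> B = (- X - \<i> * Y) / 2"
    for A B X Y :: complex
    by (auto simp: complex_eq_iff)
  moreover have "- 2 * C = X \<longleftrightarrow> C = - X / 2" for C X :: complex
    by (auto simp: complex_eq_iff)
  ultimately show ?thesis
    unfolding first_square_def second_square_def mixed_product_def by blast
qed

lemma squares_eq:
  assumes "x \<in> orthonormal_pairs"
  shows "first_square x * second_square x = (mixed_product x)\<^sup>2"
proof -
  have "fst x \<bullet> fst x = 1" "snd x \<bullet> snd x = 1" "fst x \<bullet> snd x = 0"
    using assms by (simp_all add: orthonormal_pairs_def norm_eq_1)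
  then have "(null_coord x 1)\<^sup>2 + (null_coord x 2)\<^sup>2 + (null_coord x 3)\<^sup>2 = 0"
    by (simp add: null_coord_def complex_eq_iff inner_vec_def sum_3 power2_eq_square algebra_simps)
  then have "null_coord x 3 * null_coord x 3 = - (null_coord x 1 * null_coord x 1) - null_coord x 2 * null_coord x 2"
    by (simp add: power2_eq_square algebra_simps eq_neg_iff_add_eq_0)
  then have "(mixed_product x)\<^sup>2 =
      (- (null_coord x 1 * null_coord x 1) - null_coord x 2 * null_coord x 2) / 4"
    by (simp add: mixed_product_def power2_eq_square)
  also have "\<dots> = first_square x * second_square x"
    by (simp add: first_square_def second_square_def complex_eq_iff field_simps)
  finally show ?thesis ..
qed

lemma spin_nonzero_square:
  assumes "x \<in> orthonormal_pairs"
  shows "first_square x \<noteq> 0 \<or> second_square x \<noteq> 0"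
proof (rule ccontr)
  assume "\<not> ?thesis"
  then have sq: "first_square x = 0" "second_square x = 0" by simp_all
  then have "null_coord x 3 = 0"
    using squares_eq [OF assms] by (simp add: mixed_product_def)
  moreover have "null_coord x 1 = 0" "null_coord x 2 = 0"
    using sq by (auto simp: first_square_def second_square_def complex_eq_iff)
  ultimately have "null_coord x 1 = 0" "null_coord x 2 = 0" "null_coord x 3 = 0" by simp_all
  then have "fst x = 0"
    by (simp add: null_coord_def vec_eq_iff forall_3 complex_eq_iff)
  then show False
    using assms by (simp add: orthonormal_pairs_def)
qed

lemma spin_uminus: "spin (- q) = spin q"
  by (simp add: spin_def Let_def)

lemma spin_eq_spin: "spin q = spin q' \<longleftrightarrow> q = q' \<or> q = - q'"
proof
  assume "spin q = spin q'"
  then have eq: "(fst q)\<^sup>2 = (fst q')\<^sup>2" "(snd q)\<^sup>2 = (snd q')\<^sup>2" "fst q * snd q = fst q' * snd q'"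
    using spin_eq_iff [of q "spin q'"] spin_eq_iff [of q' "spin q'"] by simp_all
  then have "fst q = fst q' \<or> fst q = - fst q'" "snd q = snd q' \<or> snd q = - snd q'"
    by (simp_all add: power2_eq_iff)
  then show "q = q' \<or> q = - q'"
    using eq(3) by (auto simp: prod_eq_iff)
qed (auto simp: spin_uminus)

lemma spin_inner:
  "fst (spin q) \<bullet> snd (spin q) = 0"
  "fst (spin q) \<bullet> fst (spin q) = ((norm q)\<^sup>2)\<^sup>2"
  "snd (spin q) \<bullet> snd (spin q) = ((norm q)\<^sup>2)\<^sup>2"
proof -
  obtain a b c d where q: "q = (Complex a b, Complex c d)"
    by (metis complex.exhaust surj_pair)
  have n: "(norm q)\<^sup>2 = a\<^sup>2 + b\<^sup>2 + c\<^sup>2 + d\<^sup>2"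
    by (simp add: q norm_Pair cmod_def)
  show "fst (spin q) \<bullet> snd (spin q) = 0"
    by (simp add: q spin_def inner_vec_def sum_3 power2_eq_square algebra_simps)
  show "fst (spin q) \<bullet> fst (spin q) = ((norm q)\<^sup>2)\<^sup>2" "snd (spin q) \<bullet> snd (spin q) = ((norm q)\<^sup>2)\<^sup>2"
    unfolding n by (simp_all add: q spin_def inner_vec_def sum_3 power2_eq_square algebra_simps)
qed

lemma norm_spinor: "spin q \<in> orthonormal_pairs \<Longrightarrow> norm q = 1"
proof -
  assume "spin q \<in> orthonormal_pairs"
  then have "((norm q)\<^sup>2)\<^sup>2 = 1"
    using spin_inner(2) [of q] by (simp add: orthonormal_pairs_def norm_eq_1)
  then have "(norm q)\<^sup>2 = 1 \<or> (norm q)\<^sup>2 = - 1"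
    by (simp only: power2_eq_1_iff)
  then have "(norm q)\<^sup>2 = 1"
    using zero_le_power2 [of "norm q"] by linarith
  then have "norm q = 1 \<or> norm q = - 1"
    by (simp only: power2_eq_1_iff)
  then show "norm q = 1"
    using norm_ge_zero [of q] by linarith
qed

lemma continuous_spin: "continuous_on S spin"
proof -
  define X :: "complex \<times> complex \<Rightarrow> 3 \<Rightarrow> complex" where
    "X q k = (if k = 1 then (fst q)\<^sup>2 - (snd q)\<^sup>2
      else if k = 2 then \<i> * ((fst q)\<^sup>2 + (snd q)\<^sup>2) else - 2 * (fst q * snd q))" for q k
  have X: "continuous_on S (\<lambda>q. X q k)" for k
    unfolding X_def by (cases "k = 1"; cases "k = 2") (auto intro!: continuous_intros)
  have "continuous_on S (\<lambda>q. (\<chi> k. Re (X q k), \<chi> k. Im (X q k)))"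
    by (intro continuous_on_Pair continuous_on_vec_lambda continuous_on_Re continuous_on_Im X)
  also have "(\<lambda>q. (\<chi> k. Re (X q k), \<chi> k. Im (X q k))) = spin"
    by (simp add: fun_eq_iff spin_def Let_def vec_eq_iff forall_3 X_def)
  finally show ?thesis .
qed

lemma continuous_null_coord: "continuous_on S (\<lambda>x. null_coord x k)"
  unfolding null_coord_def Complex_eq by (intro continuous_intros)

lemma continuous_squares:
  "continuous_on S first_square" "continuous_on S second_square" "continuous_on S mixed_product"
  unfolding first_square_def second_square_def mixed_product_def
  by (intro continuous_intros continuous_null_coord; simp)+

lemma local_square_root:
  fixes \<zeta> \<eta> :: "'a::topological_space \<Rightarrow> complex"
  assumes "continuous_on S \<zeta>" "continuous_on S \<eta>" "x0 \<in> S" "\<zeta> x0 \<noteq> 0"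
  obtains V r where "openin (top_of_set S) V" "x0 \<in> V" "continuous_on V r"
    "continuous_on V (\<lambda>x. \<eta> x / r x)" "\<forall>x\<in>V. r x \<noteq> 0 \<and> (r x)\<^sup>2 = \<zeta> x"
proof
  let ?V = "{x \<in> S. 0 < Re (\<zeta> x / \<zeta> x0)}"
  let ?r = "\<lambda>x. csqrt (\<zeta> x0) * csqrt (\<zeta> x / \<zeta> x0)"
  have c: "continuous_on S (\<lambda>x. \<zeta> x / \<zeta> x0)"
    using assms by (intro continuous_intros) auto
  then have "openin (top_of_set S) (S \<inter> (\<lambda>x. \<zeta> x / \<zeta> x0) -` {z. 0 < Re z})"
    by (intro continuous_openin_preimage_gen) (simp_all add: open_halfspace_Re_gt)
  also have "S \<inter> (\<lambda>x. \<zeta> x / \<zeta> x0) -` {z. 0 < Re z} = ?V"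
    by auto
  finally show "openin (top_of_set S) ?V" .
  show "x0 \<in> ?V" using assms by simp
  have "continuous_on ?V (\<lambda>x. \<zeta> x / \<zeta> x0)"
    using c by (rule continuous_on_subset) auto
  then show cr: "continuous_on ?V ?r"
    by (intro continuous_on_mult continuous_on_const continuous_on_compose2 [OF continuous_on_csqrt])
      (auto simp: complex_nonpos_Reals_iff)
  show r: "\<forall>x\<in>?V. ?r x \<noteq> 0 \<and> (?r x)\<^sup>2 = \<zeta> x"
    using assms(4) by (auto simp: power_mult_distrib)
  have "continuous_on ?V \<eta>"
    using assms(2) by (rule continuous_on_subset) auto
  then show "continuous_on ?V (\<lambda>x. \<eta> x / ?r x)"
    using cr r by (intro continuous_on_divide) auto
qed

text \<open>
  One of the two squares is non-zero. A local square root of it gives one component of the spinor, and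
  the other component follows by dividing the mixed product.
\<close>

lemma spin_local_section:
  assumes "x0 \<in> orthonormal_pairs"
  obtains V s where "openin (top_of_set orthonormal_pairs) V" "x0 \<in> V" "continuous_on V s"
    "\<forall>x\<in>V. spin (s x) = x"
proof (cases "first_square x0 = 0")
  case False
  obtain V r where V: "openin (top_of_set orthonormal_pairs) V" "x0 \<in> V" "continuous_on V r"
      "continuous_on V (\<lambda>x. mixed_product x / r x)" "\<forall>x\<in>V. r x \<noteq> 0 \<and> (r x)\<^sup>2 = first_square x"
    using local_square_root [OF continuous_squares(1,3) assms False] .
  have "spin (r x, mixed_product x / r x) = x" if "x \<in> V" for x
  proof -
    have "x \<in> orthonormal_pairs" using V(1) that openin_imp_subset by blast
    moreover have "r x \<noteq> 0" "(r x)\<^sup>2 = first_square x" "first_square x \<noteq> 0"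
      using bspec [OF V(5) that] by auto
    ultimately show ?thesis
      by (simp add: spin_eq_iff power_divide flip: squares_eq)
  qed
  with V show thesis
    by (intro that [of V "\<lambda>x. (r x, mixed_product x / r x)"]) (auto intro: continuous_on_Pair)
next
  case True
  then have "second_square x0 \<noteq> 0" using spin_nonzero_square [OF assms] by simp
  from local_square_root [OF continuous_squares(2,3) assms this]
  obtain V r where V: "openin (top_of_set orthonormal_pairs) V" "x0 \<in> V" "continuous_on V r"
      "continuous_on V (\<lambda>x. mixed_product x / r x)" "\<forall>x\<in>V. r x \<noteq> 0 \<and> (r x)\<^sup>2 = second_square x" .
  have "spin (mixed_product x / r x, r x) = x" if "x \<in> V" for x
  proof -
    have "x \<in> orthonormal_pairs" using V(1) that openin_imp_subset by blast
    moreover have "r x \<noteq> 0" "(r x)\<^sup>2 = second_square x" "second_square x \<noteq> 0"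
      using bspec [OF V(5) that] by auto
    ultimately show ?thesis
      by (simp add: spin_eq_iff power_divide flip: squares_eq)
  qed
  with V show thesis
    by (intro that [of V "\<lambda>x. (mixed_product x / r x, r x)"]) (auto intro: continuous_on_Pair)
qed

lemma spin_sectioned:
  assumes "x \<in> topspace (top_of_set orthonormal_pairs)"
  shows "\<exists>V. openin (top_of_set orthonormal_pairs) V \<and> x \<in> V \<and>
    sectioned_nhd (top_of_set orthonormal_pairs) (- {0}) spin V"
proof -
  obtain V s where V: "openin (top_of_set orthonormal_pairs) V" "x \<in> V" "continuous_on V s"
      "\<forall>x\<in>V. spin (s x) = x"
    using spin_local_section [of x] assms by (metis topspace_euclidean_subtopology)
  have sub: "V \<subseteq> orthonormal_pairs" using V(1) openin_imp_subset by blast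
  have nz: "q \<noteq> 0" if "spin q \<in> V" for q
    using norm_spinor [of q] that sub by auto
  have top: "subtopology (top_of_set orthonormal_pairs) V = top_of_set V"
    using sub by (simp add: subtopology_subtopology Int_absorb1)
  have "sectioned_nhd (top_of_set orthonormal_pairs) (- {0}) spin V"
    unfolding sectioned_nhd_def top
  proof (intro ballI impI)
    fix e assume e: "e \<in> - {0}" "spin e \<in> V"
    then have "e = s (spin e) \<or> e = - s (spin e)"
      using V(4) spin_eq_spin by metis
    moreover have "continuous_map (top_of_set V) (top_of_set (- {0})) s"
        "continuous_map (top_of_set V) (top_of_set (- {0})) (\<lambda>x. - s x)"
      using V(3,4) nz by (auto simp: continuous_on_minus spin_uminus)
    moreover have "\<forall>y\<in>V. spin (- s y) = y" "\<forall>y\<in>V. spin (s y) = y"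
      using V(4) by (simp_all add: spin_uminus)
    ultimately show "\<exists>s. continuous_map (top_of_set V) (top_of_set (- {0})) s \<and>
        (\<forall>y\<in>V. spin (s y) = y) \<and> s (spin e) = e"
      by metis
  qed
  with V show ?thesis by blast
qed

definition spinor :: "(real^3) \<times> (real^3) \<Rightarrow> complex \<times> complex" where
  "spinor x = (SOME q. spin q = x)"

text \<open>
  The spinors are chosen without regard to continuity. Two nearby pairs have spinors that are nearly
  equal or nearly opposite, and the sign of the inner product tells which.
\<close>

definition spin_sign :: "(real^3) \<times> (real^3) \<Rightarrow> (real^3) \<times> (real^3) \<Rightarrow> int" where
  "spin_sign x y = (if 0 < spinor x \<bullet> spinor y then 1 else - 1)"

lemma spin_spinor: "x \<in> orthonormal_pairs \<Longrightarrow> spin (spinor x) = x"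
  unfolding spinor_def by (rule someI_ex) (metis spin_local_section)

lemma spin_sign_eq:
  assumes "spinor x = of_int a *\<^sub>R p" "spinor y = of_int b *\<^sub>R q" "a \<in> {1, - 1}" "b \<in> {1, - 1}" "0 < p \<bullet> q"
  shows "spin_sign x y = a * b"
  using assms by (auto simp: spin_sign_def)

lemma spinor_cases:
  assumes "spin q = x" "x \<in> orthonormal_pairs"
  obtains a :: int where "spinor x = of_int a *\<^sub>R q" "a \<in> {1, - 1}"
proof -
  have "spinor x = q \<or> spinor x = - q"
    using spin_spinor [OF assms(2)] assms(1) spin_eq_spin by metis
  then show thesis
    using that [of 1] that [of "- 1"] by auto
qed

lemma spin_sign_local:
  assumes "x0 \<in> orthonormal_pairs"
  obtains U a where "openin (top_of_set orthonormal_pairs) U" "x0 \<in> U"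
    "\<forall>x\<in>U. a x \<in> {1, - 1}" "\<forall>x\<in>U. \<forall>y\<in>U. spin_sign x y = a x * a y"
proof -
  obtain V s where V: "openin (top_of_set orthonormal_pairs) V" "x0 \<in> V" "continuous_on V s"
      "\<forall>x\<in>V. spin (s x) = x"
    using spin_local_section [OF assms] .
  have sub: "V \<subseteq> orthonormal_pairs" using V(1) openin_imp_subset by blast
  define U where "U = V \<inter> s -` ball (s x0) (1/2)"
  have "openin (top_of_set V) U"
    unfolding U_def using V(3) by (intro continuous_openin_preimage_gen) auto
  then have "openin (top_of_set orthonormal_pairs) U"
    using V(1) openin_trans by blast
  moreover have "x0 \<in> U" using V(2) by (simp add: U_def)
  moreover have "\<forall>x\<in>V. \<exists>a::int. a \<in> {1, - 1} \<and> spinor x = of_int a *\<^sub>R s x"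
    using spinor_cases V(4) sub by (metis subsetD)
  then obtain a :: "_ \<Rightarrow> int" where a: "\<And>x. x \<in> V \<Longrightarrow> a x \<in> {1, - 1}" "\<And>x. x \<in> V \<Longrightarrow> spinor x = of_int (a x) *\<^sub>R s x"
    by metis
  moreover have "spin_sign x y = a x * a y" if "x \<in> U" "y \<in> U" for x y
  proof (rule spin_sign_eq)
    have "x \<in> V" "y \<in> V" using that by (simp_all add: U_def)
    then have n: "norm (s x) = 1" "norm (s y) = 1"
      using V(4) sub by (metis norm_spinor subsetD)+
    have "dist (s x) (s y) < 1"
      using that dist_triangle_half_r [of "s x0" "s x" 1 "s y"] by (simp add: U_def)
    then have "(norm (s x - s y))\<^sup>2 < 1"
      by (simp add: dist_norm abs_square_less_1)
    then show "0 < s x \<bullet> s y"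
      using n by (simp add: power2_norm_eq_inner inner_diff inner_commute flip: norm_eq_1)
        (simp add: dot_square_norm)
  qed (use a that in \<open>simp_all add: U_def\<close>)
  ultimately show thesis
    using that [of U a] by (simp add: U_def)
qed

section \<open>Triples of pairwise independent unit vectors\<close>

definition frames :: "(real^3^3) set" where
  "frames = {z. (\<forall>i. norm (z $ i) = 1) \<and> (\<forall>i j. i \<noteq> j \<longrightarrow> z $ i \<noteq> z $ j \<and> z $ i \<noteq> - z $ j)}"

text \<open>
  First step of the Gram-Schmidt process for the first two vectors.
\<close>

definition rejection :: "real^3^3 \<Rightarrow> real^3" where
  "rejection z = z $ 2 - (z $ 1 \<bullet> z $ 2) *\<^sub>R z $ 1"

definition frame_pair :: "real^3^3 \<Rightarrow> (real^3) \<times> (real^3)" where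
  "frame_pair z = (z $ 1, rejection z /\<^sub>R norm (rejection z))"

text \<open>
  The second vector is a positive multiple of \<open>slope z *\<^sub>R u + r\<close> for the orthonormal pair \<open>(u, r)\<close>.
\<close>

definition slope :: "real^3^3 \<Rightarrow> real" where
  "slope z = (z $ 1 \<bullet> z $ 2) / norm (rejection z)"

text \<open>
  Coordinates of the third vector in the basis \<open>u\<close>, \<open>slope z *\<^sub>R u + r\<close>, \<open>cross3 u r\<close>. In these coordinates
  the lines of the first two vectors are the first two axes, whatever the angle between them is.
\<close>

definition third_coord :: "real^3^3 \<Rightarrow> point3" where
  "third_coord z = (let (u, r) = frame_pair z; w = z $ 3 in
     (w \<bullet> u - slope z * (w \<bullet> r), w \<bullet> r, w \<bullet> cross3 u r))"

text \<open>
  Left inverse to passing from a triple to its spinor, slope and coordinates. The normalisations make it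
  defined on a whole product with factors \<open>- {0}\<close>, the line and \<open>punctured\<close>, so that homotopies can be
  constructed in each factor separately and then be pushed to triples.
\<close>

definition assemble :: "(complex \<times> complex) \<times> real \<times> point3 \<Rightarrow> real^3^3" where
  "assemble = (\<lambda>(q, a, x, y, z). let (u, r) = spin q; v = a *\<^sub>R u + r in
     vector [sgn u, sgn v, sgn (x *\<^sub>R u + y *\<^sub>R v + z *\<^sub>R cross3 u r)])"

text \<open>
  The fundamental group of the space of triples is the product of a group of order two and a free group.
  The first factor acts by signs. Since the free group meets the centre trivially, nothing is lost by
  multiplying the two.
\<close>

definition frame_cocycle :: "real^3^3 \<Rightarrow> real^3^3 \<Rightarrow> int^2^2" where
  "frame_cocycle z z' =
     mat (spin_sign (frame_pair z) (frame_pair z')) ** crossing (third_coord z) (third_coord z')"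

lemma rejection_nonzero: "z \<in> frames \<Longrightarrow> rejection z \<noteq> 0"
proof
  assume z: "z \<in> frames" and "rejection z = 0"
  then have eq: "z $ 2 = (z $ 1 \<bullet> z $ 2) *\<^sub>R z $ 1"
    by (simp add: rejection_def)
  have n: "norm (z $ 1) = 1" "norm (z $ 2) = 1"
    using z by (simp_all add: frames_def)
  have "norm (z $ 2) = \<bar>z $ 1 \<bullet> z $ 2\<bar> * norm (z $ 1)"
    using arg_cong [OF eq, of norm] by simp
  with n have "z $ 1 \<bullet> z $ 2 = 1 \<or> z $ 1 \<bullet> z $ 2 = - 1"
    by auto
  with eq have "z $ 2 = z $ 1 \<or> z $ 2 = - z $ 1"
    by auto
  moreover have "z $ 2 \<noteq> z $ 1 \<and> z $ 2 \<noteq> - z $ 1"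
  proof -
    have "(2::3) \<noteq> 1" by simp
    then show ?thesis using z unfolding frames_def by blast
  qed
  ultimately show False by blast
qed

lemma frame_pair_orthonormal: "z \<in> frames \<Longrightarrow> frame_pair z \<in> orthonormal_pairs"
proof -
  assume z: "z \<in> frames"
  then have "z $ 1 \<bullet> z $ 1 = 1" "norm (z $ 1) = 1"
    by (simp_all add: frames_def norm_eq_1 [symmetric])
  then show ?thesis
    using rejection_nonzero [OF z]
    by (simp add: orthonormal_pairs_def frame_pair_def rejection_def inner_diff_right)
qed

text \<open>
  The difference of the two sides is orthogonal to \<open>u\<close> and \<open>r\<close>, so its cross product with \<open>cross3 u r\<close>
  vanishes by Lagrange's identity; it is also orthogonal to that vector.
\<close>

lemma cross_basis_expansion:
  assumes "norm u = 1" "norm r = 1" "u \<bullet> r = 0"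
  shows "w = (w \<bullet> u) *\<^sub>R u + (w \<bullet> r) *\<^sub>R r + (w \<bullet> cross3 u r) *\<^sub>R cross3 u r"
proof -
  let ?k = "cross3 u r"
  have k: "u \<bullet> ?k = 0" "?k \<bullet> u = 0" "r \<bullet> ?k = 0" "?k \<bullet> r = 0"
    by (simp_all add: dot_cross_self inner_commute)
  have one: "u \<bullet> u = 1" "r \<bullet> r = 1" "r \<bullet> u = 0"
    using assms by (simp_all add: norm_eq_1 inner_commute)
  have "(norm ?k)\<^sup>2 = 1"
    using norm_cross_dot [of u r] assms by simp
  then have kk: "?k \<bullet> ?k = 1" by (simp add: power2_norm_eq_inner)
  define d where "d = w - ((w \<bullet> u) *\<^sub>R u + (w \<bullet> r) *\<^sub>R r + (w \<bullet> ?k) *\<^sub>R ?k)"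
  have "d \<bullet> u = 0" "d \<bullet> r = 0" "d \<bullet> ?k = 0"
    using assms(3) k one kk by (simp_all add: d_def inner_diff_left inner_add_left)
  then have "cross3 d ?k = 0"
    by (simp add: Lagrange)
  with \<open>d \<bullet> ?k = 0\<close> have "d = 0 \<or> ?k = 0"
    using norm_and_cross_eq_0 by blast
  then have "d = 0"
    using kk by auto
  then show ?thesis by (simp add: d_def)
qed

lemma third_vector:
  assumes z: "z \<in> frames" and ur: "frame_pair z = (u, r)" and xyz: "third_coord z = (x, y, h)"
  shows "z $ 1 = u" "z $ 2 = norm (rejection z) *\<^sub>R (slope z *\<^sub>R u + r)"
    "z $ 3 = x *\<^sub>R u + y *\<^sub>R (slope z *\<^sub>R u + r) + h *\<^sub>R cross3 u r"
proof -
  show u: "z $ 1 = u"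
    using ur by (simp add: frame_pair_def)
  show "z $ 2 = norm (rejection z) *\<^sub>R (slope z *\<^sub>R u + r)"
    using ur rejection_nonzero [OF z]
    by (auto simp: frame_pair_def slope_def scaleR_add_right rejection_def)
  have "norm u = 1" "norm r = 1" "u \<bullet> r = 0"
    using frame_pair_orthonormal [OF z] by (simp_all add: orthonormal_pairs_def ur)
  note expansion = cross_basis_expansion [OF this, of "z $ 3"]
  have c: "x = z $ 3 \<bullet> u - slope z * (z $ 3 \<bullet> r)" "y = z $ 3 \<bullet> r" "h = z $ 3 \<bullet> cross3 u r"
    using xyz by (auto simp: third_coord_def ur Let_def)
  have "x *\<^sub>R u + y *\<^sub>R (slope z *\<^sub>R u + r) + h *\<^sub>R cross3 u r =
      (z $ 3 \<bullet> u) *\<^sub>R u + (z $ 3 \<bullet> r) *\<^sub>R r + (z $ 3 \<bullet> cross3 u r) *\<^sub>R cross3 u r"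
    unfolding c by (simp add: algebra_simps)
  then show "z $ 3 = x *\<^sub>R u + y *\<^sub>R (slope z *\<^sub>R u + r) + h *\<^sub>R cross3 u r"
    using expansion by simp
qed

lemma third_coord_punctured:
  assumes z: "z \<in> frames"
  shows "third_coord z \<in> punctured"
proof (rule ccontr)
  obtain u r where ur: "frame_pair z = (u, r)" by (metis surj_pair)
  obtain x y h where xyz: "third_coord z = (x, y, h)" by (metis surj_pair)
  note v = third_vector [OF z ur xyz]
  assume "third_coord z \<notin> punctured"
  then have h: "h = 0" "x = 0 \<or> y = 0"
    by (auto simp: punctured_def xyz)
  have par: "b = a \<or> b = - a" if "norm a = 1" "norm b = 1" "b = c *\<^sub>R a" for a b :: "real^3" and c
  proof -
    have "norm b = \<bar>c\<bar> * norm a" using that(3) by simp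
    then have "c = 1 \<or> c = - 1" using that by auto
    then show ?thesis using that(3) by auto
  qed
  have n: "norm (z $ i) = 1" for i
    using z by (simp add: frames_def)
  have ne: "z $ i \<noteq> z $ j \<and> z $ i \<noteq> - z $ j" if "i \<noteq> j" for i j
    using z that by (simp add: frames_def)
  have neq: "(3::3) \<noteq> 1" "(3::3) \<noteq> 2" by simp_all
  from h(2) show False
  proof
    assume "y = 0"
    then have "z $ 3 = x *\<^sub>R z $ 1" using v h by simp
    from par [OF n n this] ne [OF neq(1)] show False by blast
  next
    assume "x = 0"
    then have "z $ 3 = (y / norm (rejection z)) *\<^sub>R z $ 2"
      using v h rejection_nonzero [OF z] by simp
    from par [OF n n this] ne [OF neq(2)] show False by blast
  qed
qed

lemma assemble_frame:
  assumes z: "z \<in> frames" and q: "spin q = frame_pair z"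
  shows "assemble (q, slope z, third_coord z) = z"
proof -
  obtain u r where ur: "frame_pair z = (u, r)" by (metis surj_pair)
  obtain x y h where xyz: "third_coord z = (x, y, h)" by (metis surj_pair)
  note v = third_vector [OF z ur xyz]
  have n: "norm (z $ i) = 1" for i
    using z by (simp add: frames_def)
  have "sgn u = z $ 1"
    using v(1) n [of 1] by (simp add: sgn_div_norm)
  moreover have "sgn (slope z *\<^sub>R u + r) = sgn (z $ 2)"
    using rejection_nonzero [OF z] by (simp add: v(2) sgn_scaleR)
  then have "sgn (slope z *\<^sub>R u + r) = z $ 2"
    using n [of 2] by (simp add: sgn_div_norm)
  moreover have "sgn (x *\<^sub>R u + y *\<^sub>R (slope z *\<^sub>R u + r) + h *\<^sub>R cross3 u r) = z $ 3"
    using n [of 3] unfolding v(3) [symmetric] by (simp add: sgn_div_norm)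
  ultimately show ?thesis
    by (simp add: assemble_def Let_def q ur xyz vec_eq_iff [of _ z] forall_3)
qed

lemma continuous_frame_data:
  "continuous_on frames frame_pair" "continuous_on frames slope" "continuous_on frames third_coord"
proof -
  have r: "continuous_on frames rejection"
    unfolding rejection_def by (intro continuous_intros)
  show p: "continuous_on frames frame_pair"
    unfolding frame_pair_def using rejection_nonzero by (intro continuous_intros r) auto
  show s: "continuous_on frames slope"
    unfolding slope_def using rejection_nonzero by (intro continuous_intros r) auto
  have "continuous_on frames (\<lambda>z. (z $ 3 \<bullet> fst (frame_pair z) - slope z * (z $ 3 \<bullet> snd (frame_pair z)),
      z $ 3 \<bullet> snd (frame_pair z), z $ 3 \<bullet> cross3 (fst (frame_pair z)) (snd (frame_pair z))))"
    by (intro continuous_intros continuous_on_cross p s)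
  then show "continuous_on frames third_coord"
    by (simp add: third_coord_def Let_def case_prod_beta)
qed

lemma assemble_components_nonzero:
  assumes "q \<noteq> 0" "(x, y, z) \<in> punctured" "spin q = (u, r)"
    and v_def: "v = a *\<^sub>R u + r" and w_def: "w = x *\<^sub>R u + y *\<^sub>R v + z *\<^sub>R cross3 u r"
  shows "u \<noteq> 0 \<and> v \<noteq> 0 \<and> w \<noteq> 0 \<and> (\<forall>t. u \<noteq> t *\<^sub>R v) \<and> (\<forall>t. u \<noteq> t *\<^sub>R w) \<and> (\<forall>t. v \<noteq> t *\<^sub>R w)"
proof (intro conjI allI)
  let ?k = "cross3 u r"
  have o: "u \<bullet> r = 0" "r \<bullet> u = 0" and uu: "u \<bullet> u \<noteq> 0" and rr: "r \<bullet> r \<noteq> 0"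
    using spin_inner [of q] assms(1,3) by (auto simp: inner_commute)
  have k: "u \<bullet> ?k = 0" "?k \<bullet> u = 0" "r \<bullet> ?k = 0" "?k \<bullet> r = 0"
    by (simp_all add: dot_cross_self inner_commute)
  have "u \<noteq> 0" "r \<noteq> 0" using uu rr by auto
  then have "?k \<noteq> 0"
    using norm_and_cross_eq_0 [of u r] o by blast
  then have kk: "?k \<bullet> ?k \<noteq> 0" by simp
  have vd: "v \<bullet> u = a * (u \<bullet> u)" "v \<bullet> r = r \<bullet> r" "v \<bullet> ?k = 0"
    and wd: "w \<bullet> u = (x + y * a) * (u \<bullet> u)" "w \<bullet> r = y * (r \<bullet> r)" "w \<bullet> ?k = z * (?k \<bullet> ?k)"
    using o k by (simp_all add: v_def w_def inner_add_left algebra_simps)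
  have P: "z \<noteq> 0 \<or> (x \<noteq> 0 \<and> y \<noteq> 0)"
    using assms(2) by (simp add: punctured_def)
  show "u \<noteq> 0" by fact
  show "v \<noteq> 0" using vd(2) rr by auto
  show "w \<noteq> 0" using wd(2,3) rr kk P by auto
  fix t
  show "u \<noteq> t *\<^sub>R v"
  proof
    assume eq: "u = t *\<^sub>R v"
    then have "u \<bullet> r = t * (v \<bullet> r)" by simp
    then have "t = 0" using o vd rr by simp
    then show False using eq \<open>u \<noteq> 0\<close> by simp
  qed
  show "u \<noteq> t *\<^sub>R w"
  proof
    assume eq: "u = t *\<^sub>R w"
    then have "u \<bullet> r = t * (w \<bullet> r)" "u \<bullet> ?k = t * (w \<bullet> ?k)" by simp_all
    moreover have "t \<noteq> 0" using eq \<open>u \<noteq> 0\<close> by auto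
    ultimately have "y = 0" "z = 0" using o k wd rr kk by simp_all
    then show False using P by simp
  qed
  show "v \<noteq> t *\<^sub>R w"
  proof
    assume eq: "v = t *\<^sub>R w"
    then have e: "v \<bullet> u = t * (w \<bullet> u)" "v \<bullet> r = t * (w \<bullet> r)" "v \<bullet> ?k = t * (w \<bullet> ?k)" by simp_all
    have "t \<noteq> 0" using eq \<open>v \<noteq> 0\<close> by auto
    then have "z = 0" using e(3) vd wd kk by simp
    then have "x \<noteq> 0" using P by simp
    have "t * y = 1" using e(2) vd wd rr by simp
    have "a = t * (x + y * a)" using e(1) vd wd uu by simp
    also have "\<dots> = t * x + (t * y) * a" by (simp add: algebra_simps)
    finally have "t * x = 0" using \<open>t * y = 1\<close> by simp
    then show False using \<open>t \<noteq> 0\<close> \<open>x \<noteq> 0\<close> by simp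
  qed
qed

lemma assemble_in_frames:
  assumes "q \<noteq> 0" "n \<in> punctured"
  shows "assemble (q, a, n) \<in> frames"
proof -
  obtain u r where ur: "spin q = (u, r)" by (metis surj_pair)
  obtain x y z where n: "n = (x, y, z)" by (metis surj_pair)
  define v where "v = a *\<^sub>R u + r"
  define w where "w = x *\<^sub>R u + y *\<^sub>R v + z *\<^sub>R cross3 u r"
  note nz = assemble_components_nonzero [OF assms(1) assms(2) [unfolded n] ur v_def w_def]
  have par: "b = (s * norm b / norm c) *\<^sub>R c" if "sgn b = s *\<^sub>R sgn c" "b \<noteq> 0" for b c :: "real^3" and s
  proof -
    have "b = norm b *\<^sub>R sgn b" using that(2) by (simp add: sgn_div_norm)
    also have "\<dots> = (s * norm b / norm c) *\<^sub>R c"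
      by (simp add: that(1)) (simp add: sgn_div_norm field_simps)
    finally show ?thesis .
  qed
  have ne: "sgn b \<noteq> sgn c \<and> sgn b \<noteq> - sgn c" if "b \<noteq> 0" "\<And>t. b \<noteq> t *\<^sub>R c" for b c :: "real^3"
  proof -
    have "sgn b \<noteq> s *\<^sub>R sgn c" for s
      using par [of b s c] that by blast
    from this [of 1] this [of "- 1"] show ?thesis by simp
  qed
  have "sgn u \<noteq> sgn v \<and> sgn u \<noteq> - sgn v" "sgn u \<noteq> sgn w \<and> sgn u \<noteq> - sgn w"
      "sgn v \<noteq> sgn w \<and> sgn v \<noteq> - sgn w"
    using nz by (intro ne; simp)+
  then have "\<forall>i j. i \<noteq> j \<longrightarrow> (vector [sgn u, sgn v, sgn w] :: real^3^3) $ i \<noteq> vector [sgn u, sgn v, sgn w] $ j \<and>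
      (vector [sgn u, sgn v, sgn w] :: real^3^3) $ i \<noteq> - vector [sgn u, sgn v, sgn w] $ j"
    unfolding forall_3 by (auto simp: minus_equation_iff)
  moreover have "assemble (q, a, n) = vector [sgn u, sgn v, sgn w]"
    by (simp add: assemble_def Let_def ur n v_def w_def)
  ultimately show ?thesis
    using nz by (simp add: frames_def forall_3 norm_sgn)
qed

lemma continuous_assemble: "continuous_on ((- {0}) \<times> UNIV \<times> punctured) assemble"
proof -
  let ?E = "(- {0}) \<times> UNIV \<times> punctured :: ((complex \<times> complex) \<times> real \<times> point3) set"
  let ?u = "\<lambda>e. fst (spin (fst e))" and ?r = "\<lambda>e. snd (spin (fst e))"
  let ?v = "\<lambda>e. fst (snd e) *\<^sub>R ?u e + ?r e"
  let ?w = "\<lambda>e. fst (snd (snd e)) *\<^sub>R ?u e + fst (snd (snd (snd e))) *\<^sub>R ?v e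
      + snd (snd (snd (snd e))) *\<^sub>R cross3 (?u e) (?r e)"
  have s: "continuous_on ?E (\<lambda>e. spin (fst e))"
    by (intro continuous_on_compose2 [OF continuous_spin [of UNIV]] continuous_intros) auto
  have u: "continuous_on ?E ?u" and r: "continuous_on ?E ?r"
    using continuous_on_fst [OF s] continuous_on_snd [OF s] by simp_all
  have v: "continuous_on ?E ?v"
    by (intro continuous_intros u r)
  have w: "continuous_on ?E ?w"
    by (intro continuous_intros u r v continuous_on_cross)
  have nz: "?u e \<noteq> 0 \<and> ?v e \<noteq> 0 \<and> ?w e \<noteq> 0" if "e \<in> ?E" for e
    using assemble_components_nonzero [of "fst e" "fst (snd (snd e))" "fst (snd (snd (snd e)))"
        "snd (snd (snd (snd e)))" "?u e" "?r e" "?v e" "fst (snd e)" "?w e"] that by auto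
  have "continuous_on ?E (\<lambda>e. \<chi> i::3. if i = 1 then sgn (?u e) else if i = 2 then sgn (?v e) else sgn (?w e))"
  proof (rule continuous_on_vec_lambda)
    fix i :: 3
    show "continuous_on ?E (\<lambda>e. if i = 1 then sgn (?u e) else if i = 2 then sgn (?v e) else sgn (?w e))"
      using continuous_on_sgn [OF u] continuous_on_sgn [OF v] continuous_on_sgn [OF w] nz
      by (cases "i = 1"; cases "i = 2") auto
  qed
  also have "(\<lambda>e. \<chi> i::3. if i = 1 then sgn (?u e) else if i = 2 then sgn (?v e) else sgn (?w e)) = assemble"
    by (auto simp: fun_eq_iff assemble_def vec_eq_iff forall_3 case_prod_beta Let_def)
  finally show ?thesis .
qed

lemma mat_scalar_mult:
  fixes X Y :: "int^2^2"
  shows "(mat a ** X) ** (mat b ** Y) = mat (a * b) ** (X ** Y)"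
  by (simp add: vec_eq_iff forall_2 sum_2 matrix_matrix_mult_def mat_def algebra_simps)

lemma local_cocycle_frame: "local_cocycle (top_of_set frames) frame_cocycle"
  unfolding local_cocycle_def
proof
  fix z assume "z \<in> topspace (top_of_set frames)"
  then have z: "z \<in> frames" by simp
  obtain U a where U: "openin (top_of_set orthonormal_pairs) U" "frame_pair z \<in> U"
    "\<forall>x\<in>U. a x \<in> {1, - 1}" "\<forall>x\<in>U. \<forall>y\<in>U. spin_sign x y = a x * a y"
    using spin_sign_local [OF frame_pair_orthonormal [OF z]] .
  have "continuous_map (top_of_set frames) (top_of_set punctured) third_coord"
    using continuous_frame_data(3) third_coord_punctured by auto
  from local_cocycleE [OF local_cocycle_pullback [OF local_cocycle_crossing this], of z] z
  obtain W where W: "openin (top_of_set frames) W" "z \<in> W"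
    "cocycle_on W (\<lambda>s t. crossing (third_coord s) (third_coord t))"
    by auto
  have "continuous_map (top_of_set frames) (top_of_set orthonormal_pairs) frame_pair"
    using continuous_frame_data(1) frame_pair_orthonormal by auto
  then have "openin (top_of_set frames) {x \<in> frames. frame_pair x \<in> U}"
    using U(1) by (auto simp: continuous_map_def)
  then have op: "openin (top_of_set frames) ({x \<in> frames. frame_pair x \<in> U} \<inter> W)"
    using W(1) by (rule openin_Int)
  have sq: "a x * a x = 1" if "x \<in> U" for x
    using U(3) that by auto
  have det: "det (mat (a x * a y) :: int^2^2) = 1" if "x \<in> U" "y \<in> U" for x y
    using sq [OF that(1)] sq [OF that(2)] by (simp add: det_2 mat_def algebra_simps)
  have mult: "a x * a y * (a y * a w) = a x * a w" if "y \<in> U" for x y w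
    using sq [OF that] by (simp add: algebra_simps)
  have "cocycle_on ({x \<in> frames. frame_pair x \<in> U} \<inter> W) frame_cocycle"
    using W(3) U(4) unfolding cocycle_on_def frame_cocycle_def
    by (auto simp: sq det_mul det mat_scalar_mult mult)
  with op z U(2) W(2)
  show "\<exists>U. openin (top_of_set frames) U \<and> z \<in> U \<and> cocycle_on U frame_cocycle"
    by (intro exI [of _ "{x \<in> frames. frame_pair x \<in> U} \<inter> W"]) simp
qed

text \<open>
  Multiplying a flat section of \<open>crossing\<close> by the sign that compares the continuous lift \<open>q\<close> with the
  chosen spinors gives a flat section of \<open>frame_cocycle\<close>. Trivial transport therefore forces the
  \<open>crossing\<close> part to be plus or minus the identity, hence the identity, and then the sign is plus as well.
\<close>

lemma frame_loop_components:
  assumes g: "path g" "path_image g \<subseteq> frames" "pathfinish g = pathstart g"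
    and t: "transport frame_cocycle g (mat 1) (mat 1)"
    and q: "path q" "\<forall>t\<in>{0..1}. spin (q t) = frame_pair (g t)"
  shows "pathfinish q = pathstart q"
    "homotopic_paths punctured (third_coord \<circ> g)
       (linepath (third_coord (g 0)) (third_coord (g 0)))"
proof -
  have gZ: "g t \<in> frames" if "t \<in> {0..1}" for t
    using g(2) that by (auto simp: path_image_def)
  have g01: "g 1 = g 0"
    using g(3) by (simp add: pathstart_def pathfinish_def)
  have "continuous_on (path_image g) third_coord"
    using continuous_frame_data(3) g(2) by (rule continuous_on_subset)
  then have n: "path (third_coord \<circ> g)" "path_image (third_coord \<circ> g) \<subseteq> punctured"
    using g third_coord_punctured by (auto simp: path_continuous_image path_image_compose)
  then have "pathin (top_of_set punctured) (third_coord \<circ> g)"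
    by (auto simp: pathin_def path_def path_image_def continuous_map_in_subtopology)
  then obtain N where N: "transport crossing (third_coord \<circ> g) (mat 1) N"
    using transport_exists [OF local_cocycle_crossing] by metis
  then obtain f d where f: "0 < d" "f 0 = mat 1" "f 1 = N"
    "\<And>s t. s \<in> {0..1} \<Longrightarrow> t \<in> {0..1} \<Longrightarrow> \<bar>s - t\<bar> < d \<Longrightarrow>
       f s ** crossing (third_coord (g s)) (third_coord (g t)) = f t"
    unfolding transport_def by auto
  have "\<forall>t\<in>{0..1}. \<exists>a::int. a \<in> {1, - 1} \<and> spinor (frame_pair (g t)) = of_int a *\<^sub>R q t"
    using spinor_cases q(2) gZ frame_pair_orthonormal by metis
  then obtain a :: "real \<Rightarrow> int" where a: "\<And>t. t \<in> {0..1} \<Longrightarrow> a t \<in> {1, - 1}"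
      "\<And>t. t \<in> {0..1} \<Longrightarrow> spinor (frame_pair (g t)) = of_int (a t) *\<^sub>R q t"
    by metis
  have nq: "norm (q t) = 1" if "t \<in> {0..1}" for t
    using bspec [OF q(2) that] norm_spinor frame_pair_orthonormal gZ [OF that] by metis
  have "uniformly_continuous_on {0..1} q"
    using q(1) by (simp add: path_def compact_uniformly_continuous)
  then obtain e where e: "0 < e" "\<And>s t. s \<in> {0..1} \<Longrightarrow> t \<in> {0..1} \<Longrightarrow> dist t s < e \<Longrightarrow> dist (q t) (q s) < 1"
    unfolding uniformly_continuous_on_def by (metis zero_less_one)
  have sign: "spin_sign (frame_pair (g s)) (frame_pair (g t)) = a s * a t"
    if st: "s \<in> {0..1}" "t \<in> {0..1}" "\<bar>s - t\<bar> < e" for s t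
  proof (rule spin_sign_eq)
    have "dist (q s) (q t) < 1"
      using e(2) [of t s] st by (simp add: dist_real_def)
    then have "(norm (q s - q t))\<^sup>2 < 1"
      by (simp add: dist_norm abs_square_less_1)
    then show "0 < q s \<bullet> q t"
      using nq st by (simp add: power2_norm_eq_inner inner_diff inner_commute flip: norm_eq_1)
        (simp add: dot_square_norm)
  qed (use a st in simp_all)
  have sq: "a t * a t = 1" if "t \<in> {0..1}" for t
    using a(1) [OF that] by auto
  have "transport frame_cocycle g (mat 1) (mat (a 0 * a 1) ** N)"
    unfolding transport_def
  proof (intro exI [of _ "\<lambda>t. mat (a 0 * a t) ** f t"] exI [of _ "min d e"] conjI ballI impI)
    show "0 < min d e" using f e by simp
    show "mat (a 0 * a 0) ** f 0 = mat 1" using f sq by simp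
    show "mat (a 0 * a 1) ** f 1 = mat (a 0 * a 1) ** N" using f by simp
    fix s t :: real assume st: "s \<in> {0..1}" "t \<in> {0..1}" "\<bar>s - t\<bar> < min d e"
    have "a 0 * a s * (a s * a t) = a 0 * a t"
      using sq [OF st(1)] by (simp add: algebra_simps)
    moreover have "mat (a 0 * a s) ** f s ** frame_cocycle (g s) (g t) = mat (a 0 * a s * (a s * a t)) ** f t"
      using f(4) [OF st(1,2)] sign [OF st(1,2)] st(3)
      by (simp add: frame_cocycle_def mat_scalar_mult)
    ultimately show "mat (a 0 * a s) ** f s ** frame_cocycle (g s) (g t) = mat (a 0 * a t) ** f t"
      by (simp only:)
  qed
  then have "mat (a 0 * a 1) ** N = mat 1"
    using t transport_unique by blast
  then have "mat (a 0 * a 1) ** (mat (a 0 * a 1) ** N) = mat (a 0 * a 1)"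
    by simp
  moreover have "mat (a 0 * a 1) ** (mat (a 0 * a 1) ** N) = mat (a 0 * a 1 * (a 0 * a 1)) ** N"
    using mat_scalar_mult [of "a 0 * a 1" "mat 1" "a 0 * a 1" N] by simp
  moreover have "a 0 * a 1 * (a 0 * a 1) = (a 0 * a 0) * (a 1 * a 1)"
    by (simp add: algebra_simps)
  ultimately have Na: "N = mat (a 0 * a 1)"
    using sq [of 0] sq [of 1] by simp
  have sgn: "a 0 * a 1 = 1 \<or> a 0 * a 1 = - 1"
    using a(1) [of 0] a(1) [of 1] by auto
  have mat_neg: "mat (- 1) = - (mat 1 :: int^2^2)"
    by (simp add: vec_eq_iff mat_def)
  have "N = mat 1 \<or> N = - mat 1"
    using sgn Na mat_neg by auto
  moreover have "pathfinish (third_coord \<circ> g) = pathstart (third_coord \<circ> g)"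
    using g01 by (simp add: pathfinish_def pathstart_def)
  ultimately have N1: "N = mat 1" and null: "homotopic_paths punctured (third_coord \<circ> g)
       (linepath (third_coord (g 0)) (third_coord (g 0)))"
    using crossing_transport_central [OF n _ N] by (simp_all add: pathstart_def)
  show "homotopic_paths punctured (third_coord \<circ> g)
       (linepath (third_coord (g 0)) (third_coord (g 0)))" by fact
  have "mat (a 0 * a 1) = (mat 1 :: int^2^2)"
    using Na N1 by simp
  then have "a 0 * a 1 = 1"
    by (simp add: vec_eq_iff forall_2 mat_def)
  then have "a 1 = a 0"
    using a(1) [of 0] a(1) [of 1] by auto
  moreover have "of_int (a 1) *\<^sub>R q 1 = of_int (a 0) *\<^sub>R q 0"
    using a(2) [of 0] a(2) [of 1] g01 by simp
  ultimately have "q 1 = q 0"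
    using a(1) [of 0] by auto
  then show "pathfinish q = pathstart q"
    by (simp add: pathfinish_def pathstart_def)
qed

lemma null_homotopy:
  assumes "homotopic_paths S p (linepath a a)"
  shows "\<exists>h. continuous_on ({0..1::real} \<times> {0..1::real}) h \<and> h \<in> {0..1} \<times> {0..1} \<rightarrow> S \<and>
    (\<forall>x\<in>{0..1}. h (0, x) = p x) \<and> (\<forall>x\<in>{0..1}. h (1, x) = a) \<and>
    (\<forall>t\<in>{0..1}. h (t, 0) = a \<and> h (t, 1) = a)"
proof -
  have "pathstart p = a" "pathfinish p = a"
    using homotopic_paths_imp_pathstart [OF assms] homotopic_paths_imp_pathfinish [OF assms] by simp_all
  then show ?thesis
    using assms unfolding homotopic_paths
    by (simp add: pathstart_def pathfinish_def linepath_refl)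
qed

text \<open>
  The lift to the product of spinors, slopes and coordinates is a closed loop, and it contracts in each
  factor: the space of spinors is simply connected, the line is convex, and the loop of coordinates has
  trivial transport.
\<close>

lemma frame_loop_null:
  assumes g: "path g" "path_image g \<subseteq> frames" "pathfinish g = pathstart g"
    and t: "transport frame_cocycle g (mat 1) (mat 1)"
  shows "homotopic_paths frames g (linepath (pathstart g) (pathstart g))"
proof -
  have gZ: "g t \<in> frames" if "t \<in> {0..1}" for t
    using g(2) that by (auto simp: path_image_def)
  have g01: "g 1 = g 0"
    using g(3) by (simp add: pathstart_def pathfinish_def)
  have "continuous_on {0..1} (frame_pair \<circ> g)"
    using g(1) gZ by (intro continuous_on_compose continuous_on_subset [OF continuous_frame_data(1)])
      (auto simp: path_def)
  then have fp: "pathin (top_of_set orthonormal_pairs) (frame_pair \<circ> g)"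
    using gZ frame_pair_orthonormal by (auto simp: pathin_def continuous_map_in_subtopology)
  obtain q0 where q0: "spin q0 = frame_pair (g 0)"
    using spin_spinor [OF frame_pair_orthonormal [OF gZ [of 0]]] by auto
  then have "norm q0 = 1"
    using norm_spinor [of q0] frame_pair_orthonormal [OF gZ [of 0]] by simp
  then have "q0 \<in> - {0}" by auto
  obtain q where q: "path q" "path_image q \<subseteq> - {0}" "q 0 = q0" "\<forall>t\<in>{0..1}. spin (q t) = frame_pair (g t)"
  proof (rule path_lift [OF fp spin_sectioned \<open>q0 \<in> - {0}\<close>])
    show "spin q0 = (frame_pair \<circ> g) 0" using q0 by simp
  qed (use that in auto)
  note components = frame_loop_components [OF g t q(1) q(4)]
  have "simply_connected (- {0 :: complex \<times> complex})"
    by (simp add: simply_connected_punctured_universe_eq)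
  then have "homotopic_paths (- {0}) q (linepath (pathstart q) (pathstart q))"
    using q components(1) unfolding simply_connected_eq_contractible_path by blast
  from null_homotopy [OF this]
  obtain h1 :: "real \<times> real \<Rightarrow> complex \<times> complex" where h1: "continuous_on ({0..1} \<times> {0..1}) h1" "h1 \<in> {0..1} \<times> {0..1} \<rightarrow> - {0}"
      "\<forall>x\<in>{0..1}. h1 (0, x) = q x" "\<forall>x\<in>{0..1}. h1 (1, x) = q 0"
      "\<forall>t\<in>{0..1}. h1 (t, 0) = q 0 \<and> h1 (t, 1) = q 0"
    unfolding pathstart_def by (elim exE conjE)
  from null_homotopy [OF components(2)]
  obtain h2 :: "real \<times> real \<Rightarrow> point3" where h2: "continuous_on ({0..1} \<times> {0..1}) h2" "h2 \<in> {0..1} \<times> {0..1} \<rightarrow> punctured"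
      "\<forall>x\<in>{0..1}. h2 (0, x) = (third_coord \<circ> g) x" "\<forall>x\<in>{0..1}. h2 (1, x) = third_coord (g 0)"
      "\<forall>t\<in>{0..1}. h2 (t, 0) = third_coord (g 0) \<and> h2 (t, 1) = third_coord (g 0)"
    by (elim exE conjE)
  have sl: "continuous_on {0..1} (\<lambda>t. slope (g t))"
    using g(1) gZ by (intro continuous_on_compose2 [OF continuous_frame_data(2)]) (auto simp: path_def)
  define k where "k y = (1 - fst y) * slope (g (snd y)) + fst y * slope (g 0)" for y :: "real \<times> real"
  have k: "continuous_on ({0..1} \<times> {0..1}) k"
    unfolding k_def by (intro continuous_intros continuous_on_compose2 [OF sl]) auto
  let ?h = "\<lambda>y. assemble (h1 y, k y, h2 y)"
  have inE: "(h1 y, k y, h2 y) \<in> (- {0}) \<times> UNIV \<times> punctured" if "y \<in> {0..1} \<times> {0..1}" for y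
    using h1(2) h2(2) that by auto
  have gq: "assemble (q t, slope (g t), third_coord (g t)) = g t" if "t \<in> {0..1}" for t
    using assemble_frame [OF gZ [OF that]] q(4) that by simp
  have "q 1 = q 0"
    using components(1) by (simp add: pathstart_def pathfinish_def)
  show ?thesis
    unfolding homotopic_paths
  proof (intro exI [of _ ?h] conjI ballI)
    show "continuous_on ({0..1} \<times> {0..1}) ?h"
      using h1(1) k h2(1) inE
      by (intro continuous_on_compose2 [OF continuous_assemble] continuous_on_Pair) auto
    show "?h \<in> {0..1} \<times> {0..1} \<rightarrow> frames"
      using inE assemble_in_frames by (auto simp: Pi_iff)
    fix x :: real assume x: "x \<in> {0..1}"
    show "?h (0, x) = g x"
      using h1(3) h2(3) gq x by (simp add: k_def)
    show "?h (1, x) = linepath (pathstart g) (pathstart g) x"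
      using h1(4) h2(4) gq [of 0] x by (simp add: k_def linepath_refl pathstart_def)
    show "pathstart (?h \<circ> Pair x) = pathstart g"
      using bspec [OF h1(5) x] bspec [OF h2(5) x] gq [of 0] by (simp add: pathstart_def k_def algebra_simps)
    show "pathfinish (?h \<circ> Pair x) = pathfinish g"
      using bspec [OF h1(5) x] bspec [OF h2(5) x] gq [of 0] g01
      by (simp add: pathfinish_def k_def algebra_simps)
  qed
qed

section \<open>Configurations of lines\<close>

definition line_of :: "real^3 \<Rightarrow> (real^3) set" where
  "line_of x = {x, - x}"

text \<open>
  The index type \<open>3\<close> is cyclic, so \<open>of_nat\<close> enumerates it from \<open>0\<close>, with \<open>0 = 3\<close>.
\<close>

definition lines_of :: "real^3^3 \<Rightarrow> nat \<Rightarrow> (real^3) set" where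
  "lines_of z = (\<lambda>i\<in>{..<3}. line_of (z $ of_nat i))"

definition config_of :: "real^3^3 \<Rightarrow> (nat \<Rightarrow> (real^3) set) set" where
  "config_of z = permutation_orbit 3 (lines_of z)"

definition signed_perm :: "(3 \<Rightarrow> 3) \<Rightarrow> (3 \<Rightarrow> bool) \<Rightarrow> real^3^3 \<Rightarrow> real^3^3" where
  "signed_perm \<sigma> e z = (\<chi> i. if e i then z $ \<sigma> i else - z $ \<sigma> i)"

definition signed_perms :: "(real^3^3 \<Rightarrow> real^3^3) set" where
  "signed_perms = (\<lambda>(\<sigma>, e). signed_perm \<sigma> e) ` ({\<sigma>. bij \<sigma>} \<times> UNIV)"

lemma line_of_eq_iff: "line_of x = line_of y \<longleftrightarrow> x = y \<or> x = - y"
  by (auto simp: line_of_def doubleton_eq_iff)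

lemma bij_of_nat_3: "bij_betw (of_nat :: nat \<Rightarrow> 3) {..<3} UNIV"
proof -
  have "{..<3::nat} = {0, 1, 2}" by auto
  then have "inj_on (of_nat :: nat \<Rightarrow> 3) {..<3}"
    by (auto simp: inj_on_def)
  moreover from this have "of_nat ` {..<3} = (UNIV :: 3 set)"
    by (intro card_subset_eq) (simp_all add: card_image)
  ultimately show ?thesis by (simp add: bij_betw_def)
qed

lemma ex_index: "\<exists>i<3. j = (of_nat i :: 3)"
  using bij_of_nat_3 by (auto simp: bij_betw_def)

lemma of_nat_3_eq_iff: "i < 3 \<Longrightarrow> j < 3 \<Longrightarrow> (of_nat i :: 3) = of_nat j \<longleftrightarrow> i = j"
  using bij_of_nat_3 by (auto simp: bij_betw_def inj_on_def)

lemma signed_perm_comp: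
  "signed_perm \<sigma> e \<circ> signed_perm \<tau> d = signed_perm (\<tau> \<circ> \<sigma>) (\<lambda>i. e i = d (\<sigma> i))"
  by (auto simp: fun_eq_iff signed_perm_def vec_eq_iff)

lemma signed_perm_id: "signed_perm id (\<lambda>_. True) = id"
  by (auto simp: fun_eq_iff signed_perm_def vec_eq_iff)

lemma signed_permsE:
  assumes "f \<in> signed_perms"
  obtains \<sigma> e where "bij \<sigma>" "f = signed_perm \<sigma> e"
  using assms by (auto simp: signed_perms_def)

lemma signed_permsI: "bij \<sigma> \<Longrightarrow> signed_perm \<sigma> e \<in> signed_perms"
  unfolding signed_perms_def by (rule image_eqI [of _ _ "(\<sigma>, e)"]) auto

lemma dist_signed_perm:
  assumes "bij \<sigma>"
  shows "dist (signed_perm \<sigma> e x) (signed_perm \<sigma> e y) = dist x y"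
proof -
  have "dist (signed_perm \<sigma> e x $ i) (signed_perm \<sigma> e y $ i) = dist (x $ \<sigma> i) (y $ \<sigma> i)" for i
    by (simp add: signed_perm_def dist_minus)
  moreover have "(\<Sum>i\<in>UNIV. (dist (x $ \<sigma> i) (y $ \<sigma> i))\<^sup>2) = (\<Sum>i\<in>UNIV. (dist (x $ i) (y $ i))\<^sup>2)"
    using sum.reindex_bij_betw [OF assms, of "\<lambda>i. (dist (x $ i) (y $ i))\<^sup>2"] .
  ultimately show ?thesis
    by (simp add: dist_vec_def L2_set_def)
qed

lemma neq_uminus: "x \<noteq> 0 \<Longrightarrow> x \<noteq> - x" for x :: "real^3"
proof
  assume "x \<noteq> 0" "x = - x"
  then have "2 *\<^sub>R x = x + - x" by (simp add: scaleR_2)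
  with \<open>x \<noteq> 0\<close> show False by simp
qed

lemma frames_nth:
  assumes "z \<in> frames"
  shows "norm (z $ i) = 1" "z $ i = z $ j \<longleftrightarrow> i = j" "z $ i \<noteq> - z $ j" "- z $ i \<noteq> z $ j"
proof -
  show n: "norm (z $ i) = 1" for i
    using assms by (simp add: frames_def)
  show "z $ i = z $ j \<longleftrightarrow> i = j"
    using assms unfolding frames_def by blast
  show neq: "z $ i \<noteq> - z $ j"
  proof (cases "i = j")
    case True
    have "z $ i \<noteq> 0" using n [of i] by auto
    then show ?thesis using True neq_uminus by metis
  next
    case False
    then show ?thesis using assms unfolding frames_def by blast
  qed
  then show "- z $ i \<noteq> z $ j"
    by (metis minus_minus)
qed

lemma signed_perm_frames:
  assumes "bij \<sigma>" "z \<in> frames"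
  shows "signed_perm \<sigma> e z \<in> frames"
proof -
  have "\<sigma> i = \<sigma> j \<longleftrightarrow> i = j" for i j
    using assms(1) by (metis bij_pointE)
  then show ?thesis
    using frames_nth [OF assms(2)]
    by (auto simp: frames_def signed_perm_def minus_equation_iff)
qed

lemma signed_perm_eq_iff:
  assumes "z \<in> frames"
  shows "signed_perm \<sigma> e z = signed_perm \<tau> d z \<longleftrightarrow> \<sigma> = \<tau> \<and> e = d"
proof
  assume eq: "signed_perm \<sigma> e z = signed_perm \<tau> d z"
  have "\<sigma> i = \<tau> i \<and> e i = d i" for i
  proof -
    have "signed_perm \<sigma> e z $ i = signed_perm \<tau> d z $ i" using eq by simp
    then show ?thesis
      using frames_nth [OF assms]
      by (auto simp: signed_perm_def minus_equation_iff split: if_splits)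
  qed
  then show "\<sigma> = \<tau> \<and> e = d" by auto
qed simp

lemma mat_1_in_frames: "(mat 1 :: real^3^3) \<in> frames"
proof -
  have eq: "(mat 1 :: real^3^3) $ i = axis i 1" for i
    by (auto simp: mat_def axis_def vec_eq_iff)
  have "axis i 1 \<noteq> (- axis j 1 :: real^3)" for i j
  proof
    assume "axis i 1 = (- axis j 1 :: real^3)"
    then have "(axis i 1 :: real^3) $ i = (- axis j 1 :: real^3) $ i" by simp
    then show False by (auto simp: axis_def split: if_splits)
  qed
  then show ?thesis
    by (simp add: frames_def eq axis_eq_axis)
qed

text \<open>
  The hyperoctahedral group: six permutations times eight choices of signs.
\<close>

lemma card_signed_perms: "card signed_perms = 48"
proof -
  have "inj_on (\<lambda>(\<sigma>, e). signed_perm \<sigma> e) ({\<sigma>. bij \<sigma>} \<times> UNIV)"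
  proof (intro inj_onI, clarify)
    fix \<sigma> \<tau> :: "3 \<Rightarrow> 3" and e d
    assume "signed_perm \<sigma> e = signed_perm \<tau> d"
    then have "signed_perm \<sigma> e (mat 1) = signed_perm \<tau> d (mat 1)" by simp
    then show "\<sigma> = \<tau> \<and> e = d"
      using signed_perm_eq_iff [OF mat_1_in_frames] by blast
  qed
  then have "card signed_perms = card ({\<sigma> :: 3 \<Rightarrow> 3. bij \<sigma>} \<times> (UNIV :: (3 \<Rightarrow> bool) set))"
    unfolding signed_perms_def by (rule card_image)
  also have "{\<sigma> :: 3 \<Rightarrow> 3. bij \<sigma>} = {\<sigma>. \<sigma> permutes UNIV}"
    by (auto intro: bij_imp_permutes permutes_bij)
  also have "card ({\<sigma> :: 3 \<Rightarrow> 3. \<sigma> permutes UNIV} \<times> (UNIV :: (3 \<Rightarrow> bool) set)) = 48"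
    using card_permutations [of "UNIV :: 3 set" 3]
    by (simp add: card_cartesian_product card_fun fact_numeral)
  finally show ?thesis .
qed

lemma lines_of_eq_iff:
  "lines_of w = lines_of z \<circ> \<pi> \<longleftrightarrow> (\<forall>i<3. line_of (w $ of_nat i) = line_of (z $ of_nat (\<pi> i)))"
  if "\<pi> permutes {..<3}"
proof -
  have lt: "\<pi> i < 3 \<longleftrightarrow> i < 3" for i
    using permutes_in_image [OF that, of i] by simp
  show ?thesis
    by (auto simp: lines_of_def fun_eq_iff restrict_def lt)
qed

text \<open>
  Two triples have the same lines up to order exactly if each vector of one is, up to sign, a vector of
  the other; the vectors being pairwise independent, this matching is a bijection.
\<close>

lemma config_of_eq_iff:
  assumes z: "z \<in> frames" and w: "w \<in> frames"
  shows "config_of z = config_of w \<longleftrightarrow> (\<exists>f\<in>signed_perms. w = f z)"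
proof
  assume eq: "config_of z = config_of w"
  have "lines_of w \<in> config_of w"
    unfolding config_of_def permutation_orbit_def by (auto intro!: exI [of _ id] simp: permutes_id)
  then obtain \<pi> where \<pi>: "\<pi> permutes {..<3}" "lines_of w = lines_of z \<circ> \<pi>"
    unfolding eq [symmetric] by (auto simp: config_of_def permutation_orbit_def)
  have \<pi>_lines: "line_of (w $ of_nat i) = line_of (z $ of_nat (\<pi> i))" if "i < 3" for i
    using \<pi>(2) that unfolding lines_of_eq_iff [OF \<pi>(1)] by blast
  have "\<exists>k. w $ j = z $ k \<or> w $ j = - z $ k" for j
    using ex_index [of j] \<pi>_lines unfolding line_of_eq_iff by blast
  then obtain \<sigma> where \<sigma>: "\<And>j. w $ j = z $ \<sigma> j \<or> w $ j = - z $ \<sigma> j"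
    by metis
  have "inj \<sigma>"
  proof (rule injI)
    fix i j assume "\<sigma> i = \<sigma> j"
    then have "w $ i = w $ j \<or> w $ i = - w $ j"
      using \<sigma> [of i] \<sigma> [of j] by auto
    then show "i = j" using frames_nth [OF w] by auto
  qed
  then have "bij \<sigma>"
    by (simp add: bij_def finite_UNIV_inj_surj)
  moreover have "w = signed_perm \<sigma> (\<lambda>j. w $ j = z $ \<sigma> j) z"
    using \<sigma> by (auto simp: signed_perm_def vec_eq_iff [of w])
  ultimately show "\<exists>f\<in>signed_perms. w = f z"
    using signed_permsI by blast
next
  assume "\<exists>f\<in>signed_perms. w = f z"
  then obtain \<sigma> e where \<sigma>: "bij \<sigma>" "w = signed_perm \<sigma> e z"
    by (auto elim: signed_permsE)
  define \<kappa> where "\<kappa> = inv_into {..<3} (of_nat :: nat \<Rightarrow> 3)"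
  have \<kappa>: "bij_betw \<kappa> UNIV {..<3}"
    unfolding \<kappa>_def using bij_betw_inv_into [OF bij_of_nat_3] .
  have of_\<kappa>: "of_nat (\<kappa> j) = j" for j
    unfolding \<kappa>_def using bij_betw_inv_into_right [OF bij_of_nat_3] by simp
  define \<pi> where "\<pi> i = (if i < 3 then \<kappa> (\<sigma> (of_nat i)) else i)" for i :: nat
  have "bij_betw (\<kappa> \<circ> (\<sigma> \<circ> of_nat)) {..<3} {..<3}"
    using bij_betw_trans [OF bij_betw_trans [OF bij_of_nat_3 \<sigma>(1)] \<kappa>] by (simp add: comp_assoc)
  then have "bij_betw \<pi> {..<3} {..<3}"
    by (rule bij_betw_cong [THEN iffD1, rotated]) (simp add: \<pi>_def)
  then have \<pi>: "\<pi> permutes {..<3}"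
    by (rule bij_imp_permutes) (simp add: \<pi>_def)
  have "lines_of w = lines_of z \<circ> \<pi>"
    unfolding lines_of_eq_iff [OF \<pi>]
    by (auto simp: line_of_eq_iff \<pi>_def of_\<kappa> \<sigma>(2) signed_perm_def)
  then show "config_of z = config_of w"
    unfolding config_of_def permutation_orbit_def
  proof (intro equalityI subsetI; clarify)
    fix \<tau> assume \<tau>: "\<tau> permutes {..<3::nat}"
    have "inv_into UNIV \<pi> \<circ> \<tau> permutes {..<3}"
      using permutes_compose [OF \<tau> permutes_inv [OF \<pi>]] .
    moreover assume "lines_of w = lines_of z \<circ> \<pi>"
    then have "lines_of z \<circ> \<tau> = lines_of w \<circ> (inv_into UNIV \<pi> \<circ> \<tau>)"
      using permutes_inv_o(1) [OF \<pi>] by (metis comp_assoc comp_id)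
    ultimately show "\<exists>\<sigma>. lines_of z \<circ> \<tau> = lines_of w \<circ> \<sigma> \<and> \<sigma> permutes {..<3}"
      by blast
  next
    fix \<tau> assume \<tau>: "\<tau> permutes {..<3::nat}"
    have "\<pi> \<circ> \<tau> permutes {..<3}"
      using permutes_compose [OF \<tau> \<pi>] .
    moreover assume "lines_of w = lines_of z \<circ> \<pi>"
    then have "lines_of w \<circ> \<tau> = lines_of z \<circ> (\<pi> \<circ> \<tau>)"
      by (simp add: comp_assoc)
    ultimately show "\<exists>\<sigma>. lines_of w \<circ> \<tau> = lines_of z \<circ> \<sigma> \<and> \<sigma> permutes {..<3}"
      by blast
  qed
qed

lemma projective_plane_alt: "projective_plane = quotient_topology (top_of_set (sphere 0 1)) line_of"
  by (simp add: projective_plane_def line_of_def [abs_def])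

lemma openin_projective_plane_image:
  assumes "open A"
  shows "openin projective_plane (line_of ` (A \<inter> sphere 0 1))"
proof -
  have "{x \<in> sphere 0 1. line_of x \<in> line_of ` (A \<inter> sphere 0 1)} = sphere 0 1 \<inter> (A \<union> uminus ` A)"
    by (force simp: image_iff line_of_eq_iff)
  moreover have "open (A \<union> uminus ` A)"
    using assms open_negations by blast
  ultimately show ?thesis
    by (auto simp: projective_plane_alt openin_quotient_topology openin_open_Int)
qed

lemma topspace_projective_plane: "topspace projective_plane = line_of ` sphere 0 1"
  by (simp add: projective_plane_alt)

lemma lines_of_in_config_space:
  assumes "z \<in> frames"
  shows "lines_of z \<in> topspace (ordered_config_space 3 projective_plane)"
proof -
  have "inj_on (lines_of z) {..<3}"
    using frames_nth [OF assms] of_nat_3_eq_iff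
    by (auto simp: inj_on_def lines_of_def line_of_eq_iff)
  then show ?thesis
    using frames_nth(1) [OF assms]
    by (auto simp: ordered_config_space_def lines_of_def topspace_projective_plane)
qed

lemma lines_of_surj:
  assumes x: "x \<in> topspace (ordered_config_space 3 projective_plane)"
    and y: "\<And>i. i < 3 \<Longrightarrow> x i = line_of (y i) \<and> norm (y i) = 1"
  obtains w where "w \<in> frames" "lines_of w = x" "\<And>i. i < 3 \<Longrightarrow> w $ of_nat i = y i"
proof -
  define w :: "real^3^3" where "w = (\<chi> j. y (inv_into {..<3} of_nat j))"
  have wy: "w $ of_nat i = y i" if "i < 3" for i
    using bij_betw_inv_into_left [OF bij_of_nat_3, of i] that by (simp add: w_def)
  have inj: "inj_on x {..<3}" and ext: "x \<in> extensional {..<3}"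
    using x by (auto simp: ordered_config_space_def PiE_def)
  have "norm (w $ j) = 1" for j
    using ex_index [of j] wy y by metis
  moreover have "w $ j \<noteq> w $ k \<and> w $ j \<noteq> - w $ k" if jk: "j \<noteq> k" for j k
  proof -
    obtain a b where ab: "a < 3" "b < 3" "j = of_nat a" "k = of_nat b"
      using ex_index by metis
    with jk have "x a \<noteq> x b"
      using inj by (auto simp: inj_on_def)
    then show ?thesis
      using y [OF ab(1)] y [OF ab(2)] wy [OF ab(1)] wy [OF ab(2)] ab(3,4) by (simp add: line_of_eq_iff)
  qed
  ultimately have "w \<in> frames"
    by (simp add: frames_def)
  moreover have "lines_of w = x"
    using ext y wy by (auto simp: lines_of_def fun_eq_iff restrict_def extensional_def)
  ultimately show thesis
    using that wy by blast
qed

lemma config_space_lines: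
  assumes "x \<in> topspace (ordered_config_space 3 projective_plane)"
  shows "\<forall>i<3. \<exists>y. x i = line_of y \<and> norm y = 1"
proof (intro allI impI)
  fix i :: nat assume "i < 3"
  then have "x i \<in> line_of ` sphere 0 1"
    using assms by (auto simp: ordered_config_space_def PiE_def Pi_def topspace_projective_plane)
  then show "\<exists>y. x i = line_of y \<and> norm y = 1" by auto
qed

text \<open>
  An open set of triples contains a product of three open sets, the map to the projective plane is open,
  and the constraint that the lines be distinct is the same on both sides.
\<close>

lemma lines_of_open:
  assumes V: "openin (top_of_set frames) V"
  shows "openin (ordered_config_space 3 projective_plane) (lines_of ` V)"
proof (subst openin_subopen, intro ballI)
  let ?C = "ordered_config_space 3 projective_plane"
  fix x assume "x \<in> lines_of ` V"
  then obtain z where z: "z \<in> V" "x = lines_of z" by blast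
  obtain T where T: "open T" "V = frames \<inter> T"
    using V by (auto simp: openin_open)
  then obtain A where A: "\<And>i. open (A i) \<and> z $ i \<in> A i" "\<And>y. \<forall>i. y $ i \<in> A i \<Longrightarrow> y \<in> T"
    using z(1) unfolding open_vec_def by (metis IntD2)
  have zf: "z \<in> frames" using z T by simp
  let ?P = "\<Pi>\<^sub>E i\<in>{..<3}. line_of ` (A (of_nat i) \<inter> sphere 0 1)"
  let ?W = "?P \<inter> topspace ?C"
  have P: "openin (product_topology (\<lambda>_. projective_plane) {..<3::nat}) ?P"
    using A(1) by (simp add: openin_PiE openin_projective_plane_image)
  have "?W = ?P \<inter> {x. inj_on x {..<3}}"
    using openin_subset [OF P] unfolding ordered_config_space_def topspace_subtopology by blast
  then have "openin ?C ?W"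
    using openin_subtopology_Int [OF P] unfolding ordered_config_space_def by simp
  moreover have "lines_of z \<in> ?P"
    unfolding lines_of_def using A(1) frames_nth(1) [OF zf] by auto
  then have "x \<in> ?W"
    using lines_of_in_config_space [OF zf] z(2) by blast
  moreover have "?W \<subseteq> lines_of ` V"
  proof
    fix x' assume x': "x' \<in> ?W"
    have "\<exists>y. x' i = line_of y \<and> y \<in> A (of_nat i) \<and> norm y = 1" if "i < 3" for i
    proof -
      have "x' i \<in> line_of ` (A (of_nat i) \<inter> sphere 0 1)"
        using x' that by (auto simp: PiE_def Pi_def)
      then show ?thesis by auto
    qed
    then obtain y where y: "\<And>i. i < 3 \<Longrightarrow> x' i = line_of (y i) \<and> y i \<in> A (of_nat i) \<and> norm (y i) = 1"
      by metis
    obtain w where w: "w \<in> frames" "lines_of w = x'" "\<And>i. i < 3 \<Longrightarrow> w $ of_nat i = y i"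
      using lines_of_surj [of x' y] x' y by blast
    have "w $ j \<in> A j" for j
      using ex_index [of j] w(3) y by metis
    then show "x' \<in> lines_of ` V"
      using A(2) w T by blast
  qed
  ultimately show "\<exists>W. openin ?C W \<and> x \<in> W \<and> W \<subseteq> lines_of ` V"
    by blast
qed

lemma continuous_lines_of:
  "continuous_map (top_of_set frames) (ordered_config_space 3 projective_plane) lines_of"
proof -
  have "continuous_map (top_of_set frames) projective_plane (\<lambda>z. lines_of z i)" if "i < 3" for i
  proof -
    have "continuous_map (top_of_set frames) (top_of_set (sphere 0 1)) (\<lambda>z. z $ of_nat i)"
      using frames_nth(1) by (auto intro!: continuous_intros)
    moreover have "continuous_map (top_of_set (sphere 0 1)) projective_plane line_of"
      unfolding projective_plane_alt
      by (rule quotient_imp_continuous_map [OF quotient_map_quotient_topology])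
    ultimately have "continuous_map (top_of_set frames) projective_plane (line_of \<circ> (\<lambda>z. z $ of_nat i))"
      by (rule continuous_map_compose)
    then show ?thesis
      using that by (simp add: lines_of_def o_def)
  qed
  then have "continuous_map (top_of_set frames) (product_topology (\<lambda>_. projective_plane) {..<3}) lines_of"
    by (auto simp: continuous_map_componentwise lines_of_def)
  then show ?thesis
    using lines_of_in_config_space
    by (auto simp: ordered_config_space_def continuous_map_in_subtopology)
qed

text \<open>
  Openness of the covering map: an open set is first saturated under the signed permutations, after which
  its image is tested before the permutation of the lines is divided out.
\<close>

interpretation frames_cover: finite_isometric_quotient frames signed_perms
  "unordered_config_space 3 projective_plane" config_of
proof
  let ?C = "ordered_config_space 3 projective_plane"
  show "finite signed_perms"
    using card_signed_perms by (simp add: card_ge_0_finite)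
  show "id \<in> signed_perms"
    using signed_permsI [of id] signed_perm_id by (metis bij_id)
  show "f \<circ> g \<in> signed_perms" if fg: "f \<in> signed_perms" "g \<in> signed_perms" for f g
  proof -
    obtain \<sigma> e \<tau> d where "bij \<sigma>" "f = signed_perm \<sigma> e" "bij \<tau>" "g = signed_perm \<tau> d"
      using fg by (metis signed_permsE)
    then show ?thesis
      by (simp add: signed_perm_comp signed_permsI bij_comp)
  qed
  show "\<exists>g\<in>signed_perms. f \<circ> g = id \<and> g \<circ> f = id" if f: "f \<in> signed_perms" for f
  proof -
    obtain \<sigma> e where \<sigma>: "bij \<sigma>" "f = signed_perm \<sigma> e"
      using f by (rule signed_permsE)
    let ?\<tau> = "inv_into UNIV \<sigma>"
    have inv: "\<sigma> \<circ> ?\<tau> = id" "?\<tau> \<circ> \<sigma> = id" "?\<tau> (\<sigma> i) = i" for i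
      using \<sigma>(1) by (auto simp: fun_eq_iff bij_is_inj bij_is_surj surj_f_inv_f)
    have "f \<circ> signed_perm ?\<tau> (\<lambda>i. e (?\<tau> i)) = id" "signed_perm ?\<tau> (\<lambda>i. e (?\<tau> i)) \<circ> f = id"
      by (simp_all add: \<sigma>(2) signed_perm_comp inv signed_perm_id)
    moreover have "signed_perm ?\<tau> (\<lambda>i. e (?\<tau> i)) \<in> signed_perms"
      using \<sigma>(1) by (intro signed_permsI bij_imp_bij_inv)
    ultimately show ?thesis by blast
  qed
  show "dist (f x) (f y) = dist x y" if "f \<in> signed_perms" for f x y
    using that by (elim signed_permsE) (simp add: dist_signed_perm)
  show "f z \<in> frames" if "f \<in> signed_perms" "z \<in> frames" for f z
    using that by (elim signed_permsE) (simp add: signed_perm_frames)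
  show "f = id" if f: "f \<in> signed_perms" and z: "z \<in> frames" "f z = z" for f z
  proof -
    obtain \<sigma> e where \<sigma>: "f = signed_perm \<sigma> e"
      using f by (rule signed_permsE)
    have "signed_perm \<sigma> e z = signed_perm id (\<lambda>_. True) z"
      using z(2) \<sigma> by (simp add: signed_perm_id)
    then show ?thesis
      using signed_perm_eq_iff [OF z(1)] \<sigma> signed_perm_id by metis
  qed
  show "config_of z = config_of w \<longleftrightarrow> (\<exists>f\<in>signed_perms. w = f z)"
    if "z \<in> frames" "w \<in> frames" for z w
    using config_of_eq_iff that .
  have "continuous_map ?C (unordered_config_space 3 projective_plane) (permutation_orbit 3)"
    unfolding unordered_config_space_def
    by (rule quotient_imp_continuous_map [OF quotient_map_quotient_topology])
  from continuous_map_compose [OF continuous_lines_of this]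
  show "continuous_map (top_of_set frames) (unordered_config_space 3 projective_plane) config_of"
    by (simp add: config_of_def [abs_def] o_def)
  show surj: "config_of ` frames = topspace (unordered_config_space 3 projective_plane)"
  proof -
    have "lines_of ` frames = topspace ?C"
    proof
      show "lines_of ` frames \<subseteq> topspace ?C"
        using lines_of_in_config_space by blast
      show "topspace ?C \<subseteq> lines_of ` frames"
      proof
        fix x assume x: "x \<in> topspace ?C"
        then obtain y where "\<And>i. i < 3 \<Longrightarrow> x i = line_of (y i) \<and> norm (y i) = 1"
          using config_space_lines by metis
        then show "x \<in> lines_of ` frames"
          using lines_of_surj [OF x] by blast
      qed
    qed
    then show ?thesis
      unfolding config_of_def image_image [symmetric, of "permutation_orbit 3" lines_of]
      by (simp add: unordered_config_space_def)
  qed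
  show "openin (unordered_config_space 3 projective_plane) (config_of ` U)"
    if U: "openin (top_of_set frames) U" for U
  proof -
    have Uf: "U \<subseteq> frames" using U openin_imp_subset by blast
    let ?KU = "{w \<in> frames. \<exists>z\<in>U. config_of z = config_of w}"
    have "openin (top_of_set frames) ?KU"
    proof -
      have KU: "?KU = (\<Union>f\<in>signed_perms. frames \<inter> f -` U)"
      proof (intro equalityI subsetI)
        fix w assume "w \<in> ?KU"
        then obtain z where z: "w \<in> frames" "z \<in> U" "config_of w = config_of z" by auto
        then have "z \<in> frames" using Uf by blast
        from config_of_eq_iff [OF z(1) this] z(3) obtain f where "f \<in> signed_perms" "z = f w" by blast
        with z(1,2) show "w \<in> (\<Union>f\<in>signed_perms. frames \<inter> f -` U)" by auto
      next
        fix w assume "w \<in> (\<Union>f\<in>signed_perms. frames \<inter> f -` U)"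
        then obtain f where f: "f \<in> signed_perms" "w \<in> frames" "f w \<in> U" by auto
        then have "f w \<in> frames" using Uf by blast
        from config_of_eq_iff [OF f(2) this] f(1) have "config_of w = config_of (f w)" by blast
        with f show "w \<in> ?KU" by auto
      qed
      have "openin (top_of_set frames) (frames \<inter> f -` U)" if f: "f \<in> signed_perms" for f
      proof -
        obtain \<sigma> e where \<sigma>: "bij \<sigma>" "f = signed_perm \<sigma> e"
          using f by (rule signed_permsE)
        have "continuous_on frames f"
          unfolding continuous_on_iff \<sigma>(2) dist_signed_perm [OF \<sigma>(1)] by blast
        moreover have "f \<in> frames \<rightarrow> frames"
          using signed_perm_frames [OF \<sigma>(1)] \<sigma>(2) by auto
        ultimately show ?thesis
          using U continuous_openin_preimage by blast
      qed
      then show ?thesis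
        unfolding KU by (intro openin_Union) blast
    qed
    from lines_of_open [OF this] have opn: "openin ?C (lines_of ` ?KU)" .
    have KU: "lines_of ` ?KU = {x \<in> topspace ?C. permutation_orbit 3 x \<in> config_of ` U}"
    proof (intro equalityI subsetI)
      fix x assume "x \<in> lines_of ` ?KU"
      then obtain w z where wz: "x = lines_of w" "w \<in> frames" "z \<in> U" "config_of z = config_of w"
        by blast
      then have "permutation_orbit 3 x \<in> config_of ` U"
        by (metis config_of_def imageI)
      then show "x \<in> {x \<in> topspace ?C. permutation_orbit 3 x \<in> config_of ` U}"
        using lines_of_in_config_space wz(1,2) by simp
    next
      fix x assume x: "x \<in> {x \<in> topspace ?C. permutation_orbit 3 x \<in> config_of ` U}"
      then have "\<forall>i<3. \<exists>y. x i = line_of y \<and> norm y = 1"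
        using config_space_lines by blast
      then obtain y where "\<And>i. i < 3 \<Longrightarrow> x i = line_of (y i) \<and> norm (y i) = 1"
        by metis
      then obtain w where w: "w \<in> frames" "lines_of w = x"
        using lines_of_surj [of x y] x by blast
      then have "config_of w \<in> config_of ` U"
        using x by (simp add: config_of_def)
      then show "x \<in> lines_of ` ?KU"
        using w by fastforce
    qed
    \<comment> \<open>Together with the previous equation this is openness in the quotient topology.\<close>
    have sub: "config_of ` U \<subseteq> permutation_orbit 3 ` topspace ?C"
    proof
      fix y assume "y \<in> config_of ` U"
      then obtain z where "z \<in> frames" "y = permutation_orbit 3 (lines_of z)"
        using Uf by (auto simp: config_of_def)
      then show "y \<in> permutation_orbit 3 ` topspace ?C"
        using lines_of_in_config_space by blast
    qed
    show ?thesis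
      unfolding unordered_config_space_def openin_quotient_topology
      by (rule conjI [OF sub opn [unfolded KU]])
  qed
qed

section \<open>Transport as a homomorphism\<close>

lemma transport_hom:
  fixes c :: "'a \<Rightarrow> 'a \<Rightarrow> int^'n^'n"
  assumes c: "local_cocycle X c" and b: "b \<in> topspace X"
  obtains \<phi> where "\<phi> \<in> hom (fundamental_group X b) (special_linear_group :: (int^'n^'n) monoid)"
    "\<forall>p\<in>loops X b. transport c p (mat 1) (\<phi> (loop_class X b p))"
proof -
  let ?G = "fundamental_group X b"
  have carr: "carrier ?G = loop_class X b ` loops X b"
    by (simp add: fundamental_group_def)
  have "\<exists>N. \<forall>p\<in>loops X b. A = loop_class X b p \<longrightarrow> transport c p (mat 1) N \<and> det N = 1"
    if A: "A \<in> carrier ?G" for A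
  proof -
    obtain q where q: "q \<in> loops X b" "A = loop_class X b q"
      using A carr by auto
    obtain N where N: "transport c q (mat 1) N" "det N = det (mat 1 :: int^'n^'n)"
      using transport_exists [OF c, of q "mat 1"] q(1) by (auto simp: loops_def)
    have "transport c p (mat 1) N" if "p \<in> loops X b" "A = loop_class X b p" for p
    proof -
      have "loop_homotopic X b q p"
        using q that loop_class_eq_iff by metis
      then show ?thesis
        using transport_homotopic [OF c _ N(1)] unfolding loop_homotopic_def by blast
    qed
    then show ?thesis using N(2) by auto
  qed
  then obtain \<phi> where \<phi>: "\<And>A p. A \<in> carrier ?G \<Longrightarrow> p \<in> loops X b \<Longrightarrow> A = loop_class X b p \<Longrightarrow>
      transport c p (mat 1) (\<phi> A) \<and> det (\<phi> A) = 1"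
    by metis
  have tr: "transport c p (mat 1) (\<phi> (loop_class X b p))" "det (\<phi> (loop_class X b p)) = 1"
    if "p \<in> loops X b" for p
    using \<phi> [of "loop_class X b p" p] that carr by auto
  have "\<phi> (loop_class X b p \<otimes>\<^bsub>?G\<^esub> loop_class X b q) = \<phi> (loop_class X b p) ** \<phi> (loop_class X b q)"
    if pq: "p \<in> loops X b" "q \<in> loops X b" for p q
  proof -
    have j: "loop_join p q \<in> loops X b"
      using loop_join_loops pq .
    have "transport c (loop_join p q) (mat 1) (\<phi> (loop_class X b p) ** \<phi> (loop_class X b q))"
    proof (rule transport_join [OF c])
      show "pathin X (loop_join p q)" "p 1 = q 0"
        using j pq by (simp_all add: loops_def)
      show "transport c p (mat 1) (\<phi> (loop_class X b p))"
        using tr pq by blast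
      show "transport c q (\<phi> (loop_class X b p)) (\<phi> (loop_class X b p) ** \<phi> (loop_class X b q))"
        using transport_mult_left [OF tr(1) [OF pq(2)], of "\<phi> (loop_class X b p)"] by simp
    qed
    then show ?thesis
      using transport_unique [OF _ tr(1) [OF j]] fundamental_group_mult [OF pq] by metis
  qed
  then have "\<phi> \<in> hom ?G (special_linear_group :: (int^'n^'n) monoid)"
    using tr(2) by (auto simp: hom_def carr special_linear_group_def)
  then show thesis
    using that tr(1) by blast
qed

text \<open>
  Equality of two transports is turned into triviality of one by multiplying with an inverse in the
  fundamental group; the monoid of matrices is only used as a target.
\<close>

lemma transport_faithful:
  fixes c :: "'a \<Rightarrow> 'a \<Rightarrow> int^'n^'n"
  assumes c: "local_cocycle X c" and b: "b \<in> topspace X"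
    and null: "\<And>p. p \<in> loops X b \<Longrightarrow> transport c p (mat 1) (mat 1) \<Longrightarrow> loop_homotopic X b p (\<lambda>_. b)"
  shows "\<exists>\<phi> \<in> hom (fundamental_group X b) (special_linear_group :: (int^'n^'n) monoid).
           inj_on \<phi> (carrier (fundamental_group X b))"
proof -
  let ?G = "fundamental_group X b"
  interpret G: group ?G using group_fundamental_group [OF b] .
  have carr: "carrier ?G = loop_class X b ` loops X b" and one: "\<one>\<^bsub>?G\<^esub> = loop_class X b (\<lambda>_. b)"
    by (simp_all add: fundamental_group_def)
  obtain \<phi> where hom: "\<phi> \<in> hom ?G (special_linear_group :: (int^'n^'n) monoid)"
    and tr: "\<forall>p\<in>loops X b. transport c p (mat 1) (\<phi> (loop_class X b p))"
    using transport_hom [OF c b] .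
  have mult: "\<phi> (x \<otimes>\<^bsub>?G\<^esub> y) = \<phi> x ** \<phi> y" if "x \<in> carrier ?G" "y \<in> carrier ?G" for x y
    using hom_mult [OF hom that] by (simp add: special_linear_group_def)
  have "c b b = mat 1"
    using c b unfolding local_cocycle_def cocycle_on_def by metis
  then have "transport c (\<lambda>_. b) (mat 1) (mat 1)"
    unfolding transport_def by (intro exI [of _ "\<lambda>_. mat 1"] exI [of _ 1]) simp
  then have \<phi>1: "\<phi> \<one>\<^bsub>?G\<^esub> = mat 1"
    using transport_unique tr const_loops [OF b] one by metis
  have "inj_on \<phi> (carrier ?G)"
  proof (rule inj_onI)
    fix x y assume xy: "x \<in> carrier ?G" "y \<in> carrier ?G" "\<phi> x = \<phi> y"
    let ?d = "x \<otimes>\<^bsub>?G\<^esub> inv\<^bsub>?G\<^esub> y"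
    have d: "?d \<in> carrier ?G" using xy by simp
    have "\<phi> ?d = \<phi> y ** \<phi> (inv\<^bsub>?G\<^esub> y)"
      using xy by (simp add: mult)
    also have "\<dots> = \<phi> (y \<otimes>\<^bsub>?G\<^esub> inv\<^bsub>?G\<^esub> y)"
      using xy by (intro mult [symmetric]) simp_all
    also have "\<dots> = mat 1"
      using xy(2) \<phi>1 G.r_inv by simp
    finally have "\<phi> ?d = mat 1" .
    moreover obtain p where p: "p \<in> loops X b" "?d = loop_class X b p"
      using d carr by auto
    ultimately have "transport c p (mat 1) (mat 1)"
      using tr by metis
    then have "?d = \<one>\<^bsub>?G\<^esub>"
      using null [OF p(1)] p one loop_class_eq_iff by metis
    then show "x = y"
      using xy by (metis G.inv_closed G.inv_equality G.inv_inv)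
  qed
  with hom show ?thesis by blast
qed

text \<open>
  The loop lifts to a closed loop of triples with trivial transport; its contraction is pushed down.
\<close>

lemma unordered_loop_null:
  fixes \<beta> :: "96 \<Rightarrow> 48 \<times> 2"
  assumes \<beta>: "bij \<beta>"
    and p: "p \<in> loops (unordered_config_space 3 projective_plane) b"
    and t: "transport (frames_cover.induced \<beta> frame_cocycle) p (mat 1) (mat 1)"
  shows "loop_homotopic (unordered_config_space 3 projective_plane) b p (\<lambda>_. b)"
proof -
  let ?X = "unordered_config_space 3 projective_plane"
  have p01: "pathin ?X p" "p 0 = b" "p 1 = b"
    using p by (simp_all add: loops_def)
  then have "b \<in> topspace ?X"
    by (metis atLeastAtMost_iff path_start_in_topspace)
  then have "p 0 \<in> config_of ` frames"
    using p01(2) by (simp add: frames_cover.p_surj)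
  then obtain z0 where z0: "z0 \<in> frames" "config_of z0 = p 0"
    by (metis imageE)
  obtain g where g: "path g" "path_image g \<subseteq> frames" "g 0 = z0" "\<forall>t\<in>{0..1}. config_of (g t) = p t"
    using frames_cover.lift_path [OF p01(1) z0] by metis
  have card: "CARD(48) = card signed_perms"
    by (simp add: card_signed_perms)
  have "g 0 = g 1" "transport frame_cocycle g (mat 1) (mat 1)"
    using frames_cover.induced_transport_trivial [OF card \<beta> local_cocycle_frame g(1,2) _ _ t]
      g(4) p01 by simp_all
  then have "homotopic_paths frames g (linepath (g 0) (g 0))"
    using frame_loop_null [OF g(1,2)] by (simp add: pathstart_def pathfinish_def)
  then have "homotopic_with (\<lambda>r. r 0 = g 0 \<and> r 1 = g 0) (top_of_set {0..1}) (top_of_set frames) g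
      (linepath (g 0) (g 0))"
    using \<open>g 0 = g 1\<close> by (simp add: homotopic_paths_def pathstart_def pathfinish_def)
  then have "homotopic_with (\<lambda>r. r 0 = b \<and> r 1 = b) (top_of_set {0..1}) ?X (config_of \<circ> g)
      (config_of \<circ> linepath (g 0) (g 0))"
    by (rule homotopic_with_compose_continuous_map_left [OF _ frames_cover.p_continuous])
      (use g(3) z0(2) p01 in auto)
  then have "homotopic_with (\<lambda>r. r 0 = b \<and> r 1 = b) (top_of_set {0..1}) ?X p (\<lambda>_. b)"
  proof (rule homotopic_with_eq)
    show "p x = (config_of \<circ> g) x" if "x \<in> topspace (top_of_set {0..1})" for x
      using g(4) that by simp
    show "b = (config_of \<circ> linepath (g 0) (g 0)) x" for x
      using g(3) z0(2) p01 by (simp add: linepath_refl)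
  qed simp
  then show ?thesis
    by (simp add: loop_homotopic_def)
qed

theorem theorem6p2:
  fixes b :: "(nat \<Rightarrow> (real^3) set) set"
  assumes "b \<in> topspace (unordered_config_space 3 projective_plane)"
  shows "\<exists>\<phi> \<in> hom (projective_braid_group 3 b) (special_linear_group :: (int^96^96) monoid).
           inj_on \<phi> (carrier (projective_braid_group 3 b))"
proof -
  \<comment> \<open>Forty-eight points in each fibre, with a block of size two for each.\<close>
  have "\<exists>\<beta> :: 96 \<Rightarrow> 48 \<times> 2. bij \<beta>"
    by (rule finite_same_card_bij) simp_all
  then obtain \<beta> :: "96 \<Rightarrow> 48 \<times> 2" where \<beta>: "bij \<beta>" by blast
  have "CARD(48) = card signed_perms"
    by (simp add: card_signed_perms)
  then have "local_cocycle (unordered_config_space 3 projective_plane) (frames_cover.induced \<beta> frame_cocycle)"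
    using \<beta> local_cocycle_frame by (rule frames_cover.local_cocycle_induced)
  then show ?thesis
    unfolding projective_braid_group_def
    by (rule transport_faithful [OF _ assms unordered_loop_null [OF \<beta>]])
qed

end
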